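(* Let $p,q\ge1$, $n=p+q$, let $\gamma$ be a non-crossing $(p,q)$-clan (no two arcs cross) and let $v\in S_n$. Write $\mathfrak{S}_{u_\gamma}(x;y)\mathfrak{S}_v(x;y)=\sum_w d^{w}_{u_\gamma,v}(y)\mathfrak{S}_w(x;y)$. Then $$d^{w_0v_\gamma}_{u_\gamma,v}(y_1,\ldots,y_n)=c_{\gamma,w_0v}(y_n,\ldots,y_1),$$ where $w_0=n\cdots 21$ and $c_{\gamma,w}(y)$ denotes the coefficient of $\mathfrak{S}_w(x;y)$ in the expansion $\Upsilon_\gamma(x;y)=\sum_{w\in S_n}c_{\gamma,w}(y)\mathfrak{S}_w(x;y)$.
   Context: Clans. A $(p,q)$-clan $\gamma$: nodes $1,\ldots,n$, a set of pairwise disjoint pairs $(i,j)$, $i<j$, called arcs, and a sign $\pm$ on each node not on an arc, with $\#\{+\}-\#\{-\}=p-q$. Arcs $(i,j),(k,l)$ cross if $i<k<j<l$. Matchless means no arcs. $v_\gamma\in S_n$: label nodes that are $+$ or left endpoints by $1,\ldots,p$ left to right, and nodes that are $-$ or right endpoints by $p+1,\ldots,n$ left to right; $v_\gamma(i)$ = label of node $i$. $u_\gamma$: label nodes that are $-$ or left endpoints by $1,\ldots,q$ left to right, and nodes that are $+$ or right endpoints by $q+1,\ldots,n$; $u_\gamma(i)$ = label of node $i$. Products of permutations are compositions. Double Schubert polynomials: $\mathfrak{S}_{w_0}(x;y)=\prod_{i+j\le n}(x_i-y_j)$, $\mathfrak{S}_{ws_i}=\partial_i\mathfrak{S}_w$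 if $\ell(ws_i)<\ell(w)$, $\partial_if=(f-f|_{x_i\leftrightarrow x_{i+1}})/(x_i-x_{i+1})$ (extended stably to all permutations $w$ of $S_\infty$; the coefficients $d^w_{u,v}(y)$ are the unique polynomial coefficients of the product expansion). Length and 0-Hecke action: $\ell(\gamma)=\sum_{\text{arcs}(i,j)}(j-i)-\#\{\text{crossing pairs}\}$. For $1\le i\le n-1$: if nodes $i,i+1$ have opposite signs, $s_i*\gamma$ adds the arc $(i,i+1)$; otherwise with $\gamma'$ = $\gamma$ with nodes $i,i+1$ swapped, $s_i*\gamma=\gamma'$ if $\ell(\gamma')>\ell(\gamma)$, else $s_i*\gamma=\gamma$. $\Upsilon_\gamma(x;y)$ (Wyser–Yong): $\Upsilon_\gamma=\mathfrak{S}_{u_\gamma}(x;y_n,\ldots,y_1)\mathfrak{S}_{v_\gamma}(x;y)$ for matchless $\gamma$, and $\Upsilon_{s_i*\gamma}=\partial_i\Upsilon_\gamma$ whenever $\ell(s_i*\gamma)>\ell(\gamma)$. It expands uniquely as a $\mathbb{Q}[y]$-combination of $\mathfrak{S}_w(x;y)$, $w\in S_n$. *)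

theory Defs
  imports Complex_Main "HOL-Library.Poly_Mapping" "HOL-Combinatorics.Permutations"
begin

section \<open>Polynomials in \<open>x\<close> over \<open>\<rat>[y]\<close>\<close>

text \<open>
  A polynomial in \<open>t\<^sub>0, t\<^sub>1, \<dots>\<close> over \<open>R\<close> is an element of \<open>(nat \<Rightarrow>\<^sub>0 nat) \<Rightarrow>\<^sub>0 R\<close>, i.e. a finitely
  supported function on exponent vectors. The polynomials in \<open>x\<close> and \<open>y\<close> are nested,
  \<open>\<rat>[y][x]\<close>, so that the coefficients of Schubert expansions are elements of \<open>\<rat>[y]\<close>.
  All variables that are used have indices \<open>\<ge> 1\<close>.
\<close>

type_synonym ypoly = "(nat \<Rightarrow>\<^sub>0 nat) \<Rightarrow>\<^sub>0 rat"
type_synonym xypoly = "(nat \<Rightarrow>\<^sub>0 nat) \<Rightarrow>\<^sub>0 ypoly"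

definition scalar :: "ypoly \<Rightarrow> xypoly" where
  "scalar c = Poly_Mapping.single 0 c"

definition X :: "nat \<Rightarrow> xypoly" where
  "X i = Poly_Mapping.single (Poly_Mapping.single i 1) 1"

definition Y :: "nat \<Rightarrow> xypoly" where
  "Y j = scalar (Poly_Mapping.single (Poly_Mapping.single j 1) 1)"

text \<open>
  The substitution \<open>t\<^sub>i \<mapsto> t\<^bsub>\<sigma> i\<^esub>\<close>, for a bijection \<open>\<sigma>\<close>: the coefficient of \<open>t\<^sup>m\<close> in the
  result is the coefficient of \<open>t\<^bsup>m \<circ> \<sigma>\<^esup>\<close> in the argument.
  (\<^const>\<open>Poly_Mapping.map_key\<close> is meaningful only for injective maps.)
\<close>

definition rename_vars :: "(nat \<Rightarrow> nat) \<Rightarrow> ((nat \<Rightarrow>\<^sub>0 nat) \<Rightarrow>\<^sub>0 'a::zero) \<Rightarrow> ((nat \<Rightarrow>\<^sub>0 nat) \<Rightarrow>\<^sub>0 'a)" where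
  "rename_vars \<sigma> f = Poly_Mapping.map_key (Poly_Mapping.map_key \<sigma>) f"

definition rename_y :: "(nat \<Rightarrow> nat) \<Rightarrow> xypoly \<Rightarrow> xypoly" where
  "rename_y \<sigma> f = Poly_Mapping.map (rename_vars \<sigma>) f"

text \<open>
  The quotient \<open>(f - s\<^sub>i f) / (x\<^sub>i - x\<^bsub>i+1\<^esub>)\<close>; it exists in \<open>\<rat>[y][x]\<close> and is unique because
  \<^typ>\<open>xypoly\<close> is an integral domain.
\<close>

definition divdiff :: "nat \<Rightarrow> xypoly \<Rightarrow> xypoly" where
  "divdiff i f = (THE g. (X i - X (i + 1)) * g = f - rename_vars (transpose i (i + 1)) f)"


section \<open>Permutations and double Schubert polynomials\<close>

text \<open>
  \<open>S\<^sub>n\<close> consists of the functions that permute \<open>{1..n}\<close> and fix every other natural number,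
  so \<open>S\<^sub>n \<subseteq> S\<^bsub>n+1\<^esub>\<close> and \<open>S\<^sub>\<infinity>\<close> is the union.
\<close>

definition Sym :: "nat \<Rightarrow> (nat \<Rightarrow> nat) set" where
  "Sym n = {w. w permutes {1..n}}"

definition Sym_inf :: "(nat \<Rightarrow> nat) set" where
  "Sym_inf = (\<Union>n. Sym n)"

definition perm_length :: "(nat \<Rightarrow> nat) \<Rightarrow> nat" where
  "perm_length w = card {(i, j). i < j \<and> w j < w i}"

definition w0 :: "nat \<Rightarrow> nat \<Rightarrow> nat" where
  "w0 n i = (if i \<in> {1..n} then n + 1 - i else i)"

inductive is_schubert :: "nat \<Rightarrow> (nat \<Rightarrow> nat) \<Rightarrow> xypoly \<Rightarrow> bool" for n where
  top: "is_schubert n (w0 n) (\<Prod>(i, j) \<in> {(i, j). 1 \<le> i \<and> 1 \<le> j \<and> i + j \<le> n}. X i - Y j)"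
| step: "is_schubert n w f \<Longrightarrow> 1 \<le> i \<Longrightarrow> i < n
    \<Longrightarrow> perm_length (w \<circ> transpose i (i + 1)) < perm_length w
    \<Longrightarrow> is_schubert n (w \<circ> transpose i (i + 1)) (divdiff i f)"

text \<open>
  For \<open>w \<in> S\<^sub>\<infinity>\<close>. The polynomial does not depend on the chain of divided differences, nor on the
  choice of \<open>n\<close> with \<open>w \<in> S\<^sub>n\<close> (stability).
\<close>

definition schubert :: "(nat \<Rightarrow> nat) \<Rightarrow> xypoly" where
  "schubert w = (THE f. \<exists>n. is_schubert n w f)"

definition is_schubert_expansion ::
    "(nat \<Rightarrow> nat) set \<Rightarrow> xypoly \<Rightarrow> ((nat \<Rightarrow> nat) \<Rightarrow> ypoly) \<Rightarrow> bool" where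
  "is_schubert_expansion A f c \<longleftrightarrow>
     finite {w. c w \<noteq> 0} \<and> {w. c w \<noteq> 0} \<subseteq> A \<and>
     f = (\<Sum>w | c w \<noteq> 0. scalar (c w) * schubert w)"

definition schubert_coeff :: "(nat \<Rightarrow> nat) set \<Rightarrow> xypoly \<Rightarrow> (nat \<Rightarrow> nat) \<Rightarrow> ypoly" where
  "schubert_coeff A f = (THE c. is_schubert_expansion A f c)"

text \<open>The product expansion runs over \<open>S\<^sub>\<infinity>\<close>.\<close>

definition structure_coeff :: "(nat \<Rightarrow> nat) \<Rightarrow> (nat \<Rightarrow> nat) \<Rightarrow> (nat \<Rightarrow> nat) \<Rightarrow> ypoly" where
  "structure_coeff u v w = schubert_coeff Sym_inf (schubert u * schubert v) w"


section \<open>Clans\<close>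

record clan =
  arcs :: "(nat \<times> nat) set"
  plus_nodes :: "nat set"
  minus_nodes :: "nat set"

definition is_clan :: "nat \<Rightarrow> nat \<Rightarrow> clan \<Rightarrow> bool" where
  "is_clan p q \<gamma> \<longleftrightarrow>
     (\<forall>(i, j) \<in> arcs \<gamma>. 1 \<le> i \<and> i < j \<and> j \<le> p + q) \<and>
     (\<forall>(i, j) \<in> arcs \<gamma>. \<forall>(k, l) \<in> arcs \<gamma>. (i, j) \<noteq> (k, l) \<longrightarrow> {i, j} \<inter> {k, l} = {}) \<and>
     plus_nodes \<gamma> \<union> minus_nodes \<gamma> = {1..p + q} - (fst ` arcs \<gamma> \<union> snd ` arcs \<gamma>) \<and>
     plus_nodes \<gamma> \<inter> minus_nodes \<gamma> = {} \<and>
     int (card (plus_nodes \<gamma>)) - int (card (minus_nodes \<gamma>)) = int p - int q"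

definition matchless :: "clan \<Rightarrow> bool" where
  "matchless \<gamma> \<longleftrightarrow> arcs \<gamma> = {}"

text \<open>Since the condition is asymmetric, each crossing pair of arcs occurs in exactly one order.\<close>

definition crossings :: "clan \<Rightarrow> ((nat \<times> nat) \<times> (nat \<times> nat)) set" where
  "crossings \<gamma> = {((i, j), (k, l)). (i, j) \<in> arcs \<gamma> \<and> (k, l) \<in> arcs \<gamma> \<and> i < k \<and> k < j \<and> j < l}"

definition noncrossing :: "clan \<Rightarrow> bool" where
  "noncrossing \<gamma> \<longleftrightarrow> crossings \<gamma> = {}"

definition clan_length :: "clan \<Rightarrow> int" where
  "clan_length \<gamma> = (\<Sum>(i, j) \<in> arcs \<gamma>. int j - int i) - int (card (crossings \<gamma>))"

definition swap_nodes :: "nat \<Rightarrow> clan \<Rightarrow> clan" where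
  "swap_nodes i \<gamma> = (let s = transpose i (i + 1) in
     \<lparr>arcs = (\<lambda>(a, b). (min (s a) (s b), max (s a) (s b))) ` arcs \<gamma>,
      plus_nodes = s ` plus_nodes \<gamma>,
      minus_nodes = s ` minus_nodes \<gamma>\<rparr>)"

definition opposite_signs :: "nat \<Rightarrow> clan \<Rightarrow> bool" where
  "opposite_signs i \<gamma> \<longleftrightarrow>
     (i \<in> plus_nodes \<gamma> \<and> i + 1 \<in> minus_nodes \<gamma>) \<or> (i \<in> minus_nodes \<gamma> \<and> i + 1 \<in> plus_nodes \<gamma>)"

definition hecke :: "nat \<Rightarrow> clan \<Rightarrow> clan" where
  "hecke i \<gamma> =
     (if opposite_signs i \<gamma> then
        \<lparr>arcs = insert (i, i + 1) (arcs \<gamma>),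
         plus_nodes = plus_nodes \<gamma> - {i, i + 1},
         minus_nodes = minus_nodes \<gamma> - {i, i + 1}\<rparr>
      else if clan_length (swap_nodes i \<gamma>) > clan_length \<gamma> then swap_nodes i \<gamma>
      else \<gamma>)"

text \<open>
  The nodes in \<open>L \<subseteq> {1..n}\<close> are labelled \<open>1, 2, \<dots>\<close> and the remaining nodes of \<open>{1..n}\<close> are
  labelled \<open>k + 1, k + 2, \<dots>\<close>, both from left to right.
\<close>

definition node_label :: "nat \<Rightarrow> nat \<Rightarrow> nat set \<Rightarrow> nat \<Rightarrow> nat" where
  "node_label n k L i =
     (if i \<notin> {1..n} then i
      else if i \<in> L then card {j \<in> L. j \<le> i}
      else k + card {j \<in> {1..i}. j \<notin> L})"

definition v_perm :: "nat \<Rightarrow> nat \<Rightarrow> clan \<Rightarrow> nat \<Rightarrow> nat" where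
  "v_perm p q \<gamma> = node_label (p + q) p (plus_nodes \<gamma> \<union> fst ` arcs \<gamma>)"

definition u_perm :: "nat \<Rightarrow> nat \<Rightarrow> clan \<Rightarrow> nat \<Rightarrow> nat" where
  "u_perm p q \<gamma> = node_label (p + q) q (minus_nodes \<gamma> \<union> fst ` arcs \<gamma>)"


section \<open>The Wyser--Yong polynomials\<close>

text \<open>
  The recursion that defines the family \<open>\<Upsilon>\<^sub>\<gamma>\<close> of \<open>(p, q)\<close>-clans. Every clan is reached from a
  matchless one by length-increasing steps, so the recursion determines \<open>\<Upsilon>\<^sub>\<gamma>\<close> on all clans;
  its consistency is a theorem of Wyser and Yong.
\<close>

definition wyser_yong :: "nat \<Rightarrow> nat \<Rightarrow> (clan \<Rightarrow> xypoly) \<Rightarrow> bool" where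
  "wyser_yong p q \<Upsilon> \<longleftrightarrow>
     (\<forall>\<gamma>. is_clan p q \<gamma> \<and> matchless \<gamma> \<longrightarrow>
        \<Upsilon> \<gamma> = rename_y (w0 (p + q)) (schubert (u_perm p q \<gamma>)) * schubert (v_perm p q \<gamma>)) \<and>
     (\<forall>\<gamma> i. is_clan p q \<gamma> \<and> 1 \<le> i \<and> i < p + q \<and> clan_length (hecke i \<gamma>) > clan_length \<gamma> \<longrightarrow>
        \<Upsilon> (hecke i \<gamma>) = divdiff i (\<Upsilon> \<gamma>))"

end

theory Submission
  imports Defs
begin

text \<open>
  For a non-crossing clan, \<open>\<Upsilon>\<^sub>\<gamma> = \<SS>(u\<^sub>\<gamma>; x, y\<^sub>n, \<dots>, y\<^sub>1) \<SS>(v\<^sub>\<gamma>; x, y)\<close> holds exactly: shrinking an innermost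
  arc yields a predecessor \<open>\<gamma>'\<close> with \<open>s\<^sub>i * \<gamma>' = \<gamma>\<close> for which one of the two labellings changes
  by \<open>s\<^sub>i\<close>, while the Schubert polynomial of the other one is symmetric in \<open>x\<^sub>i, x\<^bsub>i+1\<^esub>\<close>.
  Integration over the flag variety (up to a factor, the alternating sum of the values at
  \<open>x = (y\<^bsub>v(1)\<^esub>, \<dots>, y\<^bsub>v(n)\<^esub>)\<close>, \<open>v \<in> S\<^sub>n\<close>) makes the divided differences self-adjoint, hence the
  families \<open>\<SS>(w; x, y)\<close> and \<open>\<SS>(w\<^sub>0 w; x, y\<^sub>n, \<dots>, y\<^sub>1)\<close> dual to each other, and it kills
  \<open>\<SS>(w)\<close> for \<open>w \<notin> S\<^sub>n\<close>. Both coefficients are therefore the integral of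
  \<open>\<SS>(u\<^sub>\<gamma>; x, y) \<SS>(v; x, y) \<SS>(v\<^sub>\<gamma>; x, y\<^sub>n, \<dots>, y\<^sub>1)\<close>.
\<close>

section \<open>Substitution homomorphisms\<close>

text \<open>Both coefficients in the statement are definite descriptions, so the duality computation
  says nothing until the two expansions are known to exist and to be unique. Uniqueness is cheap:
  localization at the identity, combined with divided differences, reads off every coefficient.
  Existence is the obstacle. A polynomial in x_1, ..., x_N of degree at most N - l in each x_l is a
  combination of the Schubert polynomials of S_N. For the product this applies with N = 2n, but
  \<Upsilon> at \<gamma> must expand within S_n, and two factors bounded by n - l each are too
  large. Each factor therefore gets a finer bound: the number of right ends of inversions beyond l,
  whatever their left ends. For the two clan labellings these numbers add up to at most the number
  of nodes beyond l, since an arc that starts beyond l also ends there. The integral is not divided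
  by the Vandermonde product, so the localization sum needs no fractions; the factor this leaves is
  nonzero and is cancelled at the end.\<close>

locale rhom =
  fixes h :: "'a::comm_ring_1 \<Rightarrow> 'b::comm_ring_1"
  assumes one: "h 1 = 1"
    and add: "h (a + b) = h a + h b"
    and mult: "h (a * b) = h a * h b"
begin

lemma zero: "h 0 = 0"
  using add[of 0 0] by simp

lemma diff: "h (a - b) = h a - h b"
  using add[of "a - b" b] by (simp add: algebra_simps)

lemma sum: "h (sum f A) = (\<Sum>x\<in>A. h (f x))"
  by (induction A rule: infinite_finite_induct) (auto simp: zero add)

lemma prod: "h (prod f A) = (\<Prod>x\<in>A. h (f x))"
  by (induction A rule: infinite_finite_induct) (auto simp: one mult)

end

lemma rhom_comp: "rhom g \<Longrightarrow> rhom h \<Longrightarrow> rhom (\<lambda>x. g (h x))"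
  by (simp add: rhom_def)

lemma poly_mapping_sum_single:
  "f = (\<Sum>m\<in>Poly_Mapping.keys f. Poly_Mapping.single m (Poly_Mapping.lookup f m))"
proof (rule poly_mapping_eqI)
  fix k
  show "Poly_Mapping.lookup f k = Poly_Mapping.lookup (\<Sum>m\<in>Poly_Mapping.keys f.
      Poly_Mapping.single m (Poly_Mapping.lookup f m)) k"
    by (cases "k \<in> Poly_Mapping.keys f")
      (auto simp: lookup_sum lookup_single when_def sum.delta in_keys_iff)
qed

lemma poly_mapping_induct_single [case_names single add]:
  assumes "\<And>m c. P (Poly_Mapping.single m c)"
    and "\<And>f g. P f \<Longrightarrow> P g \<Longrightarrow> P (f + g)"
  shows "P (f :: 'a \<Rightarrow>\<^sub>0 'b::comm_monoid_add)"
proof -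
  have "P (\<Sum>m\<in>A. Poly_Mapping.single m (Poly_Mapping.lookup f m))" if "finite A" for A
    using that
  proof (induction A)
    case empty
    show ?case using assms(1)[of _ 0] by simp
  next
    case (insert x A)
    then show ?case using assms by simp
  qed
  then show ?thesis
    using poly_mapping_sum_single[of f] by (metis finite_keys)
qed

text \<open>The universal map out of a monoid algebra: \<phi> acts on coefficients and \<chi>, which
  has to be multiplicative, on monomials.\<close>

definition extend_hom :: "('a::comm_ring_1 \<Rightarrow> 'b::comm_ring_1) \<Rightarrow> ('m \<Rightarrow> 'b) \<Rightarrow> ('m \<Rightarrow>\<^sub>0 'a) \<Rightarrow> 'b" where
  "extend_hom \<phi> \<chi> f = (\<Sum>m\<in>Poly_Mapping.keys f. \<phi> (Poly_Mapping.lookup f m) * \<chi> m)"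

lemma extend_hom_single:
  "\<phi> 0 = 0 \<Longrightarrow> extend_hom \<phi> \<chi> (Poly_Mapping.single m c) = \<phi> c * \<chi> m"
  by (simp add: extend_hom_def)

lemma extend_hom_add:
  assumes "rhom \<phi>"
  shows "extend_hom \<phi> \<chi> (f + g) = extend_hom \<phi> \<chi> f + extend_hom \<phi> \<chi> g"
  unfolding extend_hom_def
  using rhom.add[OF assms] rhom.zero[OF assms]
  by (intro setsum_keys_plus_distrib) (auto simp: algebra_simps)

lemma rhom_extend_hom:
  fixes \<chi> :: "'m::comm_monoid_add \<Rightarrow> 'b::comm_ring_1"
  assumes \<phi>: "rhom \<phi>" and \<chi>: "\<chi> 0 = 1" "\<And>m m'. \<chi> (m + m') = \<chi> m * \<chi> m'"
  shows "rhom (extend_hom \<phi> \<chi>)"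
proof
  note [simp] = extend_hom_add[OF \<phi>] extend_hom_single[of \<phi>, OF rhom.zero[OF \<phi>]]
  show "extend_hom \<phi> \<chi> 1 = 1"
    using extend_hom_single[of \<phi> \<chi> 0 1] \<phi> \<chi> by (simp add: rhom.zero rhom.one)
  show "extend_hom \<phi> \<chi> (a + b) = extend_hom \<phi> \<chi> a + extend_hom \<phi> \<chi> b" for a b
    by simp
  show "extend_hom \<phi> \<chi> (a * b) = extend_hom \<phi> \<chi> a * extend_hom \<phi> \<chi> b" for a b
  proof (induction a rule: poly_mapping_induct_single)
    case (single m c)
    show ?case
    proof (induction b rule: poly_mapping_induct_single)
      case (single m c)
      then show ?case by (simp add: mult_single rhom.mult[OF \<phi>] \<chi>)
    qed (simp add: algebra_simps)
  qed (simp add: algebra_simps)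
qed

lemma rhom_id: "rhom (\<lambda>x. x)"
  by unfold_locales auto

lemma rhom_single_0: "rhom (Poly_Mapping.single (0::'m::comm_monoid_add))"
  by unfold_locales (auto simp: single_add mult_single)

lemma exponent_induct [case_names zero unit add]:
  fixes m :: "nat \<Rightarrow>\<^sub>0 nat"
  assumes "P 0" "\<And>i. P (Poly_Mapping.single i 1)" "\<And>m m'. P m \<Longrightarrow> P m' \<Longrightarrow> P (m + m')"
  shows "P m"
proof (induction m rule: poly_mapping_induct_single)
  case (single i k)
  show ?case
  proof (induction k)
    case (Suc k)
    have "Poly_Mapping.single i (Suc k) = Poly_Mapping.single i 1 + Poly_Mapping.single i k"
      by (simp flip: single_add)
    then show ?case using Suc assms by metis
  qed (use assms in simp)
qed (use assms in simp)

section \<open>Renaming of the variables x and y\<close>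

lemma map_key_single_bij:
  assumes "bij \<sigma>"
  shows "Poly_Mapping.map_key \<sigma> (Poly_Mapping.single (\<sigma> i) c) = Poly_Mapping.single i c"
  using map_key_single[of \<sigma> i c] bij_is_inj[OF assms] by blast

lemma lookup_map_key:
  "inj \<sigma> \<Longrightarrow> Poly_Mapping.lookup (Poly_Mapping.map_key \<sigma> m) i = Poly_Mapping.lookup m (\<sigma> i)"
  by (simp add: map_key.rep_eq)

lemma inj_map_key:
  assumes "bij \<sigma>"
  shows "inj (Poly_Mapping.map_key \<sigma> :: ('a \<Rightarrow>\<^sub>0 'b::zero) \<Rightarrow> _)"
proof (rule injI)
  fix a b :: "'a \<Rightarrow>\<^sub>0 'b"
  assume eq: "Poly_Mapping.map_key \<sigma> a = Poly_Mapping.map_key \<sigma> b"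
  show "a = b"
  proof (rule poly_mapping_eqI)
    fix k
    obtain j where "k = \<sigma> j" using assms by (metis bij_pointE)
    then show "Poly_Mapping.lookup a k = Poly_Mapping.lookup b k"
      using eq lookup_map_key[OF bij_is_inj[OF assms]] by metis
  qed
qed

lemma lookup_rename_vars:
  "bij \<sigma> \<Longrightarrow> Poly_Mapping.lookup (rename_vars \<sigma> f) m = Poly_Mapping.lookup f (Poly_Mapping.map_key \<sigma> m)"
  unfolding rename_vars_def by (rule lookup_map_key) (rule inj_map_key)

lemma map_key_inv:
  assumes "bij \<sigma>"
  shows "Poly_Mapping.map_key \<sigma> (Poly_Mapping.map_key (inv \<sigma>) m) = m"
proof (rule poly_mapping_eqI)
  fix k
  show "Poly_Mapping.lookup (Poly_Mapping.map_key \<sigma> (Poly_Mapping.map_key (inv \<sigma>) m)) k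
      = Poly_Mapping.lookup m k"
    using assms by (simp add: lookup_map_key bij_is_inj bij_imp_bij_inv inv_f_f)
qed

text \<open>\<open>map_key\<close> pulls exponent vectors back, so the monomial itself is carried by
  \<open>inv \<sigma>\<close>; with this inverse, t_i goes to t_j for j = \<sigma>(i).\<close>

lemma rename_vars_single:
  assumes "bij \<sigma>"
  shows "rename_vars \<sigma> (Poly_Mapping.single m c)
    = Poly_Mapping.single (Poly_Mapping.map_key (inv \<sigma>) m) c"
  unfolding rename_vars_def
  using map_key_single[OF inj_map_key[OF assms], of "Poly_Mapping.map_key (inv \<sigma>) m" c]
  by (simp add: map_key_inv[OF assms])

lemma rename_vars_add:
  "bij \<sigma> \<Longrightarrow> rename_vars \<sigma> (f + g) = rename_vars \<sigma> f + rename_vars \<sigma> (g :: _ \<Rightarrow>\<^sub>0 'a::monoid_add)"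
  unfolding rename_vars_def by (rule map_key_plus) (rule inj_map_key)

lemma rhom_rename_vars:
  assumes "bij \<sigma>"
  shows "rhom (rename_vars \<sigma> :: _ \<Rightarrow> (nat \<Rightarrow>\<^sub>0 nat) \<Rightarrow>\<^sub>0 'a::comm_ring_1)"
proof
  note [simp] = rename_vars_add[OF assms] rename_vars_single[OF assms]
  have i: "inj (inv \<sigma>)" using assms by (simp add: bij_is_inj bij_imp_bij_inv)
  show "rename_vars \<sigma> 1 = (1 :: _ \<Rightarrow>\<^sub>0 'a)"
    using rename_vars_single[OF assms, of 0 "1::'a"] i by (simp add: map_key_zero)
  show "rename_vars \<sigma> (a + b) = rename_vars \<sigma> a + rename_vars \<sigma> b" for a b :: "_ \<Rightarrow>\<^sub>0 'a"
    by simp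
  show "rename_vars \<sigma> (a * b) = rename_vars \<sigma> a * rename_vars \<sigma> b" for a b :: "_ \<Rightarrow>\<^sub>0 'a"
  proof (induction a rule: poly_mapping_induct_single)
    case (single m c)
    show ?case
      by (induction b rule: poly_mapping_induct_single)
        (simp_all add: mult_single map_key_plus[OF i] algebra_simps)
  qed (simp add: algebra_simps)
qed

definition y_var :: "nat \<Rightarrow> ypoly" where
  "y_var j = Poly_Mapping.single (Poly_Mapping.single j 1) 1"

lemma Y_eq: "Y j = scalar (y_var j)"
  by (simp add: Y_def y_var_def)

lemma y_var_inject [simp]: "y_var i = y_var j \<longleftrightarrow> i = j"
proof
  assume "y_var i = y_var j"
  then have "Poly_Mapping.keys (y_var i) = Poly_Mapping.keys (y_var j)" by simp
  then have "Poly_Mapping.single i (1::nat) = Poly_Mapping.single j 1" by (simp add: y_var_def)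
  then have "Poly_Mapping.keys (Poly_Mapping.single i (1::nat)) = Poly_Mapping.keys (Poly_Mapping.single j (1::nat))"
    by simp
  then show "i = j" by simp
qed simp

lemma rename_vars_y_var: "bij \<sigma> \<Longrightarrow> rename_vars \<sigma> (y_var j) = y_var (\<sigma> j)"
  using map_key_single_bij[OF bij_imp_bij_inv, of \<sigma> "\<sigma> j" "1::nat"]
  by (simp add: y_var_def rename_vars_single bij_is_inj inv_f_f del: One_nat_def)

lemma rename_vars_X: "bij \<sigma> \<Longrightarrow> rename_vars \<sigma> (X j) = X (\<sigma> j)"
  using map_key_single_bij[OF bij_imp_bij_inv, of \<sigma> "\<sigma> j" "1::nat"]
  by (simp add: X_def rename_vars_single bij_is_inj inv_f_f del: One_nat_def)

lemma rename_vars_scalar: "bij \<sigma> \<Longrightarrow> rename_vars \<sigma> (scalar c) = scalar c"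
  by (simp add: scalar_def rename_vars_single map_key_zero bij_is_inj bij_imp_bij_inv)

lemma rename_vars_comp:
  assumes "bij \<sigma>" "bij \<tau>"
  shows "rename_vars \<sigma> (rename_vars \<tau> f) = rename_vars (\<sigma> \<circ> \<tau>) f"
proof (rule poly_mapping_eqI)
  fix m :: "nat \<Rightarrow>\<^sub>0 nat"
  have "Poly_Mapping.map_key \<tau> (Poly_Mapping.map_key \<sigma> m) = Poly_Mapping.map_key (\<sigma> \<circ> \<tau>) m"
    using assms by (simp add: map_key_compose bij_is_inj)
  then show "Poly_Mapping.lookup (rename_vars \<sigma> (rename_vars \<tau> f)) m
      = Poly_Mapping.lookup (rename_vars (\<sigma> \<circ> \<tau>) f) m"
    using assms by (simp add: lookup_rename_vars bij_comp)
qed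

lemma rename_vars_id: "rename_vars id f = f"
  by (rule poly_mapping_eqI) (simp add: lookup_rename_vars map_key_id[folded id_def])

lemma rhom_scalar: "rhom scalar"
  using rhom_single_0 by (simp add: scalar_def[abs_def])

lemma xypoly_induct [case_names scalar X add mult]:
  assumes "\<And>c. P (scalar c)" "\<And>i. P (X i)"
    and "\<And>f g. P f \<Longrightarrow> P g \<Longrightarrow> P (f + g)" "\<And>f g. P f \<Longrightarrow> P g \<Longrightarrow> P (f * g)"
  shows "P f"
proof (induction f rule: poly_mapping_induct_single)
  case (single m c)
  have "P (Poly_Mapping.single m 1)"
  proof (induction m rule: exponent_induct)
    case zero
    show ?case using assms(1)[of 1] by (simp add: scalar_def)
  next
    case (unit i)
    show ?case using assms(2)[of i] by (simp add: X_def)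
  next
    case (add m m')
    then show ?case using assms(4) by (metis mult_single mult_1)
  qed
  moreover have "Poly_Mapping.single m c = scalar c * Poly_Mapping.single m 1"
    by (simp add: scalar_def mult_single)
  ultimately show ?case using assms by metis
qed (use assms in auto)

text \<open>Identities between composed substitutions are reduced by this lemma to scalars and
  variables, in place of a comparison of coefficients.\<close>

lemma rhom_eqI:
  fixes g h :: "xypoly \<Rightarrow> 'a::comm_ring_1"
  assumes "rhom g" "rhom h" "\<And>c. g (scalar c) = h (scalar c)" "\<And>i. g (X i) = h (X i)"
  shows "g f = h f"
  by (induction f rule: xypoly_induct) (use assms in \<open>auto simp: rhom.add rhom.mult\<close>)

lemma lookup_rename_y:
  assumes "bij \<sigma>"
  shows "Poly_Mapping.lookup (rename_y \<sigma> f) m = rename_vars \<sigma> (Poly_Mapping.lookup f m)"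
  using rhom.zero[OF rhom_rename_vars[OF assms]]
  by (auto simp: rename_y_def Poly_Mapping.map.rep_eq when_def)

lemma rename_y_single:
  "bij \<sigma> \<Longrightarrow> rename_y \<sigma> (Poly_Mapping.single m c) = Poly_Mapping.single m (rename_vars \<sigma> c)"
  by (simp add: rename_y_def rhom.zero[OF rhom_rename_vars])

lemma rename_y_scalar: "bij \<sigma> \<Longrightarrow> rename_y \<sigma> (scalar c) = scalar (rename_vars \<sigma> c)"
  by (simp add: scalar_def rename_y_single)

lemma rename_y_X: "bij \<sigma> \<Longrightarrow> rename_y \<sigma> (X i) = X i"
  by (simp add: X_def rename_y_single rhom.one[OF rhom_rename_vars])

lemma rhom_rename_y:
  assumes "bij \<sigma>"
  shows "rhom (rename_y \<sigma>)"
proof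
  note [simp] = rename_y_single[OF assms]
  interpret r: rhom "rename_vars \<sigma> :: ypoly \<Rightarrow> ypoly"
    by (rule rhom_rename_vars[OF assms])
  have add [simp]: "rename_y \<sigma> (a + b) = rename_y \<sigma> a + rename_y \<sigma> b" for a b
    by (rule poly_mapping_eqI) (simp add: lookup_rename_y[OF assms] lookup_add r.add)
  show "rename_y \<sigma> 1 = 1"
    using rename_y_single[OF assms, of 0 1] by (simp add: r.one)
  show "rename_y \<sigma> (a + b) = rename_y \<sigma> a + rename_y \<sigma> b" for a b
    by simp
  show "rename_y \<sigma> (a * b) = rename_y \<sigma> a * rename_y \<sigma> b" for a b
  proof (induction a rule: poly_mapping_induct_single)
    case (single m c)
    show ?case
      by (induction b rule: poly_mapping_induct_single)
        (simp_all add: mult_single r.mult algebra_simps)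
  qed (simp add: algebra_simps)
qed

lemma rename_y_rename_y:
  assumes "bij \<sigma>" "bij \<tau>"
  shows "rename_y \<sigma> (rename_y \<tau> f) = rename_y (\<sigma> \<circ> \<tau>) f"
  by (rule poly_mapping_eqI) (use assms in \<open>simp add: lookup_rename_y rename_vars_comp bij_comp\<close>)

lemma rename_y_id: "rename_y id f = f"
  by (rule poly_mapping_eqI) (simp add: lookup_rename_y rename_vars_id)

text \<open>Restriction to the torus fixed point v of the flag variety: x_i becomes y_{v(i)}, and
  the y stay as they are.\<close>

definition ev :: "(nat \<Rightarrow> nat) \<Rightarrow> xypoly \<Rightarrow> ypoly" where
  "ev v = extend_hom (\<lambda>c. c) (\<lambda>m. \<Prod>i\<in>Poly_Mapping.keys m. y_var (v i) ^ Poly_Mapping.lookup m i)"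

lemma rhom_ev: "rhom (ev v)"
  unfolding ev_def
proof (rule rhom_extend_hom[OF rhom_id])
  fix m m' :: "nat \<Rightarrow>\<^sub>0 nat"
  have eq: "(\<Prod>i\<in>Poly_Mapping.keys k. y_var (v i) ^ Poly_Mapping.lookup k i)
      = (\<Prod>i\<in>Poly_Mapping.keys m \<union> Poly_Mapping.keys m'. y_var (v i) ^ Poly_Mapping.lookup k i)"
    if "Poly_Mapping.keys k \<subseteq> Poly_Mapping.keys m \<union> Poly_Mapping.keys m'" for k
    using that by (intro prod.mono_neutral_left) (auto simp: in_keys_iff)
  show "(\<Prod>i\<in>Poly_Mapping.keys (m + m'). y_var (v i) ^ Poly_Mapping.lookup (m + m') i)
     = (\<Prod>i\<in>Poly_Mapping.keys m. y_var (v i) ^ Poly_Mapping.lookup m i)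
     * (\<Prod>i\<in>Poly_Mapping.keys m'. y_var (v i) ^ Poly_Mapping.lookup m' i)"
    by (simp add: eq keys_add flip: prod.distrib) (simp add: lookup_add power_add)
qed simp

lemma ev_scalar: "ev v (scalar c) = c"
  by (simp add: ev_def scalar_def extend_hom_single)

lemma ev_X: "ev v (X i) = y_var (v i)"
  by (simp add: ev_def X_def extend_hom_single)

lemma ev_Y: "ev v (Y i) = y_var i"
  by (simp add: Y_eq ev_scalar)

lemma ev_rename_vars: "bij \<sigma> \<Longrightarrow> ev v (rename_vars \<sigma> f) = ev (v \<circ> \<sigma>) f"
  by (rule rhom_eqI[where f = f, OF rhom_comp[OF rhom_ev rhom_rename_vars] rhom_ev])
    (auto simp: rename_vars_scalar ev_scalar rename_vars_X ev_X)

text \<open>The coordinates of the point v are themselves y-variables, so renaming the y also moves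
  the point, to \<sigma> \<circ> v.\<close>

lemma ev_rename_y: "bij \<sigma> \<Longrightarrow> ev (\<sigma> \<circ> v) (rename_y \<sigma> f) = rename_vars \<sigma> (ev v f)"
  by (rule rhom_eqI[where f = f, OF rhom_comp[OF rhom_ev rhom_rename_y]
        rhom_comp[OF rhom_rename_vars rhom_ev]])
    (auto simp: rename_y_scalar ev_scalar rename_y_X ev_X rename_vars_y_var)

section \<open>Divided differences\<close>

definition sw :: "nat \<Rightarrow> xypoly \<Rightarrow> xypoly" where
  "sw i = rename_vars (transpose i (i + 1))"

lemma rhom_sw: "rhom (sw i)"
  unfolding sw_def by (rule rhom_rename_vars) simp

interpretation sw: rhom "sw i" for i
  by (rule rhom_sw)

interpretation scalar: rhom scalar
  by (rule rhom_scalar)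

interpretation ev: rhom "ev v" for v
  by (rule rhom_ev)

lemma sw_X: "sw i (X j) = X (transpose i (i + 1) j)"
  by (simp add: sw_def rename_vars_X)

lemma sw_scalar [simp]: "sw i (scalar c) = scalar c"
  by (simp add: sw_def rename_vars_scalar)

lemma sw_sw [simp]: "sw i (sw i f) = f"
  by (simp add: sw_def rename_vars_comp rename_vars_id)

lemma X_inject [simp]: "X i = X j \<longleftrightarrow> i = j"
  using ev_X[of id] y_var_inject by (metis id_apply)

lemma X_diff_nonzero: "X i - X (i + 1) \<noteq> 0"
  by simp

lemma sw_X_diff: "sw i (X i - X (i + 1)) = - (X i - X (i + 1))"
  by (simp add: sw.diff sw_X)

text \<open>No division is performed: the polynomials that admit a quotient contain the scalars and
  variables and are closed under sums and, by the twisted Leibniz rule, under products.\<close>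

lemma divdiff_exists: "\<exists>g. (X i - X (i + 1)) * g = f - sw i f"
proof (induction f rule: xypoly_induct)
  case (scalar c)
  show ?case by (rule exI[of _ 0]) simp
next
  case (X j)
  show ?case
  proof (cases "j = i \<or> j = i + 1")
    case True
    then show ?thesis
      by (intro exI[of _ "if j = i then 1 else -1"]) (auto simp: sw_X)
  next
    case False
    then show ?thesis
      by (intro exI[of _ 0]) (auto simp: sw_X)
  qed
next
  case (add f g)
  then obtain a b where "(X i - X (i + 1)) * a = f - sw i f" "(X i - X (i + 1)) * b = g - sw i g"
    by blast
  then have "(X i - X (i + 1)) * (a + b) = (f + g) - sw i (f + g)"
    by (simp add: sw.add algebra_simps)
  then show ?case ..
next
  case (mult f g)
  then obtain a b where "(X i - X (i + 1)) * a = f - sw i f" "(X i - X (i + 1)) * b = g - sw i g"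
    by blast
  then have "(X i - X (i + 1)) * (a * g + sw i f * b) = f * g - sw i (f * g)"
    unfolding sw.mult by algebra
  then show ?case ..
qed

lemma divdiff_unique:
  assumes "(X i - X (i + 1)) * g = f - sw i f"
  shows "divdiff i f = g"
  unfolding divdiff_def
proof (rule the_equality)
  show "(X i - X (i + 1)) * g = f - rename_vars (transpose i (i + 1)) f"
    using assms by (simp add: sw_def)
  fix h
  assume "(X i - X (i + 1)) * h = f - rename_vars (transpose i (i + 1)) f"
  then have "(X i - X (i + 1)) * h = (X i - X (i + 1)) * g"
    using assms by (simp add: sw_def)
  then show "h = g"
    using X_diff_nonzero[of i] mult_left_cancel by blast
qed

lemma divdiff_eq: "(X i - X (i + 1)) * divdiff i f = f - sw i f"
  using divdiff_exists[of i f] divdiff_unique by blast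

lemma divdiff_add: "divdiff i (f + g) = divdiff i f + divdiff i g"
  by (rule divdiff_unique) (simp only: distrib_left divdiff_eq sw.add add_diff_add)

lemma divdiff_diff: "divdiff i (f - g) = divdiff i f - divdiff i g"
proof (rule divdiff_unique)
  show "(X i - X (i + 1)) * (divdiff i f - divdiff i g) = f - g - sw i (f - g)"
    using divdiff_eq[of i f] divdiff_eq[of i g] unfolding sw.diff by algebra
qed

lemma divdiff_mult: "divdiff i (f * g) = divdiff i f * g + sw i f * divdiff i g"
proof (rule divdiff_unique)
  show "(X i - X (i + 1)) * (divdiff i f * g + sw i f * divdiff i g) = f * g - sw i (f * g)"
    using divdiff_eq[of i f] divdiff_eq[of i g] unfolding sw.mult by algebra
qed

lemma divdiff_eq_0_iff: "divdiff i f = 0 \<longleftrightarrow> sw i f = f"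
proof
  assume "divdiff i f = 0"
  then show "sw i f = f" using divdiff_eq[of i f] by simp
next
  assume "sw i f = f"
  then show "divdiff i f = 0" by (intro divdiff_unique) simp
qed

lemma divdiff_0 [simp]: "divdiff i 0 = 0"
  by (simp add: divdiff_eq_0_iff sw.zero)

lemma divdiff_mult_sym: "sw i g = g \<Longrightarrow> divdiff i (g * f) = g * divdiff i f"
  by (simp add: divdiff_mult divdiff_eq_0_iff[THEN iffD2])

lemma divdiff_scalar_mult: "divdiff i (scalar c * f) = scalar c * divdiff i f"
  by (simp add: divdiff_mult_sym)

lemma divdiff_sum: "divdiff i (sum f A) = (\<Sum>x\<in>A. divdiff i (f x))"
  by (induction A rule: infinite_finite_induct) (auto simp: divdiff_add)

text \<open>Numerator and denominator of the quotient both change sign under s_i.\<close>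

lemma sw_divdiff [simp]: "sw i (divdiff i f) = divdiff i f"
proof -
  have "sw i ((X i - X (i + 1)) * divdiff i f) = sw i f - f"
    by (simp only: divdiff_eq sw.diff sw_sw)
  then have "(X i - X (i + 1)) * sw i (divdiff i f) = (X i - X (i + 1)) * divdiff i f"
    unfolding sw.mult sw_X_diff using divdiff_eq[of i f] by algebra
  then show ?thesis using X_diff_nonzero[of i] mult_left_cancel by blast
qed

lemma divdiff_divdiff [simp]: "divdiff i (divdiff i f) = 0"
  by (simp add: divdiff_eq_0_iff)

lemma rename_y_sw:
  assumes "bij \<sigma>"
  shows "rename_y \<sigma> (sw i f) = sw i (rename_y \<sigma> f)"
  using assms
  by (intro rhom_eqI[where f = f, OF rhom_comp[OF rhom_rename_y rhom_sw]
      rhom_comp[OF rhom_sw rhom_rename_y]])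
    (auto simp: sw_X rename_y_X rename_y_scalar)

lemma rename_y_divdiff:
  assumes "bij \<sigma>"
  shows "rename_y \<sigma> (divdiff i f) = divdiff i (rename_y \<sigma> f)"
proof -
  interpret r: rhom "rename_y \<sigma>" by (rule rhom_rename_y[OF assms])
  have "rename_y \<sigma> ((X i - X (i + 1)) * divdiff i f) = rename_y \<sigma> f - sw i (rename_y \<sigma> f)"
    unfolding divdiff_eq by (simp add: r.diff rename_y_sw[OF assms])
  then show ?thesis
    by (intro divdiff_unique[symmetric]) (simp add: r.mult r.diff rename_y_X[OF assms])
qed

lemma ev_sw: "ev v (sw i f) = ev (v \<circ> transpose i (i + 1)) f"
  by (simp add: sw_def ev_rename_vars)

text \<open>The value of a divided difference at v depends only on the values of f at v and v s_i.
  This is what makes inductions along fixed points possible.\<close>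

lemma ev_divdiff:
  "(y_var (v i) - y_var (v (i + 1))) * ev v (divdiff i f) = ev v f - ev (v \<circ> transpose i (i + 1)) f"
  using arg_cong[OF divdiff_eq[of i f], of "ev v"] by (simp add: ev.mult ev.diff ev_X ev_sw)

section \<open>Commutation and braid relations for divided differences\<close>

lemma sw_braid: "sw i (sw (i + 1) (sw i f)) = sw (i + 1) (sw i (sw (i + 1) f))"
  by (rule rhom_eqI[where f = f, OF rhom_comp[OF rhom_sw rhom_comp[OF rhom_sw rhom_sw]]
      rhom_comp[OF rhom_sw rhom_comp[OF rhom_sw rhom_sw]]])
    (auto simp: sw_X transpose_def)

lemma sw_commute: "i + 1 < j \<Longrightarrow> sw i (sw j f) = sw j (sw i f)"
  by (rule rhom_eqI[where f = f, OF rhom_comp[OF rhom_sw rhom_sw] rhom_comp[OF rhom_sw rhom_sw]])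
    (auto simp: sw_X transpose_def)

text \<open>Each denominator is fixed by the other reflection, so after multiplication by both
  denominators only the commutation of the reflections is left.\<close>

lemma divdiff_commute:
  assumes "i + 1 < j"
  shows "divdiff i (divdiff j f) = divdiff j (divdiff i f)"
proof -
  have i: "sw i (X j - X (j + 1)) = X j - X (j + 1)" "sw j (X i - X (i + 1)) = X i - X (i + 1)"
    using assms by (auto simp: sw.diff sw_X transpose_def)
  have 1: "(X j - X (j + 1)) * sw i (divdiff j f) = sw i f - sw i (sw j f)"
    using arg_cong[OF divdiff_eq[of j f], of "sw i", unfolded sw.mult i] by (simp only: sw.diff)
  have 2: "(X i - X (i + 1)) * sw j (divdiff i f) = sw j f - sw i (sw j f)"
    using arg_cong[OF divdiff_eq[of i f], of "sw j", unfolded sw.mult i]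
    by (simp only: sw.diff sw_commute[OF assms])
  have "(X i - X (i + 1)) * ((X j - X (j + 1)) * divdiff i (divdiff j f))
      = (X i - X (i + 1)) * ((X j - X (j + 1)) * divdiff j (divdiff i f))"
    using 1 2 divdiff_eq[of i f] divdiff_eq[of j f] divdiff_eq[of i "divdiff j f"]
      divdiff_eq[of j "divdiff i f"] by algebra
  then show ?thesis
    using X_diff_nonzero[of i] X_diff_nonzero[of j] by (metis mult_left_cancel)
qed

text \<open>Both sides of the braid relation are the antisymmetrization over \<open>S\<^sub>3\<close> divided by the
  Vandermonde product.\<close>

lemma divdiff_braid:
  "divdiff i (divdiff (i + 1) (divdiff i f)) = divdiff (i + 1) (divdiff i (divdiff (i + 1) f))"
proof -
  define a b c where "a = X i" "b = X (i + 1)" "c = X (i + 2)"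
  note abc = this
  have sw1: "sw i a = b" "sw i b = a" "sw i c = c" and sw2: "sw (i + 1) a = a" "sw (i + 1) b = c" "sw (i + 1) c = b"
    by (auto simp: abc sw_X transpose_def)
  have e1: "(a - b) * divdiff i g = g - sw i g" for g
    using divdiff_eq by (simp add: abc)
  have e2: "(b - c) * divdiff (i + 1) g = g - sw (i + 1) g" for g
    using divdiff_eq[of "i + 1" g] by (simp add: abc)
  have l: "(a - b) * (b - c) * (a - c) * divdiff i (divdiff (i + 1) (divdiff i f))
      = f - sw i f - sw (i + 1) f + sw (i + 1) (sw i f) + sw i (sw (i + 1) f) - sw i (sw (i + 1) (sw i f))"
  proof -
    define F where "F = divdiff i f"
    define G where "G = divdiff (i + 1) F"
    have 1: "(a - b) * F = f - sw i f" unfolding F_def by (rule e1)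
    have 2: "(b - c) * G = F - sw (i + 1) F" unfolding G_def by (rule e2)
    have 3: "(a - b) * divdiff i G = G - sw i G" by (rule e1)
    have 4: "(a - c) * sw i G = F - sw i (sw (i + 1) F)"
      using arg_cong[OF 2, of "sw i"] by (simp add: sw.mult sw.diff sw1 F_def)
    have 5: "(a - c) * sw (i + 1) F = sw (i + 1) f - sw (i + 1) (sw i f)"
      using arg_cong[OF 1, of "sw (i + 1)"] by (simp only: sw.mult sw.diff sw2)
    have 6: "(b - c) * sw i (sw (i + 1) F) = sw i (sw (i + 1) f) - sw i (sw (i + 1) (sw i f))"
      using arg_cong[OF 5, of "sw i"] by (simp only: sw.mult sw.diff sw1)
    show ?thesis
      unfolding G_def[symmetric] F_def[symmetric]
      using 1 2 3 4 5 6 by algebra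
  qed
  have r: "(a - b) * (b - c) * (a - c) * divdiff (i + 1) (divdiff i (divdiff (i + 1) f))
      = f - sw i f - sw (i + 1) f + sw (i + 1) (sw i f) + sw i (sw (i + 1) f) - sw (i + 1) (sw i (sw (i + 1) f))"
  proof -
    define F where "F = divdiff (i + 1) f"
    define G where "G = divdiff i F"
    have 1: "(b - c) * F = f - sw (i + 1) f" unfolding F_def by (rule e2)
    have 2: "(a - b) * G = F - sw i F" unfolding G_def by (rule e1)
    have 3: "(b - c) * divdiff (i + 1) G = G - sw (i + 1) G" by (rule e2)
    have 4: "(a - c) * sw (i + 1) G = F - sw (i + 1) (sw i F)"
      using arg_cong[OF 2, of "sw (i + 1)"] by (simp only: sw.mult sw.diff sw2 F_def sw_divdiff)
    have 5: "(a - c) * sw i F = sw i f - sw i (sw (i + 1) f)"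
      using arg_cong[OF 1, of "sw i"] by (simp only: sw.mult sw.diff sw1)
    have 6: "(a - b) * sw (i + 1) (sw i F) = sw (i + 1) (sw i f) - sw (i + 1) (sw i (sw (i + 1) f))"
      using arg_cong[OF 5, of "sw (i + 1)"] by (simp only: sw.mult sw.diff sw2)
    show ?thesis
      unfolding G_def[symmetric] F_def[symmetric]
      using 1 2 3 4 5 6 by algebra
  qed
  have "(a - b) * (b - c) * (a - c) \<noteq> 0"
    by (simp add: abc)
  then show ?thesis
    using l r sw_braid[of i f] by (metis mult_left_cancel)
qed

section \<open>Inversions and descents\<close>

lemma SymD:
  assumes "w \<in> Sym n"
  shows "w permutes {1..n}" "inj w" "bij w"
  using assms by (auto simp: Sym_def permutes_inj permutes_bij)

lemma Sym_outside: "w \<in> Sym n \<Longrightarrow> i < 1 \<or> n < i \<Longrightarrow> w i = i"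
  using permutes_not_in[OF SymD(1), of w n i] by auto

lemma Sym_inside: "w \<in> Sym n \<Longrightarrow> 1 \<le> i \<Longrightarrow> i \<le> n \<Longrightarrow> 1 \<le> w i \<and> w i \<le> n"
  using permutes_in_image[OF SymD(1), of w n i] by auto

lemma Sym_comp: "v \<in> Sym n \<Longrightarrow> w \<in> Sym n \<Longrightarrow> v \<circ> w \<in> Sym n"
  by (simp add: Sym_def permutes_compose)

lemma Sym_transpose: "1 \<le> i \<Longrightarrow> i < n \<Longrightarrow> transpose i (i + 1) \<in> Sym n"
  by (simp add: Sym_def permutes_swap_id)

lemma Sym_id: "id \<in> Sym n"
  by (simp add: Sym_def permutes_id)

lemma Sym_mono: "w \<in> Sym m \<Longrightarrow> m \<le> n \<Longrightarrow> w \<in> Sym n"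
  unfolding Sym_def using permutes_subset[of w "{1..m}" "{1..n}"] by auto

lemma finite_Sym: "finite (Sym n)"
  by (simp add: Sym_def finite_permutations)

lemma Sym_step: "w \<in> Sym n \<Longrightarrow> 1 \<le> i \<Longrightarrow> i < n \<Longrightarrow> w \<circ> transpose i (i + 1) \<in> Sym n"
  using Sym_comp Sym_transpose by blast

lemma transpose_twice [simp]: "w \<circ> transpose a b \<circ> transpose a b = w"
  by (simp add: fun_eq_iff)

lemma Sym_step_iff:
  assumes "1 \<le> i" "i < n"
  shows "w \<circ> transpose i (i + 1) \<in> Sym n \<longleftrightarrow> w \<in> Sym n"
  using Sym_step assms transpose_twice by metis

text \<open>The free bound m lets the symmetric group be chosen so large that a given position is
  not its last one.\<close>

lemma Sym_infD:
  fixes m :: nat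
  assumes "w \<in> Sym_inf"
  obtains N where "w \<in> Sym N" "m < N"
proof -
  obtain k where "w \<in> Sym k" using assms(1) by (auto simp: Sym_inf_def)
  then have "w \<in> Sym (max k (m + 1))" by (rule Sym_mono) simp
  then show ?thesis by (rule that) simp
qed

lemma Sym_imp_Sym_inf: "w \<in> Sym n \<Longrightarrow> w \<in> Sym_inf"
  by (auto simp: Sym_inf_def)

lemma Sym_inf_step:
  assumes "w \<in> Sym_inf" "1 \<le> i"
  shows "w \<circ> transpose i (i + 1) \<in> Sym_inf"
proof -
  obtain N where "w \<in> Sym N" "i < N" using Sym_infD[OF assms(1)] .
  then show ?thesis using Sym_imp_Sym_inf[OF Sym_step[OF _ assms(2)]] by simp
qed

lemma Sym_neq:
  assumes "w \<in> Sym n" shows "w i = w (i + 1) \<longleftrightarrow> False"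
  using inj_eq[OF SymD(2)[OF assms]] by simp

section \<open>Length, ascents and descents\<close>

definition inversions :: "(nat \<Rightarrow> nat) \<Rightarrow> (nat \<times> nat) set" where
  "inversions w = {(i, j). i < j \<and> w j < w i}"

lemma inversions_subset:
  assumes "w \<in> Sym n"
  shows "inversions w \<subseteq> {1..n} \<times> {1..n}"
proof
  fix x assume "x \<in> inversions w"
  then obtain i j where x: "x = (i, j)" "i < j" "w j < w i" by (auto simp: inversions_def)
  have "1 \<le> i"
    using x Sym_outside[OF assms, of i] by (cases "i = 0") auto
  moreover have "j \<le> n"
  proof (rule ccontr)
    assume "\<not> j \<le> n"
    then have "w j = j" using Sym_outside[OF assms] by simp
    then have "n < w i" using x \<open>\<not> j \<le> n\<close> by linarith
    then have "\<not> (i \<le> n)" using Sym_inside[OF assms \<open>1 \<le> i\<close>] by linarith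
    then have "w i = i" using Sym_outside[OF assms] by simp
    then show False using x \<open>w j = j\<close> by simp
  qed
  ultimately show "x \<in> {1..n} \<times> {1..n}" using x by auto
qed

lemma perm_length_eq: "perm_length w = card (inversions w)"
  by (simp add: perm_length_def inversions_def)

lemma finite_inversions: "w \<in> Sym n \<Longrightarrow> finite (inversions w)"
  using inversions_subset finite_subset by blast

lemma perm_length_le:
  assumes "w \<in> Sym n" shows "perm_length w \<le> n * n"
  using card_mono[OF _ inversions_subset[OF assms]] by (simp add: perm_length_eq card_cartesian_product)

text \<open>Exchanging two adjacent positions preserves the order of every other pair of positions.
  Hence s_i carries the inversions of w to those of w s_i, and (i, i + 1) is the only new
  one.\<close>

lemma perm_length_ascent:
  assumes "w \<in> Sym n" "w i < w (i + 1)"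
  shows "perm_length (w \<circ> transpose i (i + 1)) = perm_length w + 1"
proof -
  let ?s = "transpose i (i + 1)"
  have mono: "?s a < ?s b" if "a < b" "(a, b) \<noteq> (i, i + 1)" for a b
    using that by (auto simp: transpose_def)
  have "inversions (w \<circ> ?s) = insert (i, i + 1) (map_prod ?s ?s ` inversions w)" (is "?L = ?R")
  proof
    show "?L \<subseteq> ?R"
    proof
      fix x assume "x \<in> ?L"
      then obtain a b where x: "x = (a, b)" "a < b" "w (?s b) < w (?s a)" by (auto simp: inversions_def)
      show "x \<in> ?R"
      proof (cases "(a, b) = (i, i + 1)")
        case False
        then have "(?s a, ?s b) \<in> inversions w" using x mono by (simp add: inversions_def)
        then have "map_prod ?s ?s (?s a, ?s b) \<in> ?R" by blast
        then show ?thesis using x by simp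
      qed (use x in simp)
    qed
    show "?R \<subseteq> ?L"
    proof
      fix x assume "x \<in> ?R"
      then consider "x = (i, i + 1)" | a b where "x = (?s a, ?s b)" "a < b" "w b < w a"
        by (auto simp: inversions_def)
      then show "x \<in> ?L"
      proof cases
        case 2
        then have "(a, b) \<noteq> (i, i + 1)" using assms(2) by auto
        then show ?thesis using 2 mono by (simp add: inversions_def)
      qed (use assms(2) in \<open>simp add: inversions_def\<close>)
    qed
  qed
  moreover have "(i, i + 1) \<notin> map_prod ?s ?s ` inversions w"
  proof
    assume "(i, i + 1) \<in> map_prod ?s ?s ` inversions w"
    then obtain a b where "i = ?s a" "i + 1 = ?s b" "a < b" by (auto simp: inversions_def)
    then show False by (auto simp: transpose_def split: if_splits)
  qed
  moreover have "card (map_prod ?s ?s ` inversions w) = card (inversions w)"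
    by (intro card_image inj_on_subset[OF prod.inj_map]) auto
  ultimately show ?thesis
    using finite_inversions[OF assms(1)] by (simp add: perm_length_eq)
qed

lemma perm_length_descent:
  assumes "w \<in> Sym n" "w (i + 1) < w i" "1 \<le> i" "i < n"
  shows "perm_length w = perm_length (w \<circ> transpose i (i + 1)) + 1"
  using perm_length_ascent[OF Sym_step[OF assms(1,3,4)], of i] assms(2) by simp

lemma perm_length_less_iff:
  assumes "w \<in> Sym n" "1 \<le> i" "i < n"
  shows "perm_length (w \<circ> transpose i (i + 1)) < perm_length w \<longleftrightarrow> w (i + 1) < w i"
  using perm_length_ascent[OF assms(1), of i] perm_length_descent[OF assms(1) _ assms(2,3)]
    Sym_neq[OF assms(1), of i] by (cases "w i" "w (i + 1)" rule: linorder_cases) auto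

text \<open>Both permutations have the same sum over 1..n, so no inequality can be strict.\<close>

lemma permutes_le_imp_eq:
  fixes u w :: "nat \<Rightarrow> nat"
  assumes "u \<in> Sym n" "w \<in> Sym n" "\<And>i. 1 \<le> i \<Longrightarrow> i \<le> n \<Longrightarrow> u i \<le> w i"
  shows "u = w"
proof
  fix i
  have "(\<Sum>i\<in>{1..n}. u i) = (\<Sum>i\<in>{1..n}. w i)"
    using sum.permute[OF SymD(1)[OF assms(1)], of id] sum.permute[OF SymD(1)[OF assms(2)], of id]
    by simp
  then show "u i = w i"
    using sum_mono_inv[of u "{1..n}" w i] assms(3) Sym_outside[OF assms(1), of i] Sym_outside[OF assms(2), of i]
    by (cases "i \<in> {1..n}") auto
qed

lemma ascending_imp_id:
  assumes w: "w \<in> Sym n" and asc: "\<And>i. 1 \<le> i \<Longrightarrow> i < n \<Longrightarrow> w i < w (i + 1)"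
  shows "w = id"
proof (rule permutes_le_imp_eq[OF Sym_id w, symmetric])
  fix i :: nat assume "1 \<le> i" "i \<le> n"
  then have "i \<le> w i"
  proof (induction i rule: dec_induct)
    case base
    then show ?case using Sym_inside[OF w, of 1] by simp
  next
    case (step i)
    then show ?case using asc[of i] by simp
  qed
  then show "id i \<le> w i" by simp
qed

lemma exists_descent:
  assumes "w \<in> Sym n" "w \<noteq> id"
  obtains i where "1 \<le> i" "i < n" "w (i + 1) < w i"
proof -
  obtain i where "1 \<le> i" "i < n" "\<not> w i < w (i + 1)"
    using ascending_imp_id[OF assms(1)] assms(2) by blast
  then show ?thesis using that[of i] Sym_neq[OF assms(1), of i] by (metis nat_neq_iff)
qed

lemma w0_w0 [simp]: "w0 n (w0 n i) = i"
  by (auto simp: w0_def)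

lemma w0_comp_w0 [simp]: "w0 n \<circ> w0 n = id" "w0 n \<circ> (w0 n \<circ> w) = w"
  by (simp_all add: fun_eq_iff)

lemma w0_Sym: "w0 n \<in> Sym n"
  unfolding Sym_def mem_Collect_eq by (rule bij_imp_permutes) (auto simp: w0_def intro!: bij_betw_byWitness[where f' = "w0 n"])

lemma bij_w0: "bij (w0 n)"
  using w0_Sym SymD by blast

text \<open>Without ascents, w0 \<circ> w would ascend everywhere and be the identity. Minimality of
  the ascent matters for the degree bound on Schubert polynomials.\<close>

lemma first_ascent:
  assumes w: "w \<in> Sym n" "w \<noteq> w0 n"
  obtains i where "1 \<le> i" "i < n" "w i < w (i + 1)" "\<And>k. 1 \<le> k \<Longrightarrow> k < i \<Longrightarrow> w (k + 1) < w k"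
proof -
  have "\<exists>i. 1 \<le> i \<and> i < n \<and> w i < w (i + 1)"
  proof (rule ccontr)
    assume no: "\<nexists>i. 1 \<le> i \<and> i < n \<and> w i < w (i + 1)"
    have "w0 n \<circ> w = id"
    proof (rule ascending_imp_id[OF Sym_comp[OF w0_Sym w(1)]])
      fix i assume i: "1 \<le> i" "i < n"
      then have "w (i + 1) < w i" using no Sym_neq[OF w(1), of i] by (metis nat_neq_iff)
      then show "(w0 n \<circ> w) i < (w0 n \<circ> w) (i + 1)"
        using Sym_inside[OF w(1), of i] Sym_inside[OF w(1), of "i + 1"] i by (auto simp: w0_def)
    qed
    then have "w0 n \<circ> (w0 n \<circ> w) = w0 n" by simp
    then show False using w(2) by simp
  qed
  then obtain i where i: "1 \<le> i \<and> i < n \<and> w i < w (i + 1)"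
    and least: "\<And>k. k < i \<Longrightarrow> \<not> (1 \<le> k \<and> k < n \<and> w k < w (k + 1))"
    using exists_least_iff[of "\<lambda>i. 1 \<le> i \<and> i < n \<and> w i < w (i + 1)"] by blast
  show ?thesis
  proof (rule that[of i])
    fix k assume "1 \<le> k" "k < i"
    then show "w (k + 1) < w k"
      using least[of k] i Sym_neq[OF w(1), of k] by (metis nat_neq_iff order.strict_trans)
  qed (use i in auto)
qed

lemma w0_descent: "1 \<le> i \<Longrightarrow> i < n \<Longrightarrow> w0 n (i + 1) < w0 n i"
  by (simp add: w0_def)

section \<open>Independence of the chain and stability\<close>

definition staircase :: "nat \<Rightarrow> xypoly" where
  "staircase n = (\<Prod>(i, j) \<in> {(i, j). 1 \<le> i \<and> 1 \<le> j \<and> i + j \<le> n}. X i - Y j)"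

lemma finite_staircase: "finite {(i :: nat, j :: nat). 1 \<le> i \<and> 1 \<le> j \<and> i + j \<le> n}"
  by (rule finite_subset[of _ "{..n} \<times> {..n}"]) auto

lemma is_schubert_w0: "is_schubert n (w0 n) (staircase n)"
  unfolding staircase_def by (rule is_schubert.top)

lemma is_schubert_Sym: "is_schubert n w f \<Longrightarrow> w \<in> Sym n"
  by (induction rule: is_schubert.induct) (blast intro: w0_Sym Sym_step)+

lemma is_schubert_step:
  assumes "is_schubert n w f" "1 \<le> i" "i < n" "w (i + 1) < w i" "u = w \<circ> transpose i (i + 1)"
  shows "is_schubert n u (divdiff i f)"
  using is_schubert.step[OF assms(1-3)] perm_length_less_iff[OF is_schubert_Sym[OF assms(1)] assms(2,3)]
    assms(4,5) by blast

text \<open>The induction climbs towards w0: n * n is a crude bound on the length, so the measure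
  decreases whenever an ascent is replaced by a descent.\<close>

lemma is_schubert_exists: "w \<in> Sym n \<Longrightarrow> \<exists>f. is_schubert n w f"
proof (induction "n * n - perm_length w" arbitrary: w rule: less_induct)
  case less
  show ?case
  proof (cases "w = w0 n")
    case False
    then obtain i where i: "1 \<le> i" "i < n" "w i < w (i + 1)"
      using first_ascent[OF less.prems] by metis
    let ?u = "w \<circ> transpose i (i + 1)"
    have u: "?u \<in> Sym n" using Sym_step less.prems i by blast
    have "n * n - perm_length ?u < n * n - perm_length w"
      using perm_length_ascent[OF less.prems i(3)] perm_length_le[OF u] by linarith
    then obtain f where "is_schubert n ?u f" using less.hyps u by blast
    then have "is_schubert n w (divdiff i f)"
      by (rule is_schubert_step) (use i in auto)
    then show ?thesis ..
  qed (use is_schubert_w0 in blast)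
qed

text \<open>Any two ascents \<open>i < j\<close> of a permutation are joined above it by the longest element of
  the parabolic subgroup generated by \<open>s\<^sub>i\<close> and \<open>s\<^sub>j\<close>, so that independence of the chain
  reduces to the braid and commutation relations.\<close>

lemma is_schubert_diamond:
  assumes w: "w \<in> Sym n" and i: "1 \<le> i" "w i < w (i + 1)" and j: "i < j" "j < n" "w j < w (j + 1)"
  obtains f g where "is_schubert n (w \<circ> transpose i (i + 1)) f"
    "is_schubert n (w \<circ> transpose j (j + 1)) g" "divdiff i f = divdiff j g"
proof (cases "j = i + 1")
  case False
  then have ij: "i + 1 < j" using j by simp
  let ?u = "w \<circ> transpose i (i + 1) \<circ> transpose j (j + 1)"
  obtain h where h: "is_schubert n ?u h"
    using is_schubert_exists Sym_step[OF Sym_step[OF w]] i j by (metis less_trans less_imp_le order_le_less_trans)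
  have "is_schubert n (w \<circ> transpose i (i + 1)) (divdiff j h)"
    by (rule is_schubert_step[OF h]) (use i j ij in \<open>auto simp: transpose_def fun_eq_iff\<close>)
  moreover have "is_schubert n (w \<circ> transpose j (j + 1)) (divdiff i h)"
    by (rule is_schubert_step[OF h]) (use i j ij in \<open>auto simp: transpose_def fun_eq_iff\<close>)
  ultimately show ?thesis using divdiff_commute[OF ij] that by blast
next
  case True
  let ?s = "transpose i (i + 1)" and ?t = "transpose (i + 1) (i + 2)"
  let ?u = "w \<circ> ?s \<circ> ?t \<circ> ?s"
  have "?u \<in> Sym n"
    using Sym_step[OF Sym_step[OF Sym_step[OF w]], of i "i + 1" i] i j True by simp
  then obtain h where h: "is_schubert n ?u h" using is_schubert_exists by blast
  have 1: "is_schubert n (w \<circ> ?s \<circ> ?t) (divdiff i h)"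
    by (rule is_schubert_step[OF h]) (use i j True in \<open>auto simp: transpose_def fun_eq_iff\<close>)
  have 2: "is_schubert n (w \<circ> ?s) (divdiff j (divdiff i h))"
    by (rule is_schubert_step[OF 1]) (use i j True in \<open>auto simp: transpose_def fun_eq_iff\<close>)
  have 3: "is_schubert n (w \<circ> ?t \<circ> ?s) (divdiff j h)"
    by (rule is_schubert_step[OF h]) (use i j True in \<open>auto simp: transpose_def fun_eq_iff\<close>)
  have 4: "is_schubert n (w \<circ> transpose j (j + 1)) (divdiff i (divdiff j h))"
    by (rule is_schubert_step[OF 3]) (use i j True in \<open>auto simp: transpose_def fun_eq_iff\<close>)
  show ?thesis
    using that[OF 2 4] divdiff_braid[of i h] True by simp
qed

lemma is_schubert_cases:
  assumes "is_schubert n w f"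
  obtains "w = w0 n" "f = staircase n"
  | i g where "1 \<le> i" "i < n" "w i < w (i + 1)" "is_schubert n (w \<circ> transpose i (i + 1)) g"
    "f = divdiff i g"
  using assms
proof cases
  case top
  then show ?thesis using that(1) by (simp add: staircase_def)
next
  case (step u g i)
  have "u (i + 1) < u i"
    using perm_length_less_iff[OF is_schubert_Sym[OF step(3)] step(4,5)] step(6) by simp
  then show ?thesis
    using that(2)[of i g] step by simp
qed

text \<open>A confluence argument in the style of Newman's lemma, with w0 as the common end. Two
  chains whose last steps are at different ascents are compared with the two chains of the diamond,
  and the induction hypothesis identifies the predecessors.\<close>

lemma is_schubert_unique: "is_schubert n w f \<Longrightarrow> is_schubert n w g \<Longrightarrow> f = g"
proof (induction "n * n - perm_length w" arbitrary: w f g rule: less_induct)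
  case less
  have w: "w \<in> Sym n" using is_schubert_Sym less.prems by blast
  have IH: "f' = g'" if "1 \<le> i" "i < n" "w i < w (i + 1)"
    "is_schubert n (w \<circ> transpose i (i + 1)) f'" "is_schubert n (w \<circ> transpose i (i + 1)) g'" for i f' g'
  proof (rule less.hyps[OF _ that(4,5)])
    show "n * n - perm_length (w \<circ> transpose i (i + 1)) < n * n - perm_length w"
      using perm_length_ascent[OF w that(3)] perm_length_le[OF is_schubert_Sym[OF that(4)]] by linarith
  qed
  have lt: "divdiff i f' = divdiff j g'"
    if i: "1 \<le> i" "w i < w (i + 1)" and j: "i < j" "j < n" "w j < w (j + 1)"
      and f': "is_schubert n (w \<circ> transpose i (i + 1)) f'"
      and g': "is_schubert n (w \<circ> transpose j (j + 1)) g'" for i j f' g'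
  proof -
    obtain f'' g'' where fg: "is_schubert n (w \<circ> transpose i (i + 1)) f''"
      "is_schubert n (w \<circ> transpose j (j + 1)) g''" "divdiff i f'' = divdiff j g''"
      using is_schubert_diamond[OF w i j] .
    have "f' = f''" using IH[OF i(1) _ i(2) f' fg(1)] j by simp
    moreover have "g' = g''" using IH[OF _ j(2,3) g' fg(2)] i j by simp
    ultimately show ?thesis using fg(3) by simp
  qed
  show ?case
  proof (rule is_schubert_cases[OF less.prems(1)])
    assume f: "w = w0 n" "f = staircase n"
    show "f = g"
    proof (rule is_schubert_cases[OF less.prems(2)])
      fix i assume "1 \<le> i" "i < n" "w i < w (i + 1)"
      then show "f = g" using f w0_descent[of i n] by simp
    qed (use f in simp)
  next
    fix i f' assume i: "1 \<le> i" "i < n" "w i < w (i + 1)" "is_schubert n (w \<circ> transpose i (i + 1)) f'"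
      "f = divdiff i f'"
    show "f = g"
    proof (rule is_schubert_cases[OF less.prems(2)])
      assume "w = w0 n"
      then show "f = g" using i w0_descent[of i n] by simp
    next
      fix j g' assume j: "1 \<le> j" "j < n" "w j < w (j + 1)" "is_schubert n (w \<circ> transpose j (j + 1)) g'"
        "g = divdiff j g'"
      consider "i = j" | "i < j" | "j < i" by linarith
      then show "f = g"
      proof cases
        case 1
        then show ?thesis using IH i j by blast
      next
        case 2
        then show ?thesis using lt[of i j f' g'] i j by simp
      next
        case 3
        then show ?thesis using lt[of j i g' f'] i j by simp
      qed
    qed
  qed
qed

text \<open>Stability: \<open>w\<^sub>0\<^sup>(\<^sup>n\<^sup>+\<^sup>1\<^sup>) s\<^sub>1 \<cdots> s\<^sub>n = w\<^sub>0\<^sup>(\<^sup>n\<^sup>)\<close>, and the \<open>k\<close>-th divided difference removes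
  the factor \<open>x\<^sub>k - y\<^bsub>n+1-k\<^esub>\<close> at the end of row \<open>k\<close>.\<close>

lemma is_schubert_w0_Suc_aux:
  assumes "k \<le> n"
  shows "is_schubert (n + 1)
    (\<lambda>i. if 1 \<le> i \<and> i \<le> k then n + 1 - i else if i = k + 1 then n + 1
         else if k + 1 < i \<and> i \<le> n + 1 then n + 2 - i else i)
    (\<Prod>(i, j) \<in> {(i, j). 1 \<le> i \<and> 1 \<le> j \<and> i + j \<le> n + 1 \<and> \<not> (i \<le> k \<and> i + j = n + 1)}. X i - Y j)"
  using assms
proof (induction k)
  case 0
  have "{(i :: nat, j :: nat). 1 \<le> i \<and> 1 \<le> j \<and> i + j \<le> n + 1 \<and> \<not> (i \<le> 0 \<and> i + j = n + 1)}
      = {(i, j). 1 \<le> i \<and> 1 \<le> j \<and> i + j \<le> n + 1}" by auto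
  moreover have "(\<lambda>i. if 1 \<le> i \<and> i \<le> 0 then n + 1 - i else if i = 0 + 1 then n + 1
         else if 0 + 1 < i \<and> i \<le> n + 1 then n + 2 - i else i) = w0 (n + 1)"
    by (auto simp: w0_def fun_eq_iff)
  ultimately show ?case using is_schubert.top[of "n + 1"] by simp
next
  case (Suc k)
  let ?T = "\<lambda>k. {(i :: nat, j :: nat). 1 \<le> i \<and> 1 \<le> j \<and> i + j \<le> n + 1 \<and> \<not> (i \<le> k \<and> i + j = n + 1)}"
  let ?s = "transpose (k + 1) (k + 2)"
  define R where "R = (\<Prod>(i, j) \<in> ?T (Suc k). X i - Y j)"
  have fin: "finite (?T k)" for k
    by (rule finite_subset[of _ "{..n + 1} \<times> {..n + 1}"]) auto
  have T: "?T k = insert (k + 1, n - k) (?T (Suc k))" "(k + 1, n - k) \<notin> ?T (Suc k)"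
    using Suc.prems by auto
  then have F: "(\<Prod>(i, j) \<in> ?T k. X i - Y j) = R * (X (k + 1) - Y (n - k))"
    using fin by (simp add: R_def mult.commute)
  \<comment> \<open>Rows k + 1 and k + 2 of R both have length n - k - 1, so R is symmetric in
    x_{k+1} and x_{k+2}.\<close>
  have "sw (k + 1) R = (\<Prod>(i, j) \<in> ?T (Suc k). X (?s i) - Y j)"
    by (simp add: R_def sw.prod sw.diff sw_X Y_eq split_def)
  also have "\<dots> = R"
    unfolding R_def
    by (rule prod.reindex_bij_witness[of _ "map_prod ?s id" "map_prod ?s id"])
      (auto simp: transpose_def split: if_splits)
  finally have "divdiff (k + 1) (R * (X (k + 1) - Y (n - k))) = R * divdiff (k + 1) (X (k + 1) - Y (n - k))"
    by (rule divdiff_mult_sym)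
  also have "divdiff (k + 1) (X (k + 1) - Y (n - k)) = 1"
    by (rule divdiff_unique) (simp add: sw.diff sw_X Y_eq)
  finally have "divdiff (k + 1) (\<Prod>(i, j) \<in> ?T k. X i - Y j) = R"
    using F by simp
  moreover have "is_schubert (n + 1) (\<lambda>i. if 1 \<le> i \<and> i \<le> k then n + 1 - i else if i = k + 1 then n + 1
         else if k + 1 < i \<and> i \<le> n + 1 then n + 2 - i else i) (\<Prod>(i, j) \<in> ?T k. X i - Y j)"
    using Suc by simp
  ultimately show ?case
    using Suc.prems unfolding R_def
    by (subst (asm) eq_commute) (simp only:, rule is_schubert_step[where i = "k + 1"], auto simp: transpose_def fun_eq_iff)
qed

lemma is_schubert_Suc: "is_schubert n w f \<Longrightarrow> is_schubert (Suc n) w f"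
proof (induction rule: is_schubert.induct)
  case top
  have "{(i :: nat, j :: nat). 1 \<le> i \<and> 1 \<le> j \<and> i + j \<le> n + 1 \<and> \<not> (i \<le> n \<and> i + j = n + 1)}
      = {(i, j). 1 \<le> i \<and> 1 \<le> j \<and> i + j \<le> n}" by auto
  moreover have "(\<lambda>i. if 1 \<le> i \<and> i \<le> n then n + 1 - i else if i = n + 1 then n + 1
         else if n + 1 < i \<and> i \<le> n + 1 then n + 2 - i else i) = w0 n"
    by (auto simp: w0_def fun_eq_iff)
  ultimately show ?case using is_schubert_w0_Suc_aux[of n n] by simp
next
  case (step w f i)
  then show ?case by (intro is_schubert.step) auto
qed

lemma is_schubert_mono: "m \<le> n \<Longrightarrow> is_schubert m w f \<Longrightarrow> is_schubert n w f"
  by (induction rule: dec_induct) (auto intro: is_schubert_Suc)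

section \<open>Schubert polynomials on all finite permutations and their divided differences\<close>

lemma schubert_eqI:
  assumes "is_schubert n w f"
  shows "schubert w = f"
  unfolding schubert_def
proof (rule the_equality)
  fix g assume "\<exists>m. is_schubert m w g"
  then obtain m where "is_schubert m w g" ..
  \<comment> \<open>The chain producing g may live in another symmetric group; stability moves both
    chains into the larger of the two.\<close>
  then show "g = f"
    using assms is_schubert_mono[of m "max m n"] is_schubert_mono[of n "max m n"]
    by (intro is_schubert_unique[of "max m n" w]) auto
qed (use assms in blast)

lemma is_schubert_schubert: "w \<in> Sym n \<Longrightarrow> is_schubert n w (schubert w)"
  using is_schubert_exists schubert_eqI by metis

lemma schubert_w0: "schubert (w0 n) = staircase n"
  by (rule schubert_eqI[OF is_schubert_w0])

lemma schubert_id: "schubert id = 1"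
proof -
  have "w0 0 = id" by (auto simp: w0_def fun_eq_iff)
  moreover have "staircase 0 = 1"
    unfolding staircase_def by (rule prod.neutral) auto
  ultimately show ?thesis using schubert_w0[of 0] by simp
qed

lemma divdiff_schubert_descent:
  assumes "w \<in> Sym_inf" "1 \<le> i" "w (i + 1) < w i"
  shows "divdiff i (schubert w) = schubert (w \<circ> transpose i (i + 1))"
proof -
  obtain n where "w \<in> Sym n" "i < n" using Sym_infD[OF assms(1)] .
  then show ?thesis
    using schubert_eqI[OF is_schubert_step[OF is_schubert_schubert]] assms by simp
qed

text \<open>At an ascent the Schubert polynomial is itself a value of \<open>divdiff i\<close>, and
  \<open>divdiff i\<close> squares to zero.\<close>

lemma divdiff_schubert_ascent:
  assumes "w \<in> Sym_inf" "1 \<le> i" "w i < w (i + 1)"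
  shows "divdiff i (schubert w) = 0"
proof -
  have "schubert w = divdiff i (schubert (w \<circ> transpose i (i + 1)))"
    using divdiff_schubert_descent[OF Sym_inf_step[OF assms(1,2)] assms(2)] assms(3) by simp
  then show ?thesis by simp
qed

lemma divdiff_schubert:
  assumes "w \<in> Sym_inf" "1 \<le> i"
  shows "divdiff i (schubert w) = (if w (i + 1) < w i then schubert (w \<circ> transpose i (i + 1)) else 0)"
proof -
  obtain n where "w \<in> Sym n" using Sym_infD[OF assms(1)] .
  then have "w i \<noteq> w (i + 1)" using Sym_neq by blast
  then show ?thesis
    using divdiff_schubert_descent[OF assms] divdiff_schubert_ascent[OF assms] by auto
qed

section \<open>Localization, linear independence and duality\<close>

text \<open>A permutation other than w0 lies strictly below w0 at some position i. Then i + v(i)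
  \<le> n, and the factor x_i - y_{v(i)} vanishes at v.\<close>

lemma ev_staircase:
  assumes "v \<in> Sym n" "v \<noteq> w0 n"
  shows "ev v (staircase n) = 0"
proof -
  have "\<exists>i. 1 \<le> i \<and> i \<le> n \<and> v i < w0 n i"
    using permutes_le_imp_eq[OF w0_Sym assms(1)] assms(2) not_le by metis
  then obtain i where "1 \<le> i" "i \<le> n" "v i < n + 1 - i"
    by (auto simp: w0_def)
  then have "(i, v i) \<in> {(i, j). 1 \<le> i \<and> 1 \<le> j \<and> i + j \<le> n}"
    using Sym_inside[OF assms(1), of i] by auto
  then show ?thesis
    unfolding staircase_def ev.prod
    by (intro prod_zero[OF finite_staircase] bexI) (auto simp: ev.diff ev_X ev_Y)
qed

lemma ev_w0_staircase: "ev (w0 n) (staircase n) \<noteq> 0"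
  unfolding staircase_def ev.prod
  by (subst prod_zero_iff[OF finite_staircase]) (auto simp: ev.diff ev_X ev_Y w0_def)

text \<open>A step of the chain shortens w by one, and v s_i is longer than v by at most one, so
  both values of f entering the quotient already vanish. Comparing lengths instead of using Bruhat
  order is enough for the localization at the identity.\<close>

lemma ev_is_schubert_eq_0:
  "is_schubert n w f \<Longrightarrow> v \<in> Sym n \<Longrightarrow> perm_length v < perm_length w \<Longrightarrow> ev v f = 0"
proof (induction arbitrary: v rule: is_schubert.induct)
  case top
  then show ?case using ev_staircase unfolding staircase_def by blast
next
  case (step w f i)
  let ?s = "transpose i (i + 1)"
  have w: "w \<in> Sym n" using is_schubert_Sym step by blast
  have "perm_length w = perm_length (w \<circ> ?s) + 1"
    using perm_length_less_iff[OF w step(2,3)] perm_length_descent[OF w _ step(2,3)] step(4) by blast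
  moreover have "perm_length (v \<circ> ?s) \<le> perm_length v + 1"
    using perm_length_ascent[OF step.prems(1), of i] perm_length_less_iff[OF step.prems(1) step(2,3)]
      Sym_neq[OF step.prems(1), of i]
    by (cases "v i" "v (i + 1)" rule: linorder_cases) auto
  ultimately have "perm_length v < perm_length w" "perm_length (v \<circ> ?s) < perm_length w"
    using step.prems(2) by linarith+
  then have "ev v f = 0" "ev (v \<circ> ?s) f = 0"
    using step.IH step.prems(1) Sym_step[OF step.prems(1) step(2,3)] by blast+
  then have "(y_var (v i) - y_var (v (i + 1))) * ev v (divdiff i f) = 0"
    by (simp only: ev_divdiff diff_self)
  then show ?case
    using Sym_neq[OF step.prems(1), of i] by simp
qed

lemma ev_id_schubert:
  assumes "w \<in> Sym_inf"
  shows "ev id (schubert w) = (if w = id then 1 else 0)"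
proof (cases "w = id")
  case False
  obtain n where w: "w \<in> Sym n" using Sym_infD[OF assms] .
  obtain i where "1 \<le> i" "i < n" "w (i + 1) < w i" using exists_descent[OF w False] .
  then have "perm_length w > 0" using perm_length_descent[OF w] by simp
  moreover have "inversions id = {}" by (auto simp: inversions_def)
  then have "perm_length id = 0" by (simp add: perm_length_eq)
  ultimately show ?thesis
    using ev_is_schubert_eq_0[OF is_schubert_schubert[OF w] Sym_id] False by simp
qed (simp add: schubert_id ev.one)

text \<open>For a descent i < n of v, the value at v is determined by the values of the polynomial
  and of its divided difference at the shorter v s_i. Multiplication by s_i does not bring w into
  S_n, so everything reduces to the value at the identity, which is 0.\<close>

lemma ev_schubert_outside:
  assumes "v \<in> Sym n" "w \<in> Sym_inf" "w \<notin> Sym n"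
  shows "ev v (schubert w) = 0"
  using assms
proof (induction "perm_length v" arbitrary: v w rule: less_induct)
  case less
  show ?case
  proof (cases "v = id")
    case True
    then show ?thesis using ev_id_schubert less.prems Sym_id by auto
  next
    case False
    obtain i where i: "1 \<le> i" "i < n" "v (i + 1) < v i" using exists_descent[OF less.prems(1) False] .
    let ?s = "transpose i (i + 1)"
    have v: "v \<circ> ?s \<in> Sym n" using Sym_step less.prems i by blast
    have lt: "perm_length (v \<circ> ?s) < perm_length v"
      using perm_length_descent[OF less.prems(1) i(3,1,2)] by simp
    have "w \<circ> ?s \<in> Sym_inf" "w \<circ> ?s \<notin> Sym n"
      using Sym_inf_step[OF less.prems(2) i(1)] Sym_step_iff[OF i(1,2), of w] less.prems(3) by blast+
    then have "ev (v \<circ> ?s) (divdiff i (schubert w)) = 0"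
      using less.hyps[OF lt v] divdiff_schubert[OF less.prems(2) i(1)] by (simp add: ev.zero)
    moreover have "ev (v \<circ> ?s) (schubert w) = 0"
      using less.hyps[OF lt v] less.prems by blast
    ultimately show ?thesis
      using ev_divdiff[of "v \<circ> ?s" i "schubert w"] by simp
  qed
qed

text \<open>Localization at the identity isolates the coefficient of the identity. For any other w,
  a divided difference at a descent of w discards the terms without that descent, acts injectively
  on the indices of the others, and moves the coefficient of w to the shorter w s_i.\<close>

lemma schubert_independent:
  assumes "finite A" "A \<subseteq> Sym_inf" "(\<Sum>w\<in>A. scalar (c w) * schubert w) = 0" "w \<in> A"
  shows "c w = 0"
  using assms
proof (induction "perm_length w" arbitrary: w A c rule: less_induct)
  case less
  show ?case
  proof (cases "w = id")
    case True
    have "ev id (\<Sum>w\<in>A. scalar (c w) * schubert w) = (\<Sum>w\<in>A. if w = id then c w else 0)"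
      unfolding ev.sum ev.mult ev_scalar
      by (intro sum.cong) (use less.prems(2) ev_id_schubert in auto)
    then show ?thesis using less.prems True by (simp add: ev.zero)
  next
    case False
    obtain n where w: "w \<in> Sym n" using Sym_infD less.prems by blast
    obtain i where i: "1 \<le> i" "i < n" "w (i + 1) < w i" using exists_descent[OF w False] .
    let ?s = "transpose i (i + 1)"
    let ?B = "{u \<in> A. u (i + 1) < u i}"
    have inj: "inj_on (\<lambda>u. u \<circ> ?s) ?B"
      by (rule inj_on_inverseI[of _ "\<lambda>u. u \<circ> ?s"]) simp
    have d: "divdiff i (schubert u) = (if u (i + 1) < u i then schubert (u \<circ> ?s) else 0)" if "u \<in> A" for u
      using divdiff_schubert[OF _ i(1)] less.prems(2) that by blast
    have "0 = (\<Sum>u\<in>A. scalar (c u) * divdiff i (schubert u))"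
      using arg_cong[OF less.prems(3), of "divdiff i"] by (simp add: divdiff_sum divdiff_scalar_mult)
    also have "\<dots> = (\<Sum>u\<in>?B. scalar (c u) * schubert (u \<circ> ?s))"
      by (rule sum.mono_neutral_cong_right) (use less.prems(1) in \<open>auto simp: d\<close>)
    also have "\<dots> = (\<Sum>u\<in>(\<lambda>u. u \<circ> ?s) ` ?B. scalar (c (u \<circ> ?s)) * schubert u)"
      unfolding sum.reindex[OF inj] by (rule sum.cong) (simp_all only: comp_def[of "\<lambda>u. scalar (c (u \<circ> ?s)) * schubert u"] transpose_twice)
    finally have sum: "(\<Sum>u\<in>(\<lambda>u. u \<circ> ?s) ` ?B. scalar (c (u \<circ> ?s)) * schubert u) = 0" by (rule sym)
    have lt: "perm_length (w \<circ> ?s) < perm_length w"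
      using perm_length_descent[OF w i(3,1,2)] by simp
    have sub: "(\<lambda>u. u \<circ> ?s) ` ?B \<subseteq> Sym_inf"
      using less.prems(2) Sym_inf_step[OF _ i(1)] by blast
    have "w \<circ> ?s \<in> (\<lambda>u. u \<circ> ?s) ` ?B"
      by (rule imageI) (use less.prems(4) i in simp)
    moreover have "finite ((\<lambda>u. u \<circ> ?s) ` ?B)" using less.prems(1) by simp
    ultimately have "c (w \<circ> ?s \<circ> ?s) = 0"
      using less.hyps[of "w \<circ> ?s" "(\<lambda>u. u \<circ> ?s) ` ?B" "\<lambda>u. c (u \<circ> ?s)", OF lt _ sub sum]
      by blast
    then show ?thesis by simp
  qed
qed

lemma is_schubert_expansion_sum:
  assumes "is_schubert_expansion A f c" "finite S" "{w. c w \<noteq> 0} \<subseteq> S"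
  shows "f = (\<Sum>w\<in>S. scalar (c w) * schubert w)"
proof -
  have "f = (\<Sum>w | c w \<noteq> 0. scalar (c w) * schubert w)"
    using assms(1) by (simp add: is_schubert_expansion_def)
  also have "\<dots> = (\<Sum>w\<in>S. scalar (c w) * schubert w)"
    by (rule sum.mono_neutral_left) (use assms in \<open>auto simp: scalar.zero\<close>)
  finally show ?thesis .
qed

lemma is_schubert_expansionI:
  assumes "finite S" "S \<subseteq> A" "f = (\<Sum>w\<in>S. scalar (c w) * schubert w)" "\<And>w. w \<notin> S \<Longrightarrow> c w = 0"
  shows "is_schubert_expansion A f c"
proof -
  have sub: "{w. c w \<noteq> 0} \<subseteq> S" using assms(4) by blast
  have "f = (\<Sum>w | c w \<noteq> 0. scalar (c w) * schubert w)"
    unfolding assms(3)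
    by (rule sum.mono_neutral_right) (use assms(1) sub in \<open>auto simp: scalar.zero\<close>)
  then show ?thesis
    using sub assms(1,2) by (auto simp: is_schubert_expansion_def intro: finite_subset)
qed

lemma is_schubert_expansion_unique:
  assumes A: "A \<subseteq> Sym_inf" and c: "is_schubert_expansion A f c" and d: "is_schubert_expansion A f d"
  shows "c = d"
proof
  fix w
  let ?S = "{w. c w \<noteq> 0} \<union> {w. d w \<noteq> 0}"
  have S: "finite ?S" "?S \<subseteq> Sym_inf"
    using A c d unfolding is_schubert_expansion_def by auto
  have "(\<Sum>w\<in>?S. scalar (c w - d w) * schubert w) = f - f"
    using is_schubert_expansion_sum[OF c S(1)] is_schubert_expansion_sum[OF d S(1)]
    by (simp add: scalar.diff left_diff_distrib sum_subtractf)
  then have "c w - d w = 0" if "w \<in> ?S"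
    using schubert_independent[OF S, of "\<lambda>w. c w - d w"] that by simp
  then show "c w = d w" by (cases "w \<in> ?S") auto
qed

lemma schubert_coeff_eqI:
  assumes "A \<subseteq> Sym_inf" "is_schubert_expansion A f c"
  shows "schubert_coeff A f = c"
  unfolding schubert_coeff_def
  by (rule the_equality) (use assms is_schubert_expansion_unique in blast)+

text \<open>Up to the factor \<open>\<Prod>\<^bsub>i<j\<^esub> (y\<^sub>i - y\<^sub>j)\<close>, this is integration over the flag variety, computed
  by localization at the torus fixed points.\<close>

definition flag_int :: "nat \<Rightarrow> xypoly \<Rightarrow> ypoly" where
  "flag_int n h = (\<Sum>v\<in>Sym n. of_int (sign v) * ev v h)"

lemma flag_int_diff: "flag_int n (f - g) = flag_int n f - flag_int n g"
  by (simp add: flag_int_def ev.diff algebra_simps sum_subtractf)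

lemma flag_int_sum: "flag_int n (sum f A) = (\<Sum>x\<in>A. flag_int n (f x))"
  by (simp add: flag_int_def ev.sum sum_distrib_left) (rule sum.swap)

lemma flag_int_scalar: "flag_int n (scalar c * f) = c * flag_int n f"
  by (simp add: flag_int_def ev.mult ev_scalar sum_distrib_left algebra_simps)

lemma sign_step:
  assumes "v \<in> Sym n"
  shows "sign (v \<circ> transpose i (i + 1)) = - sign v"
proof -
  have "permutation v" using SymD(1)[OF assms] permutation_permutes by blast
  then show ?thesis
    by (subst sign_compose) (auto simp: sign_swap_id permutation_swap_id)
qed

lemma flag_int_sw:
  assumes "1 \<le> i" "i < n"
  shows "flag_int n (sw i h) = - flag_int n h"
proof -
  let ?s = "transpose i (i + 1)"
  have "flag_int n (sw i h) = (\<Sum>v\<in>Sym n. of_int (sign v) * ev (v \<circ> ?s) h)"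
    by (simp add: flag_int_def ev_sw)
  also have "\<dots> = (\<Sum>v\<in>Sym n. - (of_int (sign v) * ev v h))"
    by (rule sum.reindex_bij_witness[of _ "\<lambda>v. v \<circ> ?s" "\<lambda>v. v \<circ> ?s"])
      (use Sym_step[OF _ assms] sign_step in auto)
  finally show ?thesis by (simp add: flag_int_def sum_negf)
qed

lemma flag_int_sym:
  assumes "1 \<le> i" "i < n" "sw i h = h"
  shows "flag_int n h = 0"
proof -
  have "flag_int n h + flag_int n h = 0"
    using flag_int_sw[OF assms(1,2), of h] assms(3) by simp
  then have "2 * flag_int n h = 0" by simp
  then show ?thesis unfolding mult_eq_0_iff by simp
qed

text \<open>The difference of the two integrands is \<open>(g \<cdot> s\<^sub>i f - f \<cdot> s\<^sub>i g) / (x\<^sub>i - x\<^bsub>i+1\<^esub>)\<close>, which is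
  symmetric.\<close>

lemma flag_int_divdiff:
  assumes "1 \<le> i" "i < n"
  shows "flag_int n (divdiff i f * g) = flag_int n (f * divdiff i g)"
proof -
  let ?h = "f * divdiff i g - divdiff i f * g"
  have 1: "(X i - X (i + 1)) * ?h = g * sw i f - f * sw i g"
    using divdiff_eq[of i f] divdiff_eq[of i g] by algebra
  have "sw i ((X i - X (i + 1)) * ?h) = - ((X i - X (i + 1)) * ?h)"
    unfolding 1 by (simp add: sw.mult sw.diff)
  then have "(X i - X (i + 1)) * sw i ?h = (X i - X (i + 1)) * ?h"
    by (simp only: sw.mult[of i "X i - X (i + 1)"] sw_X_diff mult_minus_left neg_equal_iff_equal)
  then have "sw i ?h = ?h"
    using X_diff_nonzero[of i] mult_left_cancel by blast
  then show ?thesis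
    using flag_int_sym[OF assms, of ?h] by (simp add: flag_int_diff)
qed

lemma flag_int_schubert_outside:
  assumes "w \<in> Sym_inf" "w \<notin> Sym n"
  shows "flag_int n (schubert w * f) = 0"
  unfolding flag_int_def
  by (rule sum.neutral) (use ev_schubert_outside assms in \<open>auto simp: ev.mult\<close>)

section \<open>The dual family and the pairing\<close>

definition rev_schubert :: "nat \<Rightarrow> (nat \<Rightarrow> nat) \<Rightarrow> xypoly" where
  "rev_schubert n w = rename_y (w0 n) (schubert w)"

lemma divdiff_rev_schubert:
  assumes "w \<in> Sym_inf" "1 \<le> i"
  shows "divdiff i (rev_schubert n w)
    = (if w (i + 1) < w i then rev_schubert n (w \<circ> transpose i (i + 1)) else 0)"
  unfolding rev_schubert_def rename_y_divdiff[OF bij_w0, symmetric] divdiff_schubert[OF assms]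
  by (simp add: rhom.zero[OF rhom_rename_y[OF bij_w0]])

text \<open>Only the fixed point w0 contributes. Nonvanishing is what permits cancelling this factor
  at the end.\<close>

lemma flag_int_staircase_nonzero: "flag_int n (staircase n) \<noteq> 0"
proof -
  have "flag_int n (staircase n) = (\<Sum>v\<in>{w0 n}. of_int (sign v) * ev v (staircase n))"
    unfolding flag_int_def
    by (rule sum.mono_neutral_right) (use finite_Sym w0_Sym ev_staircase in auto)
  then show ?thesis using ev_w0_staircase by (simp add: sign_def)
qed

text \<open>Along the chain from w0 down to a, each divided difference is moved by self-adjointness
  to the dual factor, where it either multiplies b by s_i or gives 0.\<close>

lemma flag_int_duality:
  assumes "is_schubert n a f" "b \<in> Sym n"
  shows "flag_int n (f * rev_schubert n b) = (if b = w0 n \<circ> a then flag_int n (staircase n) else 0)"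
  using assms
proof (induction arbitrary: b rule: is_schubert.induct)
  case top
  \<comment> \<open>The staircase leaves only the point w0; there, reversing the y turns the value
    of the dual factor into the value of \<open>schubert b\<close> at the identity.\<close>
  have 1: "ev (w0 n) (rev_schubert n b) = (if b = id then 1 else 0)"
    using ev_rename_y[OF bij_w0, of n id "schubert b"] ev_id_schubert[OF Sym_imp_Sym_inf[OF top]]
    by (simp add: rev_schubert_def rhom.zero[OF rhom_rename_vars[OF bij_w0]]
        rhom.one[OF rhom_rename_vars[OF bij_w0]] del: id_apply)
  have "flag_int n (staircase n * rev_schubert n b)
      = (\<Sum>v\<in>Sym n. (if b = id then of_int (sign v) * ev v (staircase n) else 0))"
    unfolding flag_int_def
  proof (rule sum.cong[OF refl])
    fix v assume v: "v \<in> Sym n"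
    show "of_int (sign v) * ev v (staircase n * rev_schubert n b)
      = (if b = id then of_int (sign v) * ev v (staircase n) else 0)"
      using ev_staircase[OF v] 1 by (cases "v = w0 n") (auto simp: ev.mult)
  qed
  also have "\<dots> = (if b = id then flag_int n (staircase n) else 0)"
    by (cases "b = id") (simp_all add: flag_int_def)
  finally show ?case
    unfolding staircase_def[symmetric] w0_comp_w0(1) .
next
  case (step w f i)
  let ?s = "transpose i (i + 1)"
  have w: "w \<in> Sym n" using is_schubert_Sym step by blast
  have wi: "w (i + 1) < w i" using perm_length_less_iff[OF w step(2,3)] step(4) by blast
  have eq: "flag_int n (divdiff i f * rev_schubert n b)
     = flag_int n (f * (if b (i + 1) < b i then rev_schubert n (b \<circ> ?s) else 0))"
    using flag_int_divdiff[OF step(2,3)] divdiff_rev_schubert[OF Sym_imp_Sym_inf[OF step.prems] step(2)]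
    by simp
  show ?case
  proof (cases "b (i + 1) < b i")
    case True
    have "(b \<circ> ?s = w0 n \<circ> w) = (b = w0 n \<circ> (w \<circ> ?s))"
      by (metis comp_assoc transpose_twice)
    then show ?thesis
      using step.IH[OF Sym_step[OF step.prems step(2,3)]] unfolding eq if_P[OF True] by (simp only:)
  next
    case False
    \<comment> \<open>The only index with a nonzero pairing has a descent at i, so it cannot be a b
      without one.\<close>
    have "(w0 n \<circ> (w \<circ> ?s)) (i + 1) < (w0 n \<circ> (w \<circ> ?s)) i"
      using wi Sym_inside[OF w, of i] Sym_inside[OF w, of "i + 1"] step(2,3) by (auto simp: w0_def)
    then have ne: "b \<noteq> w0 n \<circ> (w \<circ> ?s)" using False by blast
    show ?thesis
      unfolding eq if_not_P[OF False] if_not_P[OF ne] by (simp add: flag_int_def ev.zero)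
  qed
qed

section \<open>Exponent bounds\<close>

abbreviation lk :: "('a \<Rightarrow>\<^sub>0 'b::zero) \<Rightarrow> 'a \<Rightarrow> 'b" where
  "lk \<equiv> Poly_Mapping.lookup"

definition exps_le :: "(nat \<Rightarrow> nat) \<Rightarrow> xypoly \<Rightarrow> bool" where
  "exps_le b f \<longleftrightarrow> (\<forall>m\<in>Poly_Mapping.keys f. \<forall>i. lk m i \<le> b i)"

lemma exps_le_mono: "exps_le b f \<Longrightarrow> (\<And>i. b i \<le> b' i) \<Longrightarrow> exps_le b' f"
  unfolding exps_le_def by (meson le_trans)

lemma exps_le_diff: "exps_le b f \<Longrightarrow> exps_le b g \<Longrightarrow> exps_le b (f - g)"
  unfolding exps_le_def using keys_diff[of f g] by (meson Un_iff subsetD)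

lemma exps_le_1: "exps_le b 1"
  by (simp add: exps_le_def)

lemma exps_le_scalar: "exps_le b (scalar c)"
  by (simp add: exps_le_def scalar_def)

lemma exps_le_mult:
  assumes "exps_le b f" "exps_le b' g" shows "exps_le (\<lambda>i. b i + b' i) (f * g)"
  unfolding exps_le_def
proof (intro ballI allI)
  fix m i assume "m \<in> Poly_Mapping.keys (f * g)"
  then obtain k l where "m = k + l" "k \<in> Poly_Mapping.keys f" "l \<in> Poly_Mapping.keys g"
    using keys_mult[of f g] by blast
  then show "lk m i \<le> b i + b' i"
    using assms by (auto simp: exps_le_def lookup_add intro: add_mono)
qed

lemma exps_le_scalar_mult: "exps_le b f \<Longrightarrow> exps_le b (scalar c * f)"
  using exps_le_mult[OF exps_le_scalar[of "\<lambda>_. 0" c], of b f] by simp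

lemma exps_le_sum: "(\<And>x. x \<in> A \<Longrightarrow> exps_le b (f x)) \<Longrightarrow> exps_le b (sum f A)"
  unfolding exps_le_def using keys_sum[of f A] by (meson UN_E subsetD)

lemma exps_le_prod:
  "(\<And>x. x \<in> A \<Longrightarrow> exps_le (b x) (f x)) \<Longrightarrow> exps_le (\<lambda>i. \<Sum>x\<in>A. b x i) (prod f A)"
proof (induction A rule: infinite_finite_induct)
  case (insert x A)
  then show ?case using exps_le_mult[of "b x" "f x"] by simp
qed (simp_all add: exps_le_1)

text \<open>A description of the monomials m' that can occur in \<open>divdiff i\<close> of the
  monomial m, read off from the geometric sum (x^a z^b - x^b z^a) / (x - z).\<close>

definition divdiff_exps :: "nat \<Rightarrow> (nat \<Rightarrow>\<^sub>0 nat) \<Rightarrow> (nat \<Rightarrow>\<^sub>0 nat) \<Rightarrow> bool" where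
  "divdiff_exps i m m' \<longleftrightarrow> (\<forall>j. j \<noteq> i \<longrightarrow> j \<noteq> i + 1 \<longrightarrow> lk m' j = lk m j)
    \<and> lk m' i + lk m' (i + 1) + 1 = lk m i + lk m (i + 1)
    \<and> lk m' i < max (lk m i) (lk m (i + 1)) \<and> lk m' (i + 1) < max (lk m i) (lk m (i + 1))"

lemma sw_single: "sw i (Poly_Mapping.single m c)
    = Poly_Mapping.single (Poly_Mapping.map_key (transpose i (i + 1)) m) c"
  unfolding sw_def by (subst rename_vars_single) (simp_all only: bij_transpose inv_transpose_eq)

lemma lookup_swap: "lk (Poly_Mapping.map_key (transpose i j) m) k = lk m (transpose i j k)"
  by (simp add: lookup_map_key)

lemma divdiff_sw: "divdiff i (sw i f) = - divdiff i f"
proof (rule divdiff_unique)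
  show "(X i - X (i + 1)) * - divdiff i f = sw i f - sw i (sw i f)"
    using divdiff_eq[of i f] unfolding sw_sw by algebra
qed

lemma divdiff_single_keys_gt:
  assumes gt: "lk m (i + 1) < lk m i" and m': "m' \<in> Poly_Mapping.keys (divdiff i (Poly_Mapping.single m c))"
  shows "divdiff_exps i m m'"
proof -
  define N where "N r s = Poly_Mapping.update i r (Poly_Mapping.update (i + 1) s m)" for r s
  have lookup_N: "lk (N r s) j = (if j = i then r else if j = i + 1 then s else lk m j)" for r s j
    by (simp add: N_def lookup_update)
  let ?a = "lk m i" and ?b = "lk m (i + 1)"
  \<comment> \<open>The quotient is the geometric sum with exponents b + k at i and a - 1 - k at i +
    1 for k < a - b; \<open>N r s\<close> is m with these two exponents overwritten.\<close>
  define g where "g = (\<Sum>k<?a - ?b. Poly_Mapping.single (N (?b + k) (?a - 1 - k)) c)"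
  have e: "Poly_Mapping.single i 1 + N r s = N (r + 1) s" "Poly_Mapping.single (i + 1) 1 + N r s = N r (s + 1)" for r s
    by (rule poly_mapping_eqI, simp add: lookup_add lookup_N lookup_single when_def)+
  have "(X i - X (i + 1)) * g = (\<Sum>k<?a - ?b.
      Poly_Mapping.single (N (?b + Suc k) (?a - Suc k)) c - Poly_Mapping.single (N (?b + k) (?a - k)) c)"
    unfolding g_def sum_distrib_left
  proof (rule sum.cong[OF refl])
    fix k assume "k \<in> {..<?a - ?b}"
    then have "?a - k = (?a - 1 - k) + 1" by auto
    then show "(X i - X (i + 1)) * Poly_Mapping.single (N (?b + k) (?a - 1 - k)) c
      = Poly_Mapping.single (N (?b + Suc k) (?a - Suc k)) c - Poly_Mapping.single (N (?b + k) (?a - k)) c"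
      unfolding X_def left_diff_distrib mult_single e by simp
  qed
  also have "\<dots> = Poly_Mapping.single (N ?a ?b) c - Poly_Mapping.single (N ?b ?a) c"
    by (subst sum_lessThan_telescope) (use gt in simp)
  also have "N ?a ?b = m"
    by (rule poly_mapping_eqI) (simp add: lookup_N)
  also have "N ?b ?a = Poly_Mapping.map_key (transpose i (i + 1)) m"
    by (rule poly_mapping_eqI) (simp add: lookup_N lookup_swap transpose_def)
  finally have "divdiff i (Poly_Mapping.single m c) = g"
    by (intro divdiff_unique) (simp only: sw_single)
  then have "m' \<in> Poly_Mapping.keys g" using m' by simp
  then obtain k where "k < ?a - ?b" "m' = N (?b + k) (?a - 1 - k)"
    unfolding g_def using keys_sum[of "\<lambda>k. Poly_Mapping.single (N (?b + k) (?a - 1 - k)) c" "{..<?a - ?b}"]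
    by (auto split: if_splits)
  then show ?thesis
    unfolding divdiff_exps_def by (auto simp: lookup_N)
qed

lemma divdiff_single_keys:
  assumes m': "m' \<in> Poly_Mapping.keys (divdiff i (Poly_Mapping.single m c))"
  shows "divdiff_exps i m m'"
proof (cases "lk m i" "lk m (i + 1)" rule: linorder_cases)
  case greater
  then show ?thesis using divdiff_single_keys_gt m' by blast
next
  case equal
  then have "Poly_Mapping.map_key (transpose i (i + 1)) m = m"
    by (intro poly_mapping_eqI) (auto simp: lookup_swap transpose_def)
  then have "divdiff i (Poly_Mapping.single m c) = 0"
    by (simp add: divdiff_eq_0_iff sw_single)
  then show ?thesis using m' by simp
next
  case less
  let ?m = "Poly_Mapping.map_key (transpose i (i + 1)) m"
  have "divdiff i (Poly_Mapping.single ?m c) = - divdiff i (Poly_Mapping.single m c)"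
    using divdiff_sw[of i "Poly_Mapping.single m c"] unfolding sw_single .
  then have "m' \<in> Poly_Mapping.keys (divdiff i (Poly_Mapping.single ?m c))"
    using m' by (simp add: in_keys_iff)
  then have "divdiff_exps i ?m m'"
    by (rule divdiff_single_keys_gt[rotated]) (use less in \<open>simp add: lookup_swap\<close>)
  then show ?thesis
    unfolding divdiff_exps_def lookup_swap by (simp add: transpose_def max.commute add.commute)
qed

lemma divdiff_keys:
  assumes "m' \<in> Poly_Mapping.keys (divdiff i f)"
  obtains m where "m \<in> Poly_Mapping.keys f" "divdiff_exps i m m'"
proof -
  have "divdiff i f = (\<Sum>m\<in>Poly_Mapping.keys f. divdiff i (Poly_Mapping.single m (lk f m)))"
    using arg_cong[OF poly_mapping_sum_single[of f], of "divdiff i"] unfolding divdiff_sum .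
  then show ?thesis
    using that keys_sum[of "\<lambda>m. divdiff i (Poly_Mapping.single m (lk f m))" "Poly_Mapping.keys f"]
      divdiff_single_keys assms by (metis (no_types, lifting) UN_E subsetD)
qed

text \<open>Both exponents drop below the larger of the two old ones. The truncated subtraction does
  no harm: if both bounds are 0, then the divided difference has no monomials.\<close>

lemma exps_le_divdiff:
  assumes "exps_le b f"
  shows "exps_le (\<lambda>l. if l = i \<or> l = i + 1 then max (b i) (b (i + 1)) - 1 else b l) (divdiff i f)"
  unfolding exps_le_def
proof (intro ballI allI)
  fix m' l assume "m' \<in> Poly_Mapping.keys (divdiff i f)"
  then obtain m where m: "m \<in> Poly_Mapping.keys f" "divdiff_exps i m m'" by (rule divdiff_keys)
  have le: "lk m j \<le> b j" for j using assms m(1) by (auto simp: exps_le_def)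
  show "lk m' l \<le> (if l = i \<or> l = i + 1 then max (b i) (b (i + 1)) - 1 else b l)"
    using m(2) le[of i] le[of "i + 1"] le[of l] by (auto simp: divdiff_exps_def)
qed

section \<open>Degree bounds for Schubert polynomials in each variable\<close>

definition stair_exps :: "nat \<Rightarrow> nat \<Rightarrow> nat" where
  "stair_exps n i = (if i = 0 then 0 else n - i)"

lemma exps_le_staircase: "exps_le (stair_exps n) (staircase n)"
proof -
  let ?T = "{(i :: nat, j :: nat). 1 \<le> i \<and> 1 \<le> j \<and> i + j \<le> n}"
  have "exps_le (\<lambda>l. \<Sum>x\<in>?T. if l = fst x then 1 else 0) (staircase n)"
    unfolding staircase_def
  proof (rule exps_le_prod)
    fix x :: "nat \<times> nat"
    have "exps_le (\<lambda>l. if l = fst x then 1 else 0) (X (fst x))"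
      by (auto simp: exps_le_def X_def lookup_single when_def)
    then show "exps_le (\<lambda>l. if l = fst x then 1 else 0) (case x of (i, j) \<Rightarrow> X i - Y j)"
      by (auto simp: Y_eq split_def intro: exps_le_diff exps_le_scalar)
  qed
  moreover have "(\<Sum>x\<in>?T. if l = fst x then 1 else 0) = stair_exps n l" for l
  proof -
    have "(\<Sum>x\<in>?T. if l = fst x then 1 else 0) = card {x \<in> ?T. l = fst x}"
      using finite_staircase[of n] by (simp add: sum.If_cases Int_def)
    also have "{x \<in> ?T. l = fst x} = (if l = 0 then {} else Pair l ` {1..n - l})"
      by auto
    also have "card \<dots> = stair_exps n l"
      by (simp add: stair_exps_def card_image inj_on_def)
    finally show ?thesis .
  qed
  ultimately show ?thesis by simp
qed

text \<open>Right ends of inversions beyond l. The left end k is arbitrary: counting only inversions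
  that start at l gives the Lehmer code, which does not bound the degree in x_l. For instance, the
  polynomial of 132 contains x_1, although its code is 0 at position 1.\<close>

definition inv_targets :: "(nat \<Rightarrow> nat) \<Rightarrow> nat \<Rightarrow> nat set" where
  "inv_targets w l = {j. l < j \<and> (\<exists>k<j. w j < w k)}"

text \<open>The value 0 at index 0 reflects that variables are numbered from 1, as in
  \<open>stair_exps\<close>.\<close>

definition schubert_exps :: "(nat \<Rightarrow> nat) \<Rightarrow> nat \<Rightarrow> nat" where
  "schubert_exps w l = (if l = 0 then 0 else card (inv_targets w l))"

lemma inv_targets_subset:
  assumes "w \<in> Sym n"
  shows "inv_targets w l \<subseteq> {l + 1..n}"
  using inversions_subset[OF assms] by (fastforce simp: inv_targets_def inversions_def)

lemma schubert_exps_le_stair: "w \<in> Sym n \<Longrightarrow> schubert_exps w l \<le> stair_exps n l"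
  using card_mono[OF _ inv_targets_subset[of w n l]] by (simp add: schubert_exps_def stair_exps_def)

text \<open>The bound would fail along an arbitrary chain of divided differences; at the first ascent
  \<open>i > 1\<close>, the position \<open>i\<close> is itself the target of an inversion, so that nothing is lost on
  the rows above \<open>i\<close>.\<close>

lemma exps_le_schubert: "w \<in> Sym n \<Longrightarrow> exps_le (schubert_exps w) (schubert w)"
proof (induction "n * n - perm_length w" arbitrary: w rule: less_induct)
  case less
  note w = less.prems
  show ?case
  proof (cases "w = w0 n")
    case True
    have "stair_exps n l \<le> schubert_exps (w0 n) l" for l
    proof (cases "l = 0")
      case False
      have "{l + 1..n} \<subseteq> inv_targets (w0 n) l"
      proof
        fix j assume j: "j \<in> {l + 1..n}"
        then have "l < j" "w0 n j < w0 n l" using False by (auto simp: w0_def)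
        then show "j \<in> inv_targets (w0 n) l" unfolding inv_targets_def by blast
      qed
      then show ?thesis
        using card_mono[OF finite_subset[OF inv_targets_subset[OF w0_Sym[of n], of l]], of "{l + 1..n}"] False
        by (simp add: schubert_exps_def stair_exps_def)
    qed (simp add: stair_exps_def)
    then show ?thesis
      using exps_le_mono[OF exps_le_staircase] True by (simp add: schubert_w0)
  next
    case False
    obtain i where i: "1 \<le> i" "i < n" "w i < w (i + 1)" and first: "\<And>k. 1 \<le> k \<Longrightarrow> k < i \<Longrightarrow> w (k + 1) < w k"
      using first_ascent[OF w False] by blast
    let ?s = "transpose i (i + 1)"
    define u where "u = w \<circ> ?s"
    have u: "u \<in> Sym n" unfolding u_def using Sym_step w i by blast
    have "perm_length u = perm_length w + 1"
      unfolding u_def by (rule perm_length_ascent[OF w i(3)])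
    then have IH: "exps_le (schubert_exps u) (schubert u)"
      using less.hyps[OF _ u] perm_length_le[OF u] by linarith
    have Sw: "schubert w = divdiff i (schubert u)"
      using divdiff_schubert_descent[OF Sym_imp_Sym_inf[OF u] i(1)] i(3) by (simp add: u_def)
    let ?P = "\<lambda>w j. \<exists>k<j. w j < w k"
    have P_other: "?P u j \<longleftrightarrow> ?P w j" if "j \<noteq> i" "j \<noteq> i + 1" for j
    proof -
      have s: "?s k < j \<longleftrightarrow> k < j" for k using that by (auto simp: transpose_def)
      have uj: "u j = w j" using that by (simp add: u_def)
      have "(\<exists>k<j. w j < w (?s k)) \<longleftrightarrow> (\<exists>k<j. w j < w k)"
      proof
        assume "\<exists>k<j. w j < w k"
        then obtain k where "k < j" "w j < w k" by blast
        then show "\<exists>k<j. w j < w (?s k)"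
          by (intro exI[of _ "?s k"]) (simp add: s[simplified])
      next
        assume "\<exists>k<j. w j < w (?s k)"
        then show "\<exists>k<j. w j < w k" using s by blast
      qed
      then show ?thesis unfolding uj by (simp add: u_def)
    qed
    have uv: "u i = w (i + 1)" "u (i + 1) = w i" "\<And>k. k < i \<Longrightarrow> u k = w k" by (auto simp: u_def)
    have Pw1: "?P w (i + 1) \<longleftrightarrow> ?P u i"
    proof -
      have "(\<exists>k<i + 1. w (i + 1) < w k) \<longleftrightarrow> (\<exists>k<i. w (i + 1) < w k)"
        using i(3) by (auto simp: less_Suc_eq)
      then show ?thesis using uv by auto
    qed
    have fin: "finite (inv_targets w l)" "finite (inv_targets u l)" for l
      by (rule finite_subset[OF inv_targets_subset[OF w]], simp)
        (rule finite_subset[OF inv_targets_subset[OF u]], simp)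
    have T_eq: "inv_targets u l = inv_targets w l" if "i < l" for l
    proof -
      have "?P u j \<longleftrightarrow> ?P w j" if "l < j" for j
        by (rule P_other) (use that \<open>i < l\<close> in auto)
      then show ?thesis unfolding inv_targets_def by (intro Collect_cong conj_cong refl)
    qed
    have T_succ: "inv_targets u i \<subseteq> insert (i + 1) (inv_targets u (i + 1))"
      by (auto simp: inv_targets_def)
    have T_mono: "inv_targets w (i + 1) \<subseteq> inv_targets w i"
      by (auto simp: inv_targets_def)
    \<comment> \<open>Beyond i + 1, u and w have the same targets; starting from i instead adds at
      most the position i + 1 for u, and the loss of one degree under \<open>divdiff i\<close>
      compensates for it.\<close>
    have max_le: "max (schubert_exps u i) (schubert_exps u (i + 1)) - 1 \<le> card (inv_targets w (i + 1))"
    proof -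
      have "card (inv_targets u i) \<le> card (inv_targets w (i + 1)) + 1"
      proof -
        have "card (inv_targets u i) \<le> card (insert (i + 1) (inv_targets u (i + 1)))"
          by (rule card_mono[OF _ T_succ]) (simp add: fin)
        also have "\<dots> \<le> card (inv_targets u (i + 1)) + 1"
          by (simp add: card_insert_if fin)
        finally show ?thesis using T_eq[of "i + 1"] by simp
      qed
      then show ?thesis using T_eq[of "i + 1"] i(1) by (simp add: schubert_exps_def)
    qed
    have low: "card (inv_targets u l) \<le> card (inv_targets w l)" if l: "1 \<le> l" "l < i" for l
    proof -
      have Pi: "?P w i"
      proof -
        obtain k where "i = k + 1" "1 \<le> k" using l by (cases i) auto
        then show ?thesis using first[of k] by auto
      qed
      \<comment> \<open>The target i of u corresponds to the target i + 1 of w, and a target i + 1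
        of u is sent to i, which is a target of w by \<open>Pi\<close>.\<close>
      have "?s ` inv_targets u l \<subseteq> inv_targets w l"
      proof
        fix x assume "x \<in> ?s ` inv_targets u l"
        then obtain j where j: "x = ?s j" "l < j" "?P u j" by (auto simp: inv_targets_def)
        have "l < x" using j l by (auto simp: transpose_def)
        moreover have "?P w x"
        proof -
          consider "j = i" | "j = i + 1" | "j \<noteq> i" "j \<noteq> i + 1" by blast
          then show ?thesis
          proof cases
            case 1
            then show ?thesis using j Pw1 by simp
          next
            case 2
            then show ?thesis using j Pi by simp
          next
            case 3
            then show ?thesis using j P_other by simp
          qed
        qed
        ultimately show "x \<in> inv_targets w l" by (auto simp: inv_targets_def)
      qed
      then have "card (?s ` inv_targets u l) \<le> card (inv_targets w l)"
        using fin by (intro card_mono)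
      then show ?thesis by (simp add: card_image)
    qed
    show ?thesis
      unfolding Sw
    proof (rule exps_le_mono[OF exps_le_divdiff[OF IH]])
      fix l
      consider "l = 0" | "1 \<le> l" "l < i" | "l = i" | "l = i + 1" | "i + 1 < l" by linarith
      then show "(if l = i \<or> l = i + 1 then max (schubert_exps u i) (schubert_exps u (i + 1)) - 1
          else schubert_exps u l) \<le> schubert_exps w l"
      proof cases
        case 2
        then show ?thesis using low by (simp add: schubert_exps_def)
      next
        case 3
        then show ?thesis
          using max_le card_mono[OF fin(1) T_mono] i(1) by (simp add: schubert_exps_def[of w])
      next
        case 4
        then show ?thesis using max_le by (simp add: schubert_exps_def[of w])
      next
        case 5
        then show ?thesis using T_eq[of l] by (simp add: schubert_exps_def)
      qed (use i(1) in \<open>simp add: schubert_exps_def\<close>)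
    qed
  qed
qed

section \<open>Existence of Schubert expansions\<close>

lemma is_schubert_expansion_0: "is_schubert_expansion A 0 (\<lambda>_. 0)"
  by (simp add: is_schubert_expansion_def)

lemma is_schubert_expansion_support: "is_schubert_expansion A f c \<Longrightarrow> w \<notin> A \<Longrightarrow> c w = 0"
  unfolding is_schubert_expansion_def by blast

lemma Sym_subset: "Sym n \<subseteq> Sym_inf"
  by (auto simp: Sym_inf_def)

lemma is_schubert_expansion_Sym_iff:
  "is_schubert_expansion (Sym n) f c
    \<longleftrightarrow> f = (\<Sum>w\<in>Sym n. scalar (c w) * schubert w) \<and> (\<forall>w. w \<notin> Sym n \<longrightarrow> c w = 0)"
proof
  assume c: "is_schubert_expansion (Sym n) f c"
  have "{w. c w \<noteq> 0} \<subseteq> Sym n" using is_schubert_expansion_support[OF c] by blast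
  then show "f = (\<Sum>w\<in>Sym n. scalar (c w) * schubert w) \<and> (\<forall>w. w \<notin> Sym n \<longrightarrow> c w = 0)"
    using is_schubert_expansion_sum[OF c finite_Sym] is_schubert_expansion_support[OF c] by blast
qed (use is_schubert_expansionI[OF finite_Sym order_refl] in blast)

lemma is_schubert_expansion_divdiff:
  assumes c: "is_schubert_expansion (Sym n) f c" and i: "1 \<le> i" "i < n"
  shows "is_schubert_expansion (Sym n) (divdiff i f)
    (\<lambda>w. if w i < w (i + 1) then c (w \<circ> transpose i (i + 1)) else 0)"
  unfolding is_schubert_expansion_Sym_iff
proof
  let ?s = "transpose i (i + 1)"
  have d: "divdiff i (schubert u) = (if u (i + 1) < u i then schubert (u \<circ> ?s) else 0)" if "u \<in> Sym n" for u
    by (rule divdiff_schubert[OF Sym_imp_Sym_inf[OF that] i(1)])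
  have "divdiff i f = (\<Sum>u\<in>Sym n. scalar (c u) * divdiff i (schubert u))"
    using c unfolding is_schubert_expansion_Sym_iff by (simp add: divdiff_sum divdiff_scalar_mult)
  also have "\<dots> = (\<Sum>w\<in>Sym n. scalar (if w i < w (i + 1) then c (w \<circ> ?s) else 0) * schubert w)"
    by (rule sum.reindex_bij_witness[of _ "\<lambda>w. w \<circ> ?s" "\<lambda>w. w \<circ> ?s"])
      (use Sym_step[OF _ i] in \<open>auto simp: d scalar.zero\<close>)
  finally show "divdiff i f = \<dots>" .
  show "\<forall>w. w \<notin> Sym n \<longrightarrow> (if w i < w (i + 1) then c (w \<circ> ?s) else 0) = 0"
    using is_schubert_expansion_support[OF c] Sym_step_iff[OF i] by auto
qed

text \<open>Compatibility of the expansions of \<open>\<partial>\<^sub>i f\<close> and \<open>\<partial>\<^sub>j f\<close>, before \<open>f\<close> is known to have one.\<close>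

lemma divdiff_coeff_compat:
  assumes a: "is_schubert_expansion (Sym n) (divdiff i f) a" and b: "is_schubert_expansion (Sym n) (divdiff j f) b"
    and i: "1 \<le> i" "w (i + 1) < w i" and j: "i < j" "j < n" "w (j + 1) < w j"
  shows "a (w \<circ> transpose i (i + 1)) = b (w \<circ> transpose j (j + 1))"
proof (cases "j = i + 1")
  case False
  then have ij: "i + 1 < j" using j by simp
  let ?s = "transpose i (i + 1)" and ?t = "transpose j (j + 1)"
  have j1: "1 \<le> j" and in': "i < n" using i j by auto
  have comm: "w \<circ> ?s \<circ> ?t = w \<circ> ?t \<circ> ?s"
    using ij by (auto simp: fun_eq_iff transpose_def)
  have l: "(w \<circ> ?s \<circ> ?t) j < (w \<circ> ?s \<circ> ?t) (j + 1)" "(w \<circ> ?s \<circ> ?t) i < (w \<circ> ?s \<circ> ?t) (i + 1)"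
    using i j ij by (auto simp: transpose_def)
  have "(\<lambda>w. if w j < w (j + 1) then a (w \<circ> ?t) else 0) = (\<lambda>w. if w i < w (i + 1) then b (w \<circ> ?s) else 0)"
    by (rule is_schubert_expansion_unique[OF Sym_subset
          is_schubert_expansion_divdiff[OF a j1 j(2)]])
       (use is_schubert_expansion_divdiff[OF b i(1) in'] divdiff_commute[OF ij] in simp)
  from fun_cong[OF this, of "w \<circ> ?s \<circ> ?t"] have "a (w \<circ> ?s \<circ> ?t \<circ> ?t) = b (w \<circ> ?s \<circ> ?t \<circ> ?s)"
    unfolding if_P[OF l(1)] if_P[OF l(2)] .
  then show ?thesis unfolding comm[symmetric] by (metis comm transpose_twice)
next
  case True
  let ?s = "transpose i (i + 1)" and ?t = "transpose (i + 1) (i + 1 + 1)"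
  have j1: "1 \<le> i + 1" "i + 1 < n" and in': "i < n" using i j True by auto
  have b: "is_schubert_expansion (Sym n) (divdiff (i + 1) f) b" using b True by simp
  let ?u = "w \<circ> ?s \<circ> ?t \<circ> ?s"
  have braid: "?u = w \<circ> ?t \<circ> ?s \<circ> ?t"
    by (auto simp: fun_eq_iff transpose_def)
  have wj: "w (i + 1 + 1) < w (i + 1)" using j True by simp
  have l: "?u i < ?u (i + 1)" "(?u \<circ> ?s) (i + 1) < (?u \<circ> ?s) (i + 1 + 1)"
    "?u (i + 1) < ?u (i + 1 + 1)" "(?u \<circ> ?t) i < (?u \<circ> ?t) (i + 1)"
    using i wj by (auto simp: transpose_def)
  have "(\<lambda>w. if w i < w (i + 1) then (if (w \<circ> ?s) (i + 1) < (w \<circ> ?s) (i + 1 + 1)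
          then a (w \<circ> ?s \<circ> ?t) else 0) else 0)
      = (\<lambda>w. if w (i + 1) < w (i + 1 + 1) then (if (w \<circ> ?t) i < (w \<circ> ?t) (i + 1)
          then b (w \<circ> ?t \<circ> ?s) else 0) else 0)"
    by (rule is_schubert_expansion_unique[OF Sym_subset
          is_schubert_expansion_divdiff[OF is_schubert_expansion_divdiff[OF a j1] i(1) in']])
       (use is_schubert_expansion_divdiff[OF is_schubert_expansion_divdiff[OF b i(1) in'] j1]
         divdiff_braid in simp)
  from fun_cong[OF this, of ?u] have "a (?u \<circ> ?s \<circ> ?t) = b (?u \<circ> ?t \<circ> ?s)"
    unfolding if_P[OF l(1)] if_P[OF l(2)] if_P[OF l(3)] if_P[OF l(4)] .
  moreover have "?u \<circ> ?s \<circ> ?t = w \<circ> ?s"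
    by (simp only: transpose_twice)
  moreover have "?u \<circ> ?t \<circ> ?s = w \<circ> ?t"
    unfolding braid by (simp only: transpose_twice)
  ultimately show ?thesis using True by simp
qed

definition tot_exp :: "nat \<Rightarrow> (nat \<Rightarrow>\<^sub>0 nat) \<Rightarrow> nat" where
  "tot_exp n m = (\<Sum>l\<le>n. lk m l)"

text \<open>This is the measure for the existence of expansions.\<close>

lemma tot_exp_divdiff:
  assumes "divdiff_exps i m m'" "i < n"
  shows "tot_exp n m' + 1 = tot_exp n m"
proof -
  have split: "tot_exp n k = lk k i + lk k (i + 1) + (\<Sum>l\<in>{..n} - {i, i + 1}. lk k l)" for k
  proof -
    have "tot_exp n k = (\<Sum>l\<in>{i, i + 1} \<union> ({..n} - {i, i + 1}). lk k l)"
      unfolding tot_exp_def by (rule sum.cong) (use assms(2) in auto)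
    also have "\<dots> = (\<Sum>l\<in>{i, i + 1}. lk k l) + (\<Sum>l\<in>{..n} - {i, i + 1}. lk k l)"
      by (rule sum.union_disjoint) auto
    finally show ?thesis by simp
  qed
  have "(\<Sum>l\<in>{..n} - {i, i + 1}. lk m' l) = (\<Sum>l\<in>{..n} - {i, i + 1}. lk m l)"
    by (rule sum.cong) (use assms(1) in \<open>auto simp: divdiff_exps_def\<close>)
  then show ?thesis
    using assms(1) unfolding split divdiff_exps_def by linarith
qed

text \<open>The bound at n is n - n = 0, so x_n does not occur; symmetry in x_k and x_{k+1} then
  removes x_{n-1}, ..., x_1 one after the other.\<close>

lemma divdiff_0_imp_scalar:
  assumes h: "exps_le (stair_exps n) h" and d: "\<And>i. 1 \<le> i \<Longrightarrow> i < n \<Longrightarrow> divdiff i h = 0"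
  shows "h = scalar (lk h 0)"
proof (rule poly_mapping_eqI)
  have zero: "\<forall>m\<in>Poly_Mapping.keys h. lk m k = 0" if "1 \<le> k" "k \<le> n" for k
    using that(2,1)
  proof (induction k rule: inc_induct)
    case base
    have z: "stair_exps n n = 0" by (simp add: stair_exps_def)
    show ?case
    proof
      fix m assume "m \<in> Poly_Mapping.keys h"
      then have "lk m n \<le> stair_exps n n" using h unfolding exps_le_def by blast
      then show "lk m n = 0" using z by simp
    qed
  next
    case (step k)
    show ?case
    proof
      fix m assume m: "m \<in> Poly_Mapping.keys h"
      let ?m = "Poly_Mapping.map_key (transpose k (k + 1)) m"
      have "lk (sw k h) m = lk h ?m"
        unfolding sw_def by (simp add: lookup_rename_vars)
      moreover have "sw k h = h"
        using d[of k] step by (simp add: divdiff_eq_0_iff)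
      ultimately have "?m \<in> Poly_Mapping.keys h"
        using m by (simp add: in_keys_iff)
      then have "lk ?m (Suc k) = 0" using step by simp
      then show "lk m k = 0" by (simp add: lookup_swap)
    qed
  qed
  fix m
  have "m = 0" if "m \<in> Poly_Mapping.keys h"
  proof (rule poly_mapping_eqI)
    fix k
    show "lk m k = lk 0 k"
    proof (cases "1 \<le> k \<and> k \<le> n")
      case False
      then have "stair_exps n k = 0" by (auto simp: stair_exps_def)
      then show ?thesis using h that unfolding exps_le_def by (metis le_zero_eq lookup_zero)
    qed (use zero that in simp)
  qed
  then show "lk h m = lk (scalar (lk h 0)) m"
    by (auto simp: scalar_def lookup_single when_def in_keys_iff)
qed

text \<open>Integration from the divided differences: by induction each \<open>divdiff i f\<close>
  has an expansion \<open>a i\<close>, which prescribes the coefficient of every w with a descent at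
  i as that of w s_i. The prescriptions agree for different descents, so they define a combination g
  with the same divided differences as f. Hence f - g is a scalar, which is absorbed into the
  coefficient of the identity because its Schubert polynomial is 1.\<close>

lemma exists_schubert_expansion_aux:
  assumes "exps_le (stair_exps n) f" "\<forall>m\<in>Poly_Mapping.keys f. tot_exp n m < d"
  shows "\<exists>c. is_schubert_expansion (Sym n) f c"
  using assms
proof (induction d arbitrary: f)
  case 0
  then have "Poly_Mapping.keys f = {}" by auto
  then have "f = 0" by simp
  then show ?case using is_schubert_expansion_0 by blast
next
  case (Suc d)
  have "\<exists>c. is_schubert_expansion (Sym n) (divdiff i f) c" if i: "1 \<le> i" "i < n" for i
  proof (rule Suc.IH)
    show "exps_le (stair_exps n) (divdiff i f)"
      by (rule exps_le_mono[OF exps_le_divdiff[OF Suc.prems(1)]]) (use i in \<open>auto simp: stair_exps_def\<close>)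
    show "\<forall>m\<in>Poly_Mapping.keys (divdiff i f). tot_exp n m < d"
    proof
      fix m' assume "m' \<in> Poly_Mapping.keys (divdiff i f)"
      then obtain m where "m \<in> Poly_Mapping.keys f" "divdiff_exps i m m'" by (rule divdiff_keys)
      then show "tot_exp n m' < d"
        using Suc.prems(2) tot_exp_divdiff[OF _ i(2)] by fastforce
    qed
  qed
  then obtain a where a: "\<And>i. 1 \<le> i \<Longrightarrow> i < n \<Longrightarrow> is_schubert_expansion (Sym n) (divdiff i f) (a i)"
    by metis
  define D where "D w i \<longleftrightarrow> 1 \<le> i \<and> i < n \<and> w (i + 1) < w i" for w :: "nat \<Rightarrow> nat" and i
  have compat: "a i (w \<circ> transpose i (i + 1)) = a j (w \<circ> transpose j (j + 1))" if "D w i" "D w j" for w i j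
  proof -
    consider "i = j" | "i < j" | "j < i" by linarith
    then show ?thesis
    proof cases
      case 2
      then show ?thesis
        using divdiff_coeff_compat[OF a a, of i j w] that by (auto simp: D_def)
    next
      case 3
      then show ?thesis
        using divdiff_coeff_compat[OF a a, of j i w] that by (auto simp: D_def)
    qed simp
  qed
  define c where "c w = (if w \<in> Sym n \<and> w \<noteq> id
    then let i = (SOME i. D w i) in a i (w \<circ> transpose i (i + 1)) else 0)" for w
  have c: "c w = a i (w \<circ> transpose i (i + 1))" if "w \<in> Sym n" "D w i" for w i
  proof -
    have "w \<noteq> id" using that by (auto simp: D_def)
    moreover have "D w (SOME i. D w i)" using that(2) by (rule someI)
    ultimately show ?thesis
      using compat[OF that(2)] that(1) unfolding c_def Let_def by simp
  qed
  define g where "g = (\<Sum>w\<in>Sym n. scalar (c w) * schubert w)"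
  have g: "is_schubert_expansion (Sym n) g c"
    unfolding is_schubert_expansion_Sym_iff g_def by (auto simp: c_def)
  have eq: "divdiff i g = divdiff i f" if i: "1 \<le> i" "i < n" for i
  proof -
    let ?s = "transpose i (i + 1)"
    have "(if w i < w (i + 1) then c (w \<circ> ?s) else 0) = a i w" for w
    proof (cases "w \<in> Sym n")
      case False
      then have "w \<circ> ?s \<notin> Sym n" using Sym_step_iff[OF i] by blast
      then show ?thesis
        using is_schubert_expansion_support[OF g] is_schubert_expansion_support[OF a[OF i]] False by simp
    next
      case True
      show ?thesis
      proof (cases "w i < w (i + 1)")
        case asc: True
        then have "D (w \<circ> ?s) i" using i by (simp add: D_def)
        then have "c (w \<circ> ?s) = a i (w \<circ> ?s \<circ> ?s)"
          by (rule c[OF Sym_step[OF True i]])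
        then show ?thesis using asc by simp
      next
        case False
        then have "w (i + 1) < w i" using Sym_neq[OF True, of i] by (metis nat_neq_iff)
        then have l: "(w \<circ> ?s) i < (w \<circ> ?s) (i + 1)" by simp
        \<comment> \<open>Applying \<open>divdiff i\<close> once more to \<open>divdiff i f\<close>
          gives 0, so by uniqueness \<open>a i\<close> vanishes at every permutation with a descent
          at i.\<close>
        have "(\<lambda>w. if w i < w (i + 1) then a i (w \<circ> ?s) else 0) = (\<lambda>_. 0)"
          by (rule is_schubert_expansion_unique[OF Sym_subset is_schubert_expansion_divdiff[OF a[OF i] i]])
            (use is_schubert_expansion_0 in simp)
        from fun_cong[OF this, of "w \<circ> ?s"] have "a i (w \<circ> ?s \<circ> ?s) = 0"
          unfolding if_P[OF l] .
        then show ?thesis using False by simp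
      qed
    qed
    then have "is_schubert_expansion (Sym n) (divdiff i g) (a i)"
      using is_schubert_expansion_divdiff[OF g i] by simp
    then show ?thesis
      using a[OF i] unfolding is_schubert_expansion_Sym_iff by simp
  qed
  have "exps_le (stair_exps n) (scalar (c w) * schubert w)" if "w \<in> Sym n" for w
    by (rule exps_le_scalar_mult[OF exps_le_mono[OF exps_le_schubert[OF that] schubert_exps_le_stair[OF that]]])
  then have "exps_le (stair_exps n) (f - g)"
    unfolding g_def by (intro exps_le_diff Suc.prems(1) exps_le_sum)
  moreover have "divdiff i (f - g) = 0" if "1 \<le> i" "i < n" for i
    by (simp only: divdiff_diff eq[OF that] diff_self)
  ultimately have "f - g = scalar (lk (f - g) 0)"
    by (rule divdiff_0_imp_scalar)
  then obtain e where e: "f = g + scalar e"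
    by (metis add.commute diff_add_cancel)
  have "f = (\<Sum>w\<in>Sym n. scalar (c w + (if w = id then e else 0)) * schubert w)"
    using Sym_id[of n] finite_Sym[of n]
    by (simp add: e g_def scalar.add distrib_right sum.distrib if_distrib[of scalar]
        if_distrib[of "\<lambda>x. x * _"] scalar.zero schubert_id cong: if_cong)
  then have exp: "is_schubert_expansion (Sym n) f (\<lambda>w. c w + (if w = id then e else 0))"
    unfolding is_schubert_expansion_Sym_iff using Sym_id[of n] by (auto simp: c_def)
  show ?case by (rule exI) (rule exp)
qed

lemma exists_schubert_expansion:
  assumes "exps_le (stair_exps n) f"
  shows "\<exists>c. is_schubert_expansion (Sym n) f c"
proof (rule exists_schubert_expansion_aux[OF assms])
  show "\<forall>m\<in>Poly_Mapping.keys f. tot_exp n m < Suc (\<Sum>m\<in>Poly_Mapping.keys f. tot_exp n m)"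
    by (auto simp: less_Suc_eq_le intro: member_le_sum)
qed

lemma exists_product_expansion:
  assumes "u \<in> Sym n" "v \<in> Sym n"
  shows "\<exists>c. is_schubert_expansion Sym_inf (schubert u * schubert v) c"
proof -
  have st: "exps_le (stair_exps n) (schubert w)" if "w \<in> Sym n" for w
    by (rule exps_le_mono[OF exps_le_schubert[OF that] schubert_exps_le_stair[OF that]])
  \<comment> \<open>The degrees in x_l add up to at most 2(n - l), which is at most 2n - l; a
    symmetric group of twice the size is therefore large enough.\<close>
  have "exps_le (stair_exps (2 * n)) (schubert u * schubert v)"
    by (rule exps_le_mono[OF exps_le_mult[OF st st]]) (use assms in \<open>auto simp: stair_exps_def\<close>)
  then obtain c where "is_schubert_expansion (Sym (2 * n)) (schubert u * schubert v) c"
    using exists_schubert_expansion by blast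
  then show ?thesis
    using Sym_subset unfolding is_schubert_expansion_def by blast
qed

section \<open>Node labels\<close>

context
  fixes n k :: nat and L :: "nat set"
  assumes L: "L \<subseteq> {1..n}" "card L = k"
begin

lemma finite_L: "finite L"
  using L(1) by (rule finite_subset) simp

lemma node_label_in:
  assumes "i \<in> L"
  shows "node_label n k L i = card {j \<in> L. j \<le> i}" "1 \<le> node_label n k L i" "node_label n k L i \<le> k"
proof -
  show eq: "node_label n k L i = card {j \<in> L. j \<le> i}"
    using assms L(1) by (auto simp: node_label_def)
  have "0 < card {j \<in> L. j \<le> i}" unfolding card_gt_0_iff using assms finite_L by auto
  then show "1 \<le> node_label n k L i" using eq by linarith
  show "node_label n k L i \<le> k"
    unfolding eq using L(2) finite_L by (metis (no_types, lifting) card_mono mem_Collect_eq subsetI)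
qed

lemma node_label_out:
  assumes "i \<in> {1..n}" "i \<notin> L"
  shows "node_label n k L i = k + card {j \<in> {1..i}. j \<notin> L}" "k < node_label n k L i" "node_label n k L i \<le> n"
proof -
  show eq: "node_label n k L i = k + card {j \<in> {1..i}. j \<notin> L}"
    using assms by (auto simp: node_label_def)
  have "0 < card {j \<in> {1..i}. j \<notin> L}" unfolding card_gt_0_iff using assms by auto
  then show "k < node_label n k L i" using eq by linarith
  have "card {j \<in> {1..i}. j \<notin> L} \<le> card ({1..n} - L)"
    by (rule card_mono) (use assms in auto)
  also have "\<dots> = n - k" using L finite_L by (simp add: card_Diff_subset)
  finally show "node_label n k L i \<le> n"
    using eq card_mono[of "{1..n}" L] L by simp
qed

lemma node_label_mono_in:
  assumes "i \<in> L" "j \<in> L" "i < j" shows "node_label n k L i < node_label n k L j"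
proof -
  have "j \<notin> {x \<in> L. x \<le> i}" "j \<in> {x \<in> L. x \<le> j}" using assms by auto
  then have "{x \<in> L. x \<le> i} \<subset> {x \<in> L. x \<le> j}" using assms by fastforce
  then show ?thesis
    unfolding node_label_in(1)[OF assms(1)] node_label_in(1)[OF assms(2)]
    by (intro psubset_card_mono) (use finite_L in auto)
qed

lemma node_label_mono_out:
  assumes "i \<in> {1..n}" "i \<notin> L" "j \<in> {1..n}" "j \<notin> L" "i < j"
  shows "node_label n k L i < node_label n k L j"
proof -
  have "j \<notin> {x \<in> {1..i}. x \<notin> L}" "j \<in> {x \<in> {1..j}. x \<notin> L}" using assms by auto
  then have "{x \<in> {1..i}. x \<notin> L} \<subset> {x \<in> {1..j}. x \<notin> L}" using assms by fastforce
  then show ?thesis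
    unfolding node_label_out(1)[OF assms(1,2)] node_label_out(1)[OF assms(3,4)]
    by (intro add_strict_left_mono psubset_card_mono) auto
qed

text \<open>Labels outside L exceed k and increase from left to right, while those in L are at most
  k. This forces the right end of every inversion of the labelling into L, on which the degree bound
  rests.\<close>

lemma node_label_less_out:
  assumes "i < j" "j \<in> {1..n}" "j \<notin> L"
  shows "node_label n k L i < node_label n k L j"
proof -
  consider "i = 0" | "i \<in> L" | "i \<in> {1..n}" "i \<notin> L" using assms by fastforce
  then show ?thesis
  proof cases
    case 1
    then show ?thesis using node_label_out(2)[OF assms(2,3)] by (simp add: node_label_def)
  next
    case 2
    then show ?thesis using node_label_in(3)[OF 2] node_label_out(2)[OF assms(2,3)] by linarith
  next
    case 3
    then show ?thesis using node_label_mono_out assms by blast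
  qed
qed

lemma node_label_ascent:
  assumes "i \<in> L" "i < n"
  shows "node_label n k L i < node_label n k L (i + 1)"
  using node_label_mono_in[OF assms(1), of "i + 1"] node_label_less_out[of i "i + 1"] assms
  by (cases "i + 1 \<in> L") auto

lemma node_label_Sym: "node_label n k L \<in> Sym n"
  unfolding Sym_def mem_Collect_eq
proof (rule bij_imp_permutes)
  have inj: "inj_on (node_label n k L) {1..n}"
  proof (rule linorder_inj_onI)
    fix i j assume ij: "i < j" "i \<in> {1..n}" "j \<in> {1..n}"
    show "node_label n k L i \<noteq> node_label n k L j"
    proof (cases "j \<in> L")
      case True
      then show ?thesis
        using node_label_mono_in[OF _ True ij(1)] node_label_in(3)[OF True] node_label_out(2)[OF ij(2)]
        by (cases "i \<in> L") auto
    qed (use node_label_less_out[OF ij(1,3)] in simp)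
  qed auto
  have sub: "node_label n k L i \<in> {1..n}" if "i \<in> {1..n}" for i
  proof (cases "i \<in> L")
    case True
    have "k \<le> n" using L card_mono[of "{1..n}" L] by simp
    then show ?thesis using node_label_in(2,3)[OF True] by simp
  next
    case False
    then show ?thesis using node_label_out(2,3)[OF that False] by simp
  qed
  then show "bij_betw (node_label n k L) {1..n} {1..n}"
    unfolding bij_betw_def using inj endo_inj_surj[OF _ _ inj] by blast
qed (simp add: node_label_def)

lemma schubert_exps_node_label: "schubert_exps (node_label n k L) l \<le> card {j \<in> L. l < j}"
proof -
  have "inv_targets (node_label n k L) l \<subseteq> {j \<in> L. l < j}"
  proof
    fix j assume j: "j \<in> inv_targets (node_label n k L) l"
    then have jn: "j \<in> {1..n}" using inv_targets_subset[OF node_label_Sym, of l] by fastforce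
    obtain i where i: "i < j" "node_label n k L j < node_label n k L i" and lj: "l < j"
      using j by (auto simp: inv_targets_def)
    have "j \<in> L" using node_label_less_out[OF i(1) jn] i(2) by (meson less_asym)
    then show "j \<in> {j \<in> L. l < j}" using lj by simp
  qed
  then show ?thesis
    using card_mono[of "{j \<in> L. l < j}"] finite_L by (simp add: schubert_exps_def)
qed

text \<open>A node of L trades places with a neighbour outside L, so the left-to-right order within
  L and within its complement is unchanged and each label travels with its node.\<close>

lemma node_label_swap:
  assumes i: "1 \<le> i" "i < n" "i \<in> L" "i + 1 \<notin> L"
  shows "node_label n k (transpose i (i + 1) ` L) = node_label n k L \<circ> transpose i (i + 1)"
proof
  fix j
  let ?s = "transpose i (i + 1)"
  have mem: "x \<in> ?s ` L \<longleftrightarrow> ?s x \<in> L" for x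
    by (metis (no_types, lifting) imageE image_eqI transpose_involutory)
  have sj: "?s j \<in> {1..n} \<longleftrightarrow> j \<in> {1..n}" using i by (auto simp: transpose_def)
  have 1: "card {x \<in> ?s ` L. x \<le> j} = card {x \<in> L. x \<le> ?s j}" if "?s j \<in> L"
  proof -
    have "x \<in> L \<Longrightarrow> ?s x \<le> j \<longleftrightarrow> x \<le> ?s j" for x
      using i that by (cases "x = i + 1"; cases "j = i"; auto simp: transpose_def split: if_splits)
    then have "{x \<in> ?s ` L. x \<le> j} = ?s ` {x \<in> L. x \<le> ?s j}"
      unfolding image_def by auto
    then show ?thesis by (simp add: card_image)
  qed
  have 2: "card {x \<in> {1..j}. ?s x \<notin> L} = card {x \<in> {1..?s j}. x \<notin> L}" if "?s j \<notin> L"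
  proof (rule bij_betw_same_card[of ?s], rule bij_betw_byWitness[where f' = ?s])
    have le: "?s x \<notin> L \<Longrightarrow> x \<le> j \<longleftrightarrow> ?s x \<le> ?s j" for x
      using i that by (cases "x = i"; cases "x = i + 1"; cases "j = i + 1"; cases "j = i";
          auto simp: transpose_def split: if_splits)
    have ge: "1 \<le> ?s x \<longleftrightarrow> 1 \<le> x" for x using i by (auto simp: transpose_def)
    show "?s ` {x \<in> {1..j}. ?s x \<notin> L} \<subseteq> {x \<in> {1..?s j}. x \<notin> L}"
    proof
      fix y assume "y \<in> ?s ` {x \<in> {1..j}. ?s x \<notin> L}"
      then obtain x where "y = ?s x" "1 \<le> x" "x \<le> j" "?s x \<notin> L" by auto
      then show "y \<in> {x \<in> {1..?s j}. x \<notin> L}" using le[of x] ge[of x] by simp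
    qed
    show "?s ` {x \<in> {1..?s j}. x \<notin> L} \<subseteq> {x \<in> {1..j}. ?s x \<notin> L}"
    proof
      fix y assume "y \<in> ?s ` {x \<in> {1..?s j}. x \<notin> L}"
      then obtain x where "y = ?s x" "1 \<le> x" "x \<le> ?s j" "x \<notin> L" by auto
      then show "y \<in> {x \<in> {1..j}. ?s x \<notin> L}" using le[of y] ge[of y] by simp
    qed
  qed simp_all
  show "node_label n k (?s ` L) j = (node_label n k L \<circ> ?s) j"
  proof (cases "j \<in> {1..n}")
    case True
    then show ?thesis using sj 1 2 unfolding node_label_def comp_def mem by simp
  next
    case False
    then have "?s j = j" using i by (auto simp: transpose_def)
    then show ?thesis using False by (simp add: node_label_def)
  qed
qed

end

lemma exps_le_rename_y:
  assumes "bij \<sigma>" "exps_le b f" shows "exps_le b (rename_y \<sigma> f)"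
proof -
  have "Poly_Mapping.keys (rename_y \<sigma> f) \<subseteq> Poly_Mapping.keys f"
    by (auto simp: in_keys_iff lookup_rename_y[OF assms(1)] rhom.zero[OF rhom_rename_vars[OF assms(1)]])
  then show ?thesis using assms(2) unfolding exps_le_def by (meson subsetD)
qed

text \<open>The factor indexed by v is symmetric in x_i and x_{i+1} because v ascends at i, so it
  passes through \<open>divdiff i\<close>. The two forms differ in which factor carries the reversed
  y.\<close>

lemma divdiff_rev_schubert_mult:
  assumes u: "u \<in> Sym n" "u i < u (i + 1)" and v: "v \<in> Sym n" "v i < v (i + 1)" and i: "1 \<le> i" "i < n"
  shows "divdiff i (rev_schubert n (u \<circ> transpose i (i + 1)) * schubert v) = rev_schubert n u * schubert v"
    and "divdiff i (rev_schubert n v * schubert (u \<circ> transpose i (i + 1))) = rev_schubert n v * schubert u"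
proof -
  have us: "u \<circ> transpose i (i + 1) \<in> Sym_inf" using Sym_imp_Sym_inf Sym_step[OF u(1) i] by blast
  have "sw i (schubert v) = schubert v"
    using divdiff_schubert_ascent[OF Sym_imp_Sym_inf[OF v(1)] i(1) v(2)] by (simp add: divdiff_eq_0_iff)
  then show "divdiff i (rev_schubert n (u \<circ> transpose i (i + 1)) * schubert v) = rev_schubert n u * schubert v"
    using divdiff_mult_sym[of i "schubert v" "rev_schubert n (u \<circ> transpose i (i + 1))"]
      divdiff_rev_schubert[OF us i(1), of n] u(2)
    by (simp add: mult.commute)
  have "sw i (rev_schubert n v) = rev_schubert n v"
    using divdiff_rev_schubert[OF Sym_imp_Sym_inf[OF v(1)] i(1), of n] v(2) by (simp add: divdiff_eq_0_iff)
  then show "divdiff i (rev_schubert n v * schubert (u \<circ> transpose i (i + 1))) = rev_schubert n v * schubert u"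
    using divdiff_mult_sym[of i "rev_schubert n v"] divdiff_schubert[OF us i(1)] u(2) by simp
qed

section \<open>Clans\<close>

definition u_nodes :: "clan \<Rightarrow> nat set" where
  "u_nodes \<gamma> = minus_nodes \<gamma> \<union> fst ` arcs \<gamma>"

definition v_nodes :: "clan \<Rightarrow> nat set" where
  "v_nodes \<gamma> = plus_nodes \<gamma> \<union> fst ` arcs \<gamma>"

lemma u_perm_eq: "u_perm p q \<gamma> = node_label (p + q) q (u_nodes \<gamma>)"
  by (simp add: u_perm_def u_nodes_def)

lemma v_perm_eq: "v_perm p q \<gamma> = node_label (p + q) p (v_nodes \<gamma>)"
  by (simp add: v_perm_def v_nodes_def)

lemma arc_range: "is_clan p q \<gamma> \<Longrightarrow> (i, j) \<in> arcs \<gamma> \<Longrightarrow> 1 \<le> i \<and> i < j \<and> j \<le> p + q"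
  unfolding is_clan_def by blast

lemma arc_disjoint:
  assumes "is_clan p q \<gamma>" "(i, j) \<in> arcs \<gamma>" "(k, l) \<in> arcs \<gamma>" "(i, j) \<noteq> (k, l)"
  shows "i \<noteq> k" "i \<noteq> l" "j \<noteq> k" "j \<noteq> l"
proof -
  have "\<forall>(i, j)\<in>arcs \<gamma>. \<forall>(k, l)\<in>arcs \<gamma>. (i, j) \<noteq> (k, l) \<longrightarrow> {i, j} \<inter> {k, l} = {}"
    using assms(1) unfolding is_clan_def by (elim conjE)
  from bspec[OF this assms(2)] have "\<forall>(k, l)\<in>arcs \<gamma>. (i, j) \<noteq> (k, l) \<longrightarrow> {i, j} \<inter> {k, l} = {}"
    by (simp only: prod.case)
  from bspec[OF this assms(3)] have "(i, j) \<noteq> (k, l) \<longrightarrow> {i, j} \<inter> {k, l} = {}"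
    by (simp only: prod.case)
  from mp[OF this assms(4)] have "{i, j} \<inter> {k, l} = {}" .
  then show "i \<noteq> k" "i \<noteq> l" "j \<noteq> k" "j \<noteq> l" by auto
qed

lemma finite_arcs:
  assumes "is_clan p q \<gamma>" shows "finite (arcs \<gamma>)"
proof (rule finite_subset)
  show "arcs \<gamma> \<subseteq> {1..p + q} \<times> {1..p + q}"
  proof
    fix x assume "x \<in> arcs \<gamma>"
    then show "x \<in> {1..p + q} \<times> {1..p + q}" using arc_range[OF assms, of "fst x" "snd x"] by (cases x) auto
  qed
qed simp

lemma clan_signs:
  assumes "is_clan p q \<gamma>"
  shows "plus_nodes \<gamma> \<union> minus_nodes \<gamma> = {1..p + q} - (fst ` arcs \<gamma> \<union> snd ` arcs \<gamma>)"
    "plus_nodes \<gamma> \<inter> minus_nodes \<gamma> = {}"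
proof -
  have "plus_nodes \<gamma> \<union> minus_nodes \<gamma> = {1..p + q} - (fst ` arcs \<gamma> \<union> snd ` arcs \<gamma>)
    \<and> plus_nodes \<gamma> \<inter> minus_nodes \<gamma> = {}"
    using assms unfolding is_clan_def by (elim conjE) (rule conjI)
  then show "plus_nodes \<gamma> \<union> minus_nodes \<gamma> = {1..p + q} - (fst ` arcs \<gamma> \<union> snd ` arcs \<gamma>)"
    "plus_nodes \<gamma> \<inter> minus_nodes \<gamma> = {}"
    by (rule conjunct1, rule conjunct2)
qed

lemma inj_arcs:
  assumes "is_clan p q \<gamma>"
  shows "inj_on fst (arcs \<gamma>)" "inj_on snd (arcs \<gamma>)" "fst ` arcs \<gamma> \<inter> snd ` arcs \<gamma> = {}"
proof -
  show "inj_on fst (arcs \<gamma>)" "inj_on snd (arcs \<gamma>)"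
    unfolding inj_on_def using arc_disjoint[OF assms] by (metis prod.collapse)+
  have "fst x \<noteq> snd y" if "x \<in> arcs \<gamma>" "y \<in> arcs \<gamma>" for x y
  proof (cases "x = y")
    case True
    then show ?thesis using arc_range[OF assms, of "fst x" "snd x"] that by auto
  next
    case False
    then show ?thesis using arc_disjoint(2)[OF assms, of "fst x" "snd x" "fst y" "snd y"] that by auto
  qed
  then show "fst ` arcs \<gamma> \<inter> snd ` arcs \<gamma> = {}" by blast
qed

lemma clan_finite_signs:
  assumes "is_clan p q \<gamma>" shows "finite (plus_nodes \<gamma>)" "finite (minus_nodes \<gamma>)"
proof -
  have "plus_nodes \<gamma> \<union> minus_nodes \<gamma> \<subseteq> {1..p + q}" using clan_signs(1)[OF assms] by blast
  then show "finite (plus_nodes \<gamma>)" "finite (minus_nodes \<gamma>)"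
    using finite_subset[of _ "{1..p + q}"] by auto
qed

lemma arc_ends_subset:
  assumes "is_clan p q \<gamma>" shows "fst ` arcs \<gamma> \<union> snd ` arcs \<gamma> \<subseteq> {1..p + q}"
proof -
  have "fst x \<in> {1..p + q} \<and> snd x \<in> {1..p + q}" if "x \<in> arcs \<gamma>" for x
    using arc_range[OF assms, of "fst x" "snd x"] that by auto
  then show ?thesis by blast
qed

text \<open>There are as many left as right endpoints, so the numbers of plus and minus signs have
  sum p + q minus twice the number of arcs, and difference p - q.\<close>

lemma card_nodes:
  assumes "is_clan p q \<gamma>"
  shows "u_nodes \<gamma> \<subseteq> {1..p + q}" "card (u_nodes \<gamma>) = q"
    "v_nodes \<gamma> \<subseteq> {1..p + q}" "card (v_nodes \<gamma>) = p"
proof -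
  note fin = finite_arcs[OF assms] clan_finite_signs[OF assms]
  let ?P = "plus_nodes \<gamma>" and ?M = "minus_nodes \<gamma>" and ?F = "fst ` arcs \<gamma>" and ?G = "snd ` arcs \<gamma>"
  show "u_nodes \<gamma> \<subseteq> {1..p + q}" "v_nodes \<gamma> \<subseteq> {1..p + q}"
    using clan_signs(1)[OF assms] arc_ends_subset[OF assms] unfolding u_nodes_def v_nodes_def by blast+
  have FG: "card ?F = card (arcs \<gamma>)" "card ?G = card (arcs \<gamma>)" "card (?F \<union> ?G) = card ?F + card ?G"
    using inj_arcs[OF assms] fin by (simp_all add: card_image card_Un_disjoint)
  have "card (?P \<union> ?M) = card ?P + card ?M"
    using clan_signs(2)[OF assms] fin by (simp add: card_Un_disjoint)
  moreover have "card (?P \<union> ?M) = p + q - card (?F \<union> ?G)"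
    unfolding clan_signs(1)[OF assms] using arc_ends_subset[OF assms] fin by (simp add: card_Diff_subset)
  moreover have "card (?F \<union> ?G) \<le> p + q"
    using card_mono[OF _ arc_ends_subset[OF assms]] by simp
  moreover have "int (card ?P) - int (card ?M) = int p - int q"
    using assms unfolding is_clan_def by blast
  moreover have "card (u_nodes \<gamma>) = card ?M + card ?F" "card (v_nodes \<gamma>) = card ?P + card ?F"
    unfolding u_nodes_def v_nodes_def
    using clan_signs(1)[OF assms] fin by (auto intro!: card_Un_disjoint)
  ultimately show "card (u_nodes \<gamma>) = q" "card (v_nodes \<gamma>) = p"
    using FG by linarith+
qed

text \<open>The degree in x_l is at most the number of signs beyond l plus twice the number of left
  endpoints beyond l. An arc with its left end beyond l also has its right end there, so one copy of
  the left endpoints can be exchanged for right endpoints, and the total is at most the n - l nodes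
  beyond l. This keeps the expansion of \<Upsilon> inside S_n.\<close>

lemma exps_le_clan_product:
  assumes "is_clan p q \<gamma>"
  defines "n \<equiv> p + q"
  shows "exps_le (stair_exps n) (rev_schubert n (u_perm p q \<gamma>) * schubert (v_perm p q \<gamma>))"
proof -
  note L = card_nodes[OF assms(1), folded n_def]
  have su: "u_perm p q \<gamma> \<in> Sym n" "v_perm p q \<gamma> \<in> Sym n"
    unfolding u_perm_eq v_perm_eq n_def[symmetric]
    using node_label_Sym[OF L(1,2)] node_label_Sym[OF L(3,4)] by simp_all
  have "exps_le (\<lambda>l. schubert_exps (u_perm p q \<gamma>) l + schubert_exps (v_perm p q \<gamma>) l)
     (rev_schubert n (u_perm p q \<gamma>) * schubert (v_perm p q \<gamma>))"
    unfolding rev_schubert_def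
    by (intro exps_le_mult exps_le_rename_y bij_w0 exps_le_schubert[OF su(1)] exps_le_schubert[OF su(2)])
  moreover have "schubert_exps (u_perm p q \<gamma>) l + schubert_exps (v_perm p q \<gamma>) l \<le> stair_exps n l" for l
  proof (cases "l = 0")
    case True
    then show ?thesis by (simp add: schubert_exps_def)
  next
    case False
    let ?f = "\<lambda>A. {j \<in> A. l < j}"
    let ?P = "plus_nodes \<gamma>" and ?M = "minus_nodes \<gamma>" and ?F = "fst ` arcs \<gamma>" and ?G = "snd ` arcs \<gamma>"
    note fin = finite_arcs[OF assms(1)] clan_finite_signs[OF assms(1)]
    have FG: "card (?f ?F) \<le> card (?f ?G)"
    proof -
      have "card (?f ?F) = card {x \<in> arcs \<gamma>. l < fst x}"
        by (rule bij_betw_same_card[symmetric, of fst])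
          (use inj_on_subset[OF inj_arcs(1)[OF assms(1)]] in \<open>auto simp: bij_betw_def\<close>)
      also have "\<dots> \<le> card {x \<in> arcs \<gamma>. l < snd x}"
      proof (rule card_mono)
        show "{x \<in> arcs \<gamma>. l < fst x} \<subseteq> {x \<in> arcs \<gamma>. l < snd x}"
        proof
          fix x assume "x \<in> {x \<in> arcs \<gamma>. l < fst x}"
          then show "x \<in> {x \<in> arcs \<gamma>. l < snd x}"
            using arc_range[OF assms(1), of "fst x" "snd x"] by simp
        qed
      qed (use fin in simp)
      also have "\<dots> = card (?f ?G)"
        by (rule bij_betw_same_card[of snd])
          (use inj_on_subset[OF inj_arcs(2)[OF assms(1)]] in \<open>auto simp: bij_betw_def\<close>)
      finally show ?thesis .
    qed
    have "schubert_exps (u_perm p q \<gamma>) l \<le> card (?f (u_nodes \<gamma>))"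
      "schubert_exps (v_perm p q \<gamma>) l \<le> card (?f (v_nodes \<gamma>))"
      using schubert_exps_node_label[OF L(1,2)] schubert_exps_node_label[OF L(3,4)]
      by (simp_all add: u_perm_eq v_perm_eq n_def)
    moreover have "card (?f (u_nodes \<gamma>)) \<le> card (?f ?M) + card (?f ?F)"
      "card (?f (v_nodes \<gamma>)) \<le> card (?f ?P) + card (?f ?F)"
    proof -
      have "?f (A \<union> B) = ?f A \<union> ?f B" for A B by blast
      then show "card (?f (u_nodes \<gamma>)) \<le> card (?f ?M) + card (?f ?F)"
        "card (?f (v_nodes \<gamma>)) \<le> card (?f ?P) + card (?f ?F)"
        unfolding u_nodes_def v_nodes_def by (simp_all only: card_Un_le)
    qed
    moreover have "card (?f ?M) + card (?f ?P) + card (?f ?F) + card (?f ?G)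
        = card (?f ?M \<union> ?f ?P \<union> ?f ?F \<union> ?f ?G)"
    proof -
      have "?f ?M \<inter> ?f ?P = {}" "(?f ?M \<union> ?f ?P) \<inter> ?f ?F = {}" "(?f ?M \<union> ?f ?P \<union> ?f ?F) \<inter> ?f ?G = {}"
        using clan_signs[OF assms(1)] inj_arcs(3)[OF assms(1)] by blast+
      then show ?thesis using fin by (simp add: card_Un_disjoint)
    qed
    moreover have "card (?f ?M \<union> ?f ?P \<union> ?f ?F \<union> ?f ?G) \<le> card {l + 1..n}"
    proof (rule card_mono)
      have "?M \<union> ?P \<union> ?F \<union> ?G \<subseteq> {1..n}"
        using clan_signs(1)[OF assms(1)] arc_ends_subset[OF assms(1)] unfolding n_def by blast
      then show "?f ?M \<union> ?f ?P \<union> ?f ?F \<union> ?f ?G \<subseteq> {l + 1..n}" by fastforce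
    qed simp
    ultimately have "schubert_exps (u_perm p q \<gamma>) l + schubert_exps (v_perm p q \<gamma>) l \<le> card {l + 1..n}"
      using FG by linarith
    then show ?thesis using False by (simp add: stair_exps_def)
  qed
  ultimately show ?thesis by (rule exps_le_mono)
qed

section \<open>Non-crossing clans and the factorization of their polynomials\<close>

lemma noncrossingD:
  assumes "noncrossing \<gamma>" "(i, j) \<in> arcs \<gamma>" "(k, l) \<in> arcs \<gamma>"
  shows "\<not> (i < k \<and> k < j \<and> j < l)"
  using assms unfolding noncrossing_def crossings_def by blast

lemma clan_length_noncrossing:
  "noncrossing \<gamma> \<Longrightarrow> clan_length \<gamma> = (\<Sum>(i, j)\<in>arcs \<gamma>. int j - int i)"
  by (simp add: clan_length_def noncrossing_def)

context
  fixes p q n :: nat and \<Upsilon> :: "clan \<Rightarrow> xypoly"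
  assumes n: "n = p + q" and wy: "wyser_yong p q \<Upsilon>"
begin

text \<open>Since i belongs to both node sets of \<gamma>, both labellings ascend at i: this makes
  the unchanged factor symmetric and lets s_i lengthen the permutation of the other one. The two
  disjuncts of \<open>labels\<close> say which of the two labellings moves.\<close>

lemma Upsilon_step:
  assumes clan: "is_clan p q \<gamma>" "is_clan p q \<gamma>'" and i: "1 \<le> i" "i < n"
    and hecke: "hecke i \<gamma>' = \<gamma>" and len: "clan_length \<gamma>' < clan_length \<gamma>"
    and IH: "\<Upsilon> \<gamma>' = rev_schubert n (u_perm p q \<gamma>') * schubert (v_perm p q \<gamma>')"
    and labels: "u_nodes \<gamma>' = transpose i (i + 1) ` u_nodes \<gamma> \<and> i + 1 \<notin> u_nodes \<gamma> \<and> v_nodes \<gamma>' = v_nodes \<gamma>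
      \<or> v_nodes \<gamma>' = transpose i (i + 1) ` v_nodes \<gamma> \<and> i + 1 \<notin> v_nodes \<gamma> \<and> u_nodes \<gamma>' = u_nodes \<gamma>"
    and iL: "i \<in> u_nodes \<gamma>" "i \<in> v_nodes \<gamma>"
  shows "\<Upsilon> \<gamma> = rev_schubert n (u_perm p q \<gamma>) * schubert (v_perm p q \<gamma>)"
proof -
  let ?s = "transpose i (i + 1)"
  note L = card_nodes[OF clan(1), folded n]
  have u: "u_perm p q \<gamma> \<in> Sym n" "u_perm p q \<gamma> i < u_perm p q \<gamma> (i + 1)"
    using node_label_Sym[OF L(1,2)] node_label_ascent[OF L(1,2) iL(1) i(2)]
    unfolding u_perm_eq n[symmetric] .
  have v: "v_perm p q \<gamma> \<in> Sym n" "v_perm p q \<gamma> i < v_perm p q \<gamma> (i + 1)"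
    using node_label_Sym[OF L(3,4)] node_label_ascent[OF L(3,4) iL(2) i(2)]
    unfolding v_perm_eq n[symmetric] .
  have "clan_length (hecke i \<gamma>') > clan_length \<gamma>'" using hecke len by simp
  then have step: "\<Upsilon> \<gamma> = divdiff i (\<Upsilon> \<gamma>')"
    using wy clan(2) i n hecke unfolding wyser_yong_def by blast
  from labels show ?thesis
  proof
    assume *: "u_nodes \<gamma>' = ?s ` u_nodes \<gamma> \<and> i + 1 \<notin> u_nodes \<gamma> \<and> v_nodes \<gamma>' = v_nodes \<gamma>"
    then have "u_perm p q \<gamma>' = u_perm p q \<gamma> \<circ> ?s" "v_perm p q \<gamma>' = v_perm p q \<gamma>"
      using node_label_swap[OF L(1,2) i iL(1)] unfolding u_perm_eq v_perm_eq n[symmetric] by simp_all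
    then show ?thesis
      unfolding step IH using divdiff_rev_schubert_mult(1)[OF u v i] by (simp only:)
  next
    assume *: "v_nodes \<gamma>' = ?s ` v_nodes \<gamma> \<and> i + 1 \<notin> v_nodes \<gamma> \<and> u_nodes \<gamma>' = u_nodes \<gamma>"
    then have "v_perm p q \<gamma>' = v_perm p q \<gamma> \<circ> ?s" "u_perm p q \<gamma>' = u_perm p q \<gamma>"
      using node_label_swap[OF L(3,4) i iL(2)] unfolding u_perm_eq v_perm_eq n[symmetric] by simp_all
    then show ?thesis
      unfolding step IH using divdiff_rev_schubert_mult(2)[OF v u i] by (simp only:)
  qed
qed

end

lemma image_fixed: "(\<And>x. x \<in> A \<Longrightarrow> f x = x) \<Longrightarrow> f ` A = A"
  using image_cong[of A A f "\<lambda>x. x"] by simp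

lemma is_clanI:
  assumes "\<And>i j. (i, j) \<in> arcs \<gamma> \<Longrightarrow> 1 \<le> i \<and> i < j \<and> j \<le> p + q"
    and "\<And>i j k l. (i, j) \<in> arcs \<gamma> \<Longrightarrow> (k, l) \<in> arcs \<gamma> \<Longrightarrow> (i, j) \<noteq> (k, l) \<Longrightarrow> {i, j} \<inter> {k, l} = {}"
    and "plus_nodes \<gamma> \<union> minus_nodes \<gamma> = {1..p + q} - (fst ` arcs \<gamma> \<union> snd ` arcs \<gamma>)"
    and "plus_nodes \<gamma> \<inter> minus_nodes \<gamma> = {}"
    and "int (card (plus_nodes \<gamma>)) - int (card (minus_nodes \<gamma>)) = int p - int q"
  shows "is_clan p q \<gamma>"
  unfolding is_clan_def
proof (intro conjI)
  show "\<forall>(i, j)\<in>arcs \<gamma>. 1 \<le> i \<and> i < j \<and> j \<le> p + q" using assms(1) by blast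
  show "\<forall>(i, j)\<in>arcs \<gamma>. \<forall>(k, l)\<in>arcs \<gamma>. (i, j) \<noteq> (k, l) \<longrightarrow> {i, j} \<inter> {k, l} = {}"
    using assms(2) by blast
qed (fact assms)+

lemma noncrossingI:
  assumes "\<And>i j k l. (i, j) \<in> arcs \<gamma> \<Longrightarrow> (k, l) \<in> arcs \<gamma> \<Longrightarrow> \<not> (i < k \<and> k < j \<and> j < l)"
  shows "noncrossing \<gamma>"
  unfolding noncrossing_def crossings_def using assms by blast

text \<open>An arc of minimal span works: another arc with an endpoint strictly inside it would have
  to be nested in it by the non-crossing condition, and would then be shorter.\<close>

lemma innermost_arc:
  assumes clan: "is_clan p q \<gamma>" and nc: "noncrossing \<gamma>" and "\<not> matchless \<gamma>"
  obtains a b where "(a, b) \<in> arcs \<gamma>"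
    "\<forall>c. a < c \<and> c < b \<longrightarrow> c \<in> plus_nodes \<gamma> \<union> minus_nodes \<gamma>"
proof -
  obtain x where "x \<in> arcs \<gamma>" using assms(3) by (auto simp: matchless_def)
  from ex_has_least_nat[of "\<lambda>x. x \<in> arcs \<gamma>", OF this, of "\<lambda>x. snd x - fst x"]
  obtain a b where ab: "(a, b) \<in> arcs \<gamma>" and least: "\<And>k l. (k, l) \<in> arcs \<gamma> \<Longrightarrow> b - a \<le> l - k"
    by force
  show ?thesis
  proof (rule that[OF ab], intro allI impI)
    fix c assume c: "a < c \<and> c < b"
    have "c \<noteq> k \<and> c \<noteq> l" if kl: "(k, l) \<in> arcs \<gamma>" for k l
    proof (cases "(k, l) = (a, b)")
      case False
      note d = arc_disjoint[OF clan ab kl False[symmetric]]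
      have kl': "k < l" using arc_range[OF clan kl] by simp
      have "c \<noteq> k"
      proof
        assume 1: "c = k"
        then have "l < b" using noncrossingD[OF nc ab kl] c d(4) by simp
        then show False using least[OF kl] kl' c 1 by linarith
      qed
      moreover have "c \<noteq> l"
      proof
        assume 1: "c = l"
        then have "a < k" using noncrossingD[OF nc kl ab] c d(1) by simp
        then show False using least[OF kl] kl' c 1 by linarith
      qed
      ultimately show ?thesis by simp
    qed (use c in auto)
    then have "c \<noteq> fst x \<and> c \<noteq> snd x" if "x \<in> arcs \<gamma>" for x
      using that by (cases x) simp
    then have "c \<notin> fst ` arcs \<gamma> \<union> snd ` arcs \<gamma>" by blast
    moreover have "c \<in> {1..p + q}" using arc_range[OF clan ab] c by auto
    ultimately show "c \<in> plus_nodes \<gamma> \<union> minus_nodes \<gamma>"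
      unfolding clan_signs(1)[OF clan] by blast
  qed
qed

text \<open>An innermost arc is shortened by one node; an arc joining neighbours is replaced by \<open>+-\<close>.\<close>

lemma noncrossing_clan_predecessor:
  assumes clan: "is_clan p q \<gamma>" and nc: "noncrossing \<gamma>" and "\<not> matchless \<gamma>"
  obtains i \<gamma>' where "1 \<le> i" "i < p + q" "is_clan p q \<gamma>'" "noncrossing \<gamma>'" "hecke i \<gamma>' = \<gamma>"
    "clan_length \<gamma>' < clan_length \<gamma>" "i \<in> u_nodes \<gamma>" "i \<in> v_nodes \<gamma>"
    "u_nodes \<gamma>' = transpose i (i + 1) ` u_nodes \<gamma> \<and> i + 1 \<notin> u_nodes \<gamma> \<and> v_nodes \<gamma>' = v_nodes \<gamma>
      \<or> v_nodes \<gamma>' = transpose i (i + 1) ` v_nodes \<gamma> \<and> i + 1 \<notin> v_nodes \<gamma> \<and> u_nodes \<gamma>' = u_nodes \<gamma>"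
proof -
  obtain a b where ab: "(a, b) \<in> arcs \<gamma>"
    and inner: "\<forall>c. a < c \<and> c < b \<longrightarrow> c \<in> plus_nodes \<gamma> \<union> minus_nodes \<gamma>"
    using innermost_arc[OF assms] .
  define A P M where "A = arcs \<gamma> - {(a, b)}" "P = plus_nodes \<gamma>" "M = minus_nodes \<gamma>"
  note AM = this
  let ?E = "fst ` A \<union> snd ` A"
  let ?s = "transpose a (a + 1)"
  have arcs: "arcs \<gamma> = insert (a, b) A" "(a, b) \<notin> A" using ab by (auto simp: AM)
  have finA: "finite A" using finite_arcs[OF clan] by (simp add: AM)
  have finS: "finite P" "finite M" using clan_finite_signs[OF clan] by (simp_all add: AM)
  have r: "1 \<le> a" "a < b" "b \<le> p + q" using arc_range[OF clan ab] by auto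
  have Ad: "k \<noteq> a" "k \<noteq> b" "l \<noteq> a" "l \<noteq> b" "1 \<le> k" "k < l" "l \<le> p + q" if "(k, l) \<in> A" for k l
  proof -
    have kl: "(k, l) \<in> arcs \<gamma>" "(a, b) \<noteq> (k, l)" using that by (auto simp: AM)
    show "k \<noteq> a" "k \<noteq> b" "l \<noteq> a" "l \<noteq> b" "1 \<le> k" "k < l" "l \<le> p + q"
      using arc_disjoint[OF clan ab kl] arc_range[OF clan kl(1)] by simp_all
  qed
  have AA: "{i, j} \<inter> {k, l} = {}" if "(i, j) \<in> A" "(k, l) \<in> A" "(i, j) \<noteq> (k, l)" for i j k l
  proof -
    have "(i, j) \<in> arcs \<gamma>" "(k, l) \<in> arcs \<gamma>" using that by (auto simp: AM)
    from arc_disjoint[OF clan this that(3)] show ?thesis by simp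
  qed
  have "fst x \<noteq> a \<and> snd x \<noteq> a \<and> fst x \<noteq> b \<and> snd x \<noteq> b" if "x \<in> A" for x
    using Ad(1-4)[of "fst x" "snd x"] that by simp
  then have E: "a \<notin> ?E" "b \<notin> ?E" by blast+
  have ends: "fst ` arcs \<gamma> \<union> snd ` arcs \<gamma> = ?E \<union> {a, b}" by (auto simp: arcs(1))
  have signs: "P \<union> M = {1..p + q} - (?E \<union> {a, b})" "P \<inter> M = {}"
    using clan_signs[OF clan] unfolding ends AM(2,3) .
  have cardPM: "int (card P) - int (card M) = int p - int q"
    using clan unfolding is_clan_def AM by (elim conjE)
  have aPM: "a \<notin> P" "a \<notin> M" "b \<notin> P" "b \<notin> M" using signs by auto
  have Anc: "\<not> (i < k \<and> k < j \<and> j < l)" if "(i, j) \<in> insert (a, b) A" "(k, l) \<in> insert (a, b) A" for i j k l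
    using noncrossingD[OF nc] that unfolding arcs(1) by blast
  have fst_arcs: "fst ` arcs \<gamma> = insert a (fst ` A)" by (simp add: arcs(1))
  have nodes: "u_nodes \<gamma> = insert a (M \<union> fst ` A)" "v_nodes \<gamma> = insert a (P \<union> fst ` A)"
    unfolding u_nodes_def v_nodes_def fst_arcs AM(2,3) by simp_all
  then have aL: "a \<in> u_nodes \<gamma>" "a \<in> v_nodes \<gamma>" by simp_all
  have len: "clan_length \<gamma> = int b - int a + (\<Sum>(i, j)\<in>A. int j - int i)"
    using clan_length_noncrossing[OF nc] arcs finA by simp
  have a_lt: "a < p + q" using r by simp
  have \<gamma>_eq: "\<gamma> = \<lparr>arcs = insert (a, b) A, plus_nodes = P, minus_nodes = M\<rparr>"
    unfolding arcs(1)[symmetric] AM(2,3) by (cases \<gamma>) simp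
  show ?thesis
  proof (cases "b = a + 1")
    case True
    \<comment> \<open>With + on the left, a stays in \<open>v_nodes\<close> and is replaced by b = a
      + 1 in \<open>u_nodes\<close>; the opposite signs would interchange the two roles.\<close>
    define \<gamma>' where "\<gamma>' = \<lparr>arcs = A, plus_nodes = insert a P, minus_nodes = insert b M\<rparr>"
    have clan': "is_clan p q \<gamma>'"
    proof (rule is_clanI)
      show "plus_nodes \<gamma>' \<union> minus_nodes \<gamma>' = {1..p + q} - (fst ` arcs \<gamma>' \<union> snd ` arcs \<gamma>')"
      proof -
        have "insert a P \<union> insert b M = (P \<union> M) \<union> {a, b}" by blast
        also have "\<dots> = {1..p + q} - ?E" unfolding signs(1) using E r by auto
        finally show ?thesis by (simp add: \<gamma>'_def)
      qed
      show "plus_nodes \<gamma>' \<inter> minus_nodes \<gamma>' = {}"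
        using signs(2) aPM r by (auto simp: \<gamma>'_def)
      show "int (card (plus_nodes \<gamma>')) - int (card (minus_nodes \<gamma>')) = int p - int q"
        using cardPM finS aPM by (simp add: \<gamma>'_def)
      show "1 \<le> i \<and> i < j \<and> j \<le> p + q" if "(i, j) \<in> arcs \<gamma>'" for i j
        using Ad(5-7)[of i j] that by (simp add: \<gamma>'_def)
      show "{i, j} \<inter> {k, l} = {}" if "(i, j) \<in> arcs \<gamma>'" "(k, l) \<in> arcs \<gamma>'" "(i, j) \<noteq> (k, l)" for i j k l
        by (rule AA[OF _ _ that(3)]) (use that(1,2) in \<open>simp_all add: \<gamma>'_def\<close>)
    qed
    have nc': "noncrossing \<gamma>'"
      by (rule noncrossingI, rule Anc) (simp_all add: \<gamma>'_def)
    have hecke: "hecke a \<gamma>' = \<gamma>"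
      using True aPM by (auto simp: hecke_def opposite_signs_def \<gamma>'_def \<gamma>_eq)
    have len': "clan_length \<gamma>' < clan_length \<gamma>"
      using clan_length_noncrossing[OF nc'] len r by (simp add: \<gamma>'_def)
    have "?s x = x" if "x \<in> M \<union> fst ` A" for x
    proof -
      have "x \<noteq> a" "x \<noteq> a + 1" using that aPM E unfolding True by blast+
      then show ?thesis by (rule transpose_apply_other)
    qed
    then have "?s ` (M \<union> fst ` A) = M \<union> fst ` A" by (rule image_fixed)
    moreover have nodes': "u_nodes \<gamma>' = insert b (M \<union> fst ` A)" "v_nodes \<gamma>' = insert a (P \<union> fst ` A)"
      by (simp_all add: u_nodes_def v_nodes_def \<gamma>'_def)
    ultimately have "u_nodes \<gamma>' = ?s ` u_nodes \<gamma>"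
      using True by (simp add: nodes)
    moreover have "a + 1 \<notin> u_nodes \<gamma>"
      using True aPM E by (auto simp: nodes)
    moreover have "v_nodes \<gamma>' = v_nodes \<gamma>"
      by (simp only: nodes nodes')
    ultimately show ?thesis
      using that[OF r(1) a_lt clan' nc' hecke len' aL] by simp
  next
    case False
    then have ab1: "a + 1 < b" using r by simp
    then have a1: "a + 1 \<in> P \<union> M" using inner[rule_format, of "a + 1"] unfolding AM(2,3) by simp
    have a1E: "a + 1 \<notin> ?E" using a1 signs by blast
    \<comment> \<open>The left end of the arc and the sign next to it trade places, so
      \<open>swap_nodes a\<close> restores \<gamma>.\<close>
    define \<gamma>' where "\<gamma>' = \<lparr>arcs = insert (a + 1, b) A, plus_nodes = ?s ` P, minus_nodes = ?s ` M\<rparr>"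
    have Ad1: "k \<noteq> a + 1" "l \<noteq> a + 1" if "(k, l) \<in> A" for k l
    proof -
      have "k \<in> ?E" "l \<in> ?E" using imageI[OF that, of fst] imageI[OF that, of snd] by simp_all
      then show "k \<noteq> a + 1" "l \<noteq> a + 1" using a1E by metis+
    qed
    have sE: "?s ` ?E = ?E"
    proof -
      have "?s x = x" if "x \<in> ?E" for x
        by (rule transpose_apply_other) (use that E a1E in blast)+
      then show ?thesis by (rule image_fixed)
    qed
    have clan': "is_clan p q \<gamma>'"
    proof (rule is_clanI)
      show "1 \<le> i \<and> i < j \<and> j \<le> p + q" if "(i, j) \<in> arcs \<gamma>'" for i j
      proof (cases "(i, j) = (a + 1, b)")
        case False
        then have "(i, j) \<in> A" using that unfolding \<gamma>'_def by auto
        then show ?thesis using Ad(5-7) by blast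
      qed (use r ab1 in simp)
      show "{i, j} \<inter> {k, l} = {}" if kl: "(i, j) \<in> arcs \<gamma>'" "(k, l) \<in> arcs \<gamma>'" "(i, j) \<noteq> (k, l)" for i j k l
      proof -
        consider "(i, j) = (a + 1, b)" "(k, l) \<in> A" | "(i, j) \<in> A" "(k, l) = (a + 1, b)"
          | "(i, j) \<in> A" "(k, l) \<in> A" using kl by (auto simp: \<gamma>'_def)
        then show ?thesis
        proof cases
          case 1
          then show ?thesis using Ad(2,4)[OF 1(2)] Ad1[OF 1(2)] by auto
        next
          case 2
          then show ?thesis using Ad(2,4)[OF 2(1)] Ad1[OF 2(1)] by auto
        next
          case 3
          then show ?thesis using AA kl(3) by blast
        qed
      qed
      show "plus_nodes \<gamma>' \<union> minus_nodes \<gamma>' = {1..p + q} - (fst ` arcs \<gamma>' \<union> snd ` arcs \<gamma>')"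
      proof -
        have "?s ` {1..p + q} = {1..p + q}"
          using Sym_transpose[OF r(1) a_lt] unfolding Sym_def mem_Collect_eq by (rule permutes_image)
        then have "?s ` (P \<union> M) = {1..p + q} - ?s ` (?E \<union> {a, b})"
          unfolding signs(1) by (simp add: image_set_diff)
        also have "?s ` (?E \<union> {a, b}) = ?E \<union> {a + 1, b}"
          unfolding image_Un[of _ ?E] sE using ab1 by simp
        finally show ?thesis by (simp add: \<gamma>'_def image_Un insert_commute)
      qed
      show "plus_nodes \<gamma>' \<inter> minus_nodes \<gamma>' = {}"
        using signs(2) by (simp add: \<gamma>'_def flip: image_Int)
      show "int (card (plus_nodes \<gamma>')) - int (card (minus_nodes \<gamma>')) = int p - int q"
        using cardPM by (simp add: \<gamma>'_def card_image)
    qed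
    have nc': "noncrossing \<gamma>'"
    proof -
      have "\<not> (i < k \<and> k < j \<and> j < l)" if mem: "(i, j) \<in> insert (a + 1, b) A" "(k, l) \<in> insert (a + 1, b) A" for i j k l
      proof -
        consider "(i, j) = (a + 1, b)" "(k, l) = (a + 1, b)" | "(i, j) = (a + 1, b)" "(k, l) \<in> A"
          | "(i, j) \<in> A" "(k, l) = (a + 1, b)" | "(i, j) \<in> A" "(k, l) \<in> A" using mem by blast
        then show ?thesis
        proof cases
          case 2
          then show ?thesis using Anc[of a b k l] by auto
        next
          case 3
          then show ?thesis using Anc[of i j a b] Ad[OF 3(1)] Ad1[OF 3(1)] by auto
        next
          case 4
          then show ?thesis using Anc by blast
        qed auto
      qed
      then show ?thesis by (intro noncrossingI) (simp add: \<gamma>'_def)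
    qed
    have len': "clan_length \<gamma>' < clan_length \<gamma>"
    proof -
      have "(a + 1, b) \<notin> A" using Ad1(1) by blast
      then show ?thesis
        using clan_length_noncrossing[OF nc'] len finA by (simp add: \<gamma>'_def)
    qed
    have swap: "swap_nodes a \<gamma>' = \<gamma>"
    proof -
      have "(\<lambda>(x, y). (min (?s x) (?s y), max (?s x) (?s y))) x = x" if "x \<in> A" for x
      proof -
        obtain k l where x: "x = (k, l)" "(k, l) \<in> A" using \<open>x \<in> A\<close> by (cases x) auto
        then have "?s k = k" "?s l = l" "k < l" using Ad[OF x(2)] Ad1[OF x(2)] by auto
        then show ?thesis using x by simp
      qed
      then have "(\<lambda>(x, y). (min (?s x) (?s y), max (?s x) (?s y))) ` A = A" by (rule image_fixed)
      moreover have "?s b = b" using ab1 by (simp add: transpose_def)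
      ultimately show ?thesis
        using r by (simp add: swap_nodes_def Let_def \<gamma>'_def \<gamma>_eq image_image)
    qed
    \<comment> \<open>In \<gamma>' the node a + 1 is an arc end and carries no sign, so
      \<open>hecke a\<close> cannot create an arc and is decided by the length comparison.\<close>
    have "a \<notin> plus_nodes \<gamma>' \<or> a + 1 \<notin> minus_nodes \<gamma>'" "a \<notin> minus_nodes \<gamma>' \<or> a + 1 \<notin> plus_nodes \<gamma>'"
      using aPM by (auto simp: \<gamma>'_def transpose_def split: if_splits)
    then have hecke: "hecke a \<gamma>' = \<gamma>"
      using swap len' by (auto simp: hecke_def opposite_signs_def)
    have "?s x = x" if "x \<in> fst ` A" for x
      by (rule transpose_apply_other) (use that E a1E in blast)+
    then have "?s ` fst ` A = fst ` A" by (rule image_fixed)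
    then have us: "u_nodes \<gamma>' = ?s ` u_nodes \<gamma>" and vs: "v_nodes \<gamma>' = ?s ` v_nodes \<gamma>"
      unfolding nodes u_nodes_def[of \<gamma>'] v_nodes_def[of \<gamma>'] by (simp_all add: \<gamma>'_def image_Un)
    have fixed: "?s ` L = L" if "a \<in> L" "a + 1 \<in> L" for L
      using that by simp
    \<comment> \<open>The sign at a + 1 decides which node set contains both a and a + 1. That set
      is invariant under s_a, while the other one contains only a and is moved.\<close>
    show ?thesis
    proof (cases "a + 1 \<in> P")
      case True
      then have "a + 1 \<notin> M" using signs(2) by blast
      then have "a + 1 \<notin> u_nodes \<gamma>" "a + 1 \<in> v_nodes \<gamma>"
        using True a1E by (simp_all add: nodes)
      then show ?thesis
        using that[OF r(1) a_lt clan' nc' hecke len' aL] us vs fixed aL by simp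
    next
      case False
      then have "a + 1 \<notin> v_nodes \<gamma>" "a + 1 \<in> u_nodes \<gamma>"
        using False a1 a1E by (simp_all add: nodes)
      then show ?thesis
        using that[OF r(1) a_lt clan' nc' hecke len' aL] us vs fixed aL by simp
    qed
  qed
qed

lemma Upsilon_noncrossing:
  assumes n: "n = p + q" and wy: "wyser_yong p q \<Upsilon>"
    and "is_clan p q \<gamma>" "noncrossing \<gamma>"
  shows "\<Upsilon> \<gamma> = rev_schubert n (u_perm p q \<gamma>) * schubert (v_perm p q \<gamma>)"
  using assms(3,4)
proof (induction "nat (clan_length \<gamma>)" arbitrary: \<gamma> rule: less_induct)
  case less
  show ?case
  proof (cases "matchless \<gamma>")
    case True
    then show ?thesis
      using wy less.prems(1) unfolding wyser_yong_def rev_schubert_def n by blast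
  next
    case False
    obtain i \<gamma>' where i: "1 \<le> i" "i < p + q" and clan': "is_clan p q \<gamma>'" and nc': "noncrossing \<gamma>'"
      and hecke: "hecke i \<gamma>' = \<gamma>" and len: "clan_length \<gamma>' < clan_length \<gamma>"
      and iL: "i \<in> u_nodes \<gamma>" "i \<in> v_nodes \<gamma>"
      and labels: "u_nodes \<gamma>' = transpose i (i + 1) ` u_nodes \<gamma> \<and> i + 1 \<notin> u_nodes \<gamma> \<and> v_nodes \<gamma>' = v_nodes \<gamma>
        \<or> v_nodes \<gamma>' = transpose i (i + 1) ` v_nodes \<gamma> \<and> i + 1 \<notin> v_nodes \<gamma> \<and> u_nodes \<gamma>' = u_nodes \<gamma>"
      using noncrossing_clan_predecessor[OF less.prems False] .
    \<comment> \<open>Nonnegativity is needed because \<open>nat\<close> collapses negative integers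
      and the measure would then not decrease.\<close>
    have "0 \<le> clan_length \<gamma>'"
      unfolding clan_length_noncrossing[OF nc']
    proof (rule sum_nonneg)
      fix x assume "x \<in> arcs \<gamma>'"
      then show "0 \<le> (case x of (i, j) \<Rightarrow> int j - int i)"
        using arc_range[OF clan', of "fst x" "snd x"] by (cases x) simp
    qed
    then have "nat (clan_length \<gamma>') < nat (clan_length \<gamma>)" using len by simp
    from less.hyps[OF this clan' nc'] show ?thesis
      using Upsilon_step[OF n wy less.prems(1) clan' i(1) i(2)[folded n] hecke len _ labels iL] by blast
  qed
qed

section \<open>Comparison of the coefficients\<close>

theorem theoremC:
  fixes p q n :: nat and \<gamma> :: clan and v :: "nat \<Rightarrow> nat" and \<Upsilon> :: "clan \<Rightarrow> xypoly"
  assumes "p \<ge> 1" and "q \<ge> 1" and "n = p + q"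
    and "wyser_yong p q \<Upsilon>"
    and "is_clan p q \<gamma>" and "noncrossing \<gamma>"
    and "v \<in> Sym n"
  shows "structure_coeff (u_perm p q \<gamma>) v (w0 n \<circ> v_perm p q \<gamma>)
       = rename_vars (w0 n) (schubert_coeff (Sym n) (\<Upsilon> \<gamma>) (w0 n \<circ> v))"
proof -
  define u where "u = u_perm p q \<gamma>"
  define v' where "v' = v_perm p q \<gamma>"
  note u_v'_def = u_def v'_def
  let ?\<rho> = "rename_y (w0 n)" and ?\<rho>y = "rename_vars (w0 n) :: ypoly \<Rightarrow> ypoly"
  let ?K = "flag_int n (staircase n)"
  interpret \<rho>: rhom ?\<rho> by (rule rhom_rename_y[OF bij_w0])
  have u: "u \<in> Sym n" and v': "v' \<in> Sym n"
    using node_label_Sym card_nodes[OF assms(5)]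
    unfolding u_v'_def u_perm_eq v_perm_eq assms(3) by auto
  have Upsilon: "\<Upsilon> \<gamma> = rev_schubert n u * schubert v'"
    unfolding u_v'_def using Upsilon_noncrossing[OF assms(3-6)] .
  have dual: "flag_int n (schubert a * rev_schubert n b) = (if b = w0 n \<circ> a then ?K else 0)"
    if "a \<in> Sym n" "b \<in> Sym n" for a b
    using flag_int_duality[OF is_schubert_schubert[OF that(1)] that(2)] .
  obtain c where c: "is_schubert_expansion (Sym n) (\<Upsilon> \<gamma>) c"
    using exists_schubert_expansion exps_le_clan_product[OF assms(5)]
    unfolding Upsilon u_v'_def assms(3) by blast
  obtain d where d: "is_schubert_expansion Sym_inf (schubert u * schubert v) d"
    using exists_product_expansion[OF u assms(7)] by blast
  have \<rho>\<rho>: "?\<rho> (rev_schubert n w) = schubert w" for w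
    unfolding rev_schubert_def rename_y_rename_y[OF bij_w0 bij_w0] w0_comp_w0(1) rename_y_id ..
  \<comment> \<open>Reversing the y exchanges the decorations of the two factors and turns the
    expansion of \<Upsilon> into one in the dual family; this is also the source of the reversed y
    in the statement.\<close>
  have "?\<rho> (\<Upsilon> \<gamma>) = schubert u * rev_schubert n v'"
    unfolding Upsilon \<rho>.mult \<rho>\<rho> by (simp only: rev_schubert_def)
  moreover have "?\<rho> (\<Upsilon> \<gamma>) = (\<Sum>w\<in>Sym n. scalar (?\<rho>y (c w)) * rev_schubert n w)"
    using c unfolding is_schubert_expansion_Sym_iff
    by (simp add: \<rho>.sum \<rho>.mult rename_y_scalar[OF bij_w0] rev_schubert_def)
  ultimately have eq: "schubert u * rev_schubert n v' = (\<Sum>w\<in>Sym n. scalar (?\<rho>y (c w)) * rev_schubert n w)"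
    by (rule trans[OF sym])
  \<comment> \<open>Pairing with \<open>schubert v\<close> isolates the single term w = w0 \<circ>
    v.\<close>
  have "flag_int n (schubert v * (schubert u * rev_schubert n v'))
      = (\<Sum>w\<in>Sym n. ?\<rho>y (c w) * flag_int n (schubert v * rev_schubert n w))"
    unfolding eq
    by (simp add: sum_distrib_left flag_int_sum mult.left_commute[of "schubert v"] flag_int_scalar)
  also have "\<dots> = (\<Sum>w\<in>Sym n. if w = w0 n \<circ> v then ?\<rho>y (c w) * ?K else 0)"
    by (rule sum.cong[OF refl]) (use dual[OF assms(7)] in simp)
  also have "\<dots> = ?\<rho>y (c (w0 n \<circ> v)) * ?K"
    using Sym_comp[OF w0_Sym assms(7)] finite_Sym by simp
  finally have 1: "flag_int n (schubert u * schubert v * rev_schubert n v') = ?\<rho>y (c (w0 n \<circ> v)) * ?K"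
    by (simp only: ac_simps)
  \<comment> \<open>The support of d is enlarged by S_n so that the index w0 \<circ> v' is in the
    range of summation even if its coefficient is 0.\<close>
  let ?D = "{w. d w \<noteq> 0} \<union> Sym n"
  have D: "finite ?D" "?D \<subseteq> Sym_inf"
    using d Sym_subset finite_Sym unfolding is_schubert_expansion_def by auto
  \<comment> \<open>The same integral, now computed from the product expansion: duality selects w0
    \<circ> v' within S_n, and the integral kills the indices outside S_n.\<close>
  have "flag_int n (schubert u * schubert v * rev_schubert n v')
      = (\<Sum>w\<in>?D. d w * flag_int n (schubert w * rev_schubert n v'))"
    unfolding is_schubert_expansion_sum[OF d D(1) Un_upper1]
    by (simp only: sum_distrib_right flag_int_sum mult.assoc flag_int_scalar)
  also have "\<dots> = (\<Sum>w\<in>?D. if w = w0 n \<circ> v' then d w * ?K else 0)"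
  proof (rule sum.cong[OF refl])
    fix w assume w: "w \<in> ?D"
    show "d w * flag_int n (schubert w * rev_schubert n v') = (if w = w0 n \<circ> v' then d w * ?K else 0)"
    proof (cases "w \<in> Sym n")
      case True
      have "v' = w0 n \<circ> w \<longleftrightarrow> w = w0 n \<circ> v'"
        by (metis w0_comp_w0(2))
      then show ?thesis using dual[OF True v'] by simp
    next
      case False
      then have "w \<noteq> w0 n \<circ> v'" using Sym_comp[OF w0_Sym v'] by blast
      moreover have "flag_int n (schubert w * rev_schubert n v') = 0"
        using flag_int_schubert_outside False w D(2) by blast
      ultimately show ?thesis by (simp only: if_False mult_zero_right)
    qed
  qed
  also have "\<dots> = d (w0 n \<circ> v') * ?K"
    using Sym_comp[OF w0_Sym v'] D(1) by simp
  finally have "d (w0 n \<circ> v') * ?K = ?\<rho>y (c (w0 n \<circ> v)) * ?K"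
    using 1 by (rule trans[OF sym])
  \<comment> \<open>The unnormalized factor \<open>?K\<close> is nonzero and is cancelled in the
    integral domain Q[y].\<close>
  then have "d (w0 n \<circ> v') = ?\<rho>y (c (w0 n \<circ> v))"
    using flag_int_staircase_nonzero[of n] by simp
  then show ?thesis
    unfolding structure_coeff_def u_v'_def[symmetric] schubert_coeff_eqI[OF order_refl d]
      schubert_coeff_eqI[OF Sym_subset c] .
qed

end
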